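(* For $q\in\mathbb{Z}[i]$ with $(q,2)=1$, as $N(q)\to\infty$, $$\#\left\{\widetilde\chi:\ \chi \bmod q,\ \chi(-1)=-1,\ \chi\text{ primitive},\ L\left(\tfrac12,\widetilde\chi\right)\neq 0\right\}\gg\frac{\psi^*(q)}{\log N(q)},$$ with an absolute implied constant.
   Context: Let $K=\mathbb{Q}(i)$, $\mathcal{O}_K=\mathbb{Z}[i]$, and let $N$ denote the norm of elements and of ideals ($N(a+bi)=a^2+b^2$). Let $q\in\mathcal{O}_K$ with $(q,2)=1$. A character modulo $q$ is a group homomorphism $\chi:(\mathcal{O}_K/(q))^*\to\{z\in\mathbb{C}:|z|=1\}$. It is primitive if it does not factor through $(\mathcal{O}_K/(q'))^*$ for any proper divisor $q'$ of $q$ (a divisor not associate to $q$). An element of $\mathcal{O}_K$ is primary if it is congruent to $1$ modulo $(1+i)^3$; every ideal coprime to $2$ has a unique primary generator. For $\chi$ primitive modulo $q$ with $\chi(-1)=-1$, let $\widetilde\chi$ be the function on nonzero integral ideals $\mathcal A$ of $\mathcal O_K$ given by $\widetilde\chi(\mathcal A)=\chi(a)$, where $a$ is the primary generator of $\mathcal A$, if $\mathcal A$ is coprime to $2q$, and $\widetilde\chi(\mathcal A)=0$ otherwise. It is a primitive Hecke character modulo $(1+i)^3q$ of trivial infinite type. Its Hecke $L$-function is $L(s,\widetilde\chi)=\sum_{0\ne\mathcal A\subset\mathcal O_K}\widetilde\chi(\mathcal A)N(\mathcal A)^{-s}$ for $\Re(s)>1$, which continues analytically to an entire function. $\psi^*(q)$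 denotes the number of primitive characters $\chi$ modulo $q$ satisfying $\chi(-1)=-1$. *)

theory Defs
  imports
    "HOL-Complex_Analysis.Complex_Analysis"
    "HOL-Algebra.QuotRing"
    "HOL-Algebra.Divisibility"
begin

definition gauss_int :: "complex ring" where
  "gauss_int = \<lparr>carrier = {z. Re z \<in> \<int> \<and> Im z \<in> \<int>}, mult = (*), one = 1, zero = 0, add = (+)\<rparr>"

lemma cring_gauss_int: "cring gauss_int"
proof (rule cringI)
  have "\<exists>y\<in>carrier gauss_int. y + x = 0" if "x \<in> carrier gauss_int" for x
    using that by (intro bexI[of _ "- x"]) (auto simp: gauss_int_def)
  then show "abelian_group gauss_int"
    by (intro abelian_groupI) (auto simp: gauss_int_def)
  show "comm_monoid gauss_int"
    by (intro comm_monoidI) (auto simp: gauss_int_def)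
qed (auto simp: gauss_int_def algebra_simps)

abbreviation gideal :: "complex \<Rightarrow> complex set" where
  "gideal a \<equiv> cgenideal gauss_int a"

definition coprime_ideals :: "complex set \<Rightarrow> complex set \<Rightarrow> bool" where
  "coprime_ideals I J \<longleftrightarrow> I <+>\<^bsub>gauss_int\<^esub> J = carrier gauss_int"

definition gnorm :: "complex \<Rightarrow> real" where
  "gnorm z = (Re z)\<^sup>2 + (Im z)\<^sup>2"

definition nonzero_ideals :: "complex set set" where
  "nonzero_ideals = {I. ideal I gauss_int \<and> I \<noteq> {0}}"

definition ideal_norm :: "complex set \<Rightarrow> nat" where
  "ideal_norm I = card (carrier (gauss_int Quot I))"

definition residue_class :: "complex \<Rightarrow> complex \<Rightarrow> complex set" where
  "residue_class q a = gideal q +>\<^bsub>gauss_int\<^esub> a"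

abbreviation gunits :: "complex \<Rightarrow> complex set monoid" where
  "gunits q \<equiv> units_of (gauss_int Quot gideal q)"

definition circle_group :: "complex monoid" where
  "circle_group = \<lparr>carrier = {z. cmod z = 1}, mult = (*), one = 1\<rparr>"

text \<open>Extensionality makes equality of characters the equality of functions on
  the unit group, so that characters can be counted.\<close>

definition characters :: "complex \<Rightarrow> (complex set \<Rightarrow> complex) set" where
  "characters q = hom (gunits q) circle_group \<inter> extensional (carrier (gunits q))"

text \<open>For \<open>q'\<close> dividing \<open>q\<close>, the class \<open>X\<close> modulo \<open>q\<close> is reduced modulo \<open>q'\<close> by
  adding the ideal \<open>(q')\<close> to it: \<open>a + (q)\<close> becomes \<open>a + (q')\<close>.\<close>

definition factors_through :: "complex \<Rightarrow> complex \<Rightarrow> (complex set \<Rightarrow> complex) \<Rightarrow> bool" where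
  "factors_through q q' \<phi> \<longleftrightarrow>
     (\<exists>\<phi>'\<in>characters q'. \<forall>X\<in>carrier (gunits q). \<phi> X = \<phi>' (gideal q' <+>\<^bsub>gauss_int\<^esub> X))"

definition primitive_char :: "complex \<Rightarrow> (complex set \<Rightarrow> complex) \<Rightarrow> bool" where
  "primitive_char q \<phi> \<longleftrightarrow>
     \<phi> \<in> characters q \<and>
     (\<forall>q'\<in>carrier gauss_int. q' divides\<^bsub>gauss_int\<^esub> q \<and> \<not> q' \<sim>\<^bsub>gauss_int\<^esub> q
        \<longrightarrow> \<not> factors_through q q' \<phi>)"

definition odd_primitive_chars :: "complex \<Rightarrow> (complex set \<Rightarrow> complex) set" where
  "odd_primitive_chars q = {\<phi>. primitive_char q \<phi> \<and> \<phi> (residue_class q (-1)) = -1}"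

definition psi_star :: "complex \<Rightarrow> nat" where
  "psi_star q = card (odd_primitive_chars q)"

definition primary :: "complex \<Rightarrow> bool" where
  "primary a \<longleftrightarrow> a \<in> carrier gauss_int \<and> a - 1 \<in> gideal ((1 + \<i>) ^ 3)"

definition primary_generator :: "complex set \<Rightarrow> complex" where
  "primary_generator I = (THE a. primary a \<and> I = gideal a)"

definition hecke_char :: "complex \<Rightarrow> (complex set \<Rightarrow> complex) \<Rightarrow> complex set \<Rightarrow> complex" where
  "hecke_char q \<phi> = (\<lambda>I\<in>nonzero_ideals.
     if coprime_ideals I (gideal (2 * q)) then \<phi> (residue_class q (primary_generator I)) else 0)"

text \<open>The series only converges absolutely for \<open>Re s > 1\<close>; the \<open>L\<close>-function is
  its entire continuation, which is unique by the identity theorem. Only for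
  characters whose \<open>L\<close>-function does continue to the whole plane (such as those
  arising from odd primitive characters) is the description meaningful.\<close>

definition hecke_L :: "(complex set \<Rightarrow> complex) \<Rightarrow> complex \<Rightarrow> complex" where
  "hecke_L \<theta> = (THE L. L holomorphic_on UNIV \<and>
     (\<forall>s. Re s > 1 \<longrightarrow>
        L s = (\<Sum>\<^sub>\<infinity>I\<in>nonzero_ideals. \<theta> I * of_nat (ideal_norm I) powr (- s))))"

end

theory Submission
  imports Defs "HOL-Algebra.Multiplicative_Group"
begin

text \<open>By Cauchy-Schwarz the number of nonvanishing central values is at least \<open>\<bar>M\<^sub>1\<bar>\<^sup>2 / M\<^sub>2\<close>, where
  \<open>M\<^sub>1\<close> and \<open>M\<^sub>2\<close> are the first and second moments. No functional equation is needed. Put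
  \<open>Q = (1 + \<i>)\<^sup>3 q\<close> and split the \<open>L\<close>-series into residue classes modulo \<open>Q\<close>. Each class gives an
  Epstein-Hurwitz zeta function; after subtracting a function that does not depend on the class
  (and cancels because \<open>\<chi>\<close> is nontrivial) it is entire, and its value at \<open>1/2\<close> is
  \<open>H(r) = 1/\<bar>r\<bar> + O(1/\<bar>Q\<bar>)\<close>, where \<open>r\<close> is the representative of least absolute value. So
  \<open>L(1/2, \<chi>) = \<Sum> \<chi>(r) H(r)\<close> over the primary residues \<open>r\<close>. For the second moment, positivity allows
  summing over all characters, and orthogonality leaves \<open>\<phi>(q) \<Sum> \<bar>H(r)\<bar>\<^sup>2\<close> over \<open>r\<close> coprime to \<open>q\<close>,
  which is \<open>O(\<psi>\<^sup>*(q) log N(q))\<close>. In the first moment, \<open>r = 1\<close> gives the main term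
  \<open>\<psi>\<^sup>*(q)\<close>; inclusion-exclusion over the prime divisors of \<open>q\<close> bounds the other terms by
  \<open>O(2\<^bsup>\<omega>(q)\<^esup> \<surd>N(q)) = o(\<psi>\<^sup>*(q))\<close>.\<close>

section \<open>Gaussian integers\<close>

text \<open>Crude bounds lose a factor that can reach the size of log log N(q). If the second moment
  were summed over all residues it would be of order \<phi>(q) log N(q), while the quotient of
  \<phi>(q) by the number of primitive characters behaves like the product of 1 + 1/N(p) over the
  primes dividing q, which is unbounded. The condition that r be coprime to q saves just such a
  product, and a sieve recovers it; what is left over is a convergent product of factors 1 -
  O(1/N(p)^2). The continuation is elementary for a different reason. As u tends to 0, the theta
  function of a shifted lattice depends on the shift only through terms smaller than any power of u.
  The difference of two such functions therefore decays rapidly at both ends and has an entire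
  Mellin transform; the pole stays in the common term. The main term 1/|r| is the contribution of a
  single lattice vector. Arithmetic takes place in the type \<open>gint\<close>, where residues,
  Bezout coefficients and prime factors come from the Euclidean type classes; \<open>cof\<close>
  carries the results back to the complex numbers.\<close>

datatype gint = GInt (gre: int) (gim: int)

lemma gint_eq_iff: "x = y \<longleftrightarrow> gre x = gre y \<and> gim x = gim y"
  by (cases x; cases y) auto

instantiation gint :: comm_ring_1
begin

definition "0 = GInt 0 0"
definition "1 = GInt 1 0"
definition "x + y = GInt (gre x + gre y) (gim x + gim y)"
definition "x - y = GInt (gre x - gre y) (gim x - gim y)"
definition "- x = GInt (- gre x) (- gim x)"
definition "x * y = GInt (gre x * gre y - gim x * gim y) (gre x * gim y + gim x * gre y)"

lemma gint_simps [simp]: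
  "gre 0 = 0" "gim 0 = 0" "gre 1 = 1" "gim 1 = 0"
  "gre (x + y) = gre x + gre y" "gim (x + y) = gim x + gim y"
  "gre (x - y) = gre x - gre y" "gim (x - y) = gim x - gim y"
  "gre (- x) = - gre x" "gim (- x) = - gim x"
  "gre (x * y) = gre x * gre y - gim x * gim y"
  "gim (x * y) = gre x * gim y + gim x * gre y"
  by (simp_all add: zero_gint_def one_gint_def plus_gint_def minus_gint_def uminus_gint_def times_gint_def)

instance
  by standard (simp_all add: gint_eq_iff algebra_simps)

end

lemma gre_of_nat [simp]: "gre (of_nat n) = int n" and gim_of_nat [simp]: "gim (of_nat n) = 0"
  by (induction n) auto

lemma gre_of_int [simp]: "gre (of_int n) = n" and gim_of_int [simp]: "gim (of_int n) = 0"
  by (cases n rule: int_cases2; simp)+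

lemma gre_numeral [simp]: "gre (numeral n) = numeral n" and gim_numeral [simp]: "gim (numeral n) = 0"
  using gre_of_nat[of "numeral n"] gim_of_nat[of "numeral n"] by simp_all

definition gnm :: "gint \<Rightarrow> int" where "gnm z = (gre z)\<^sup>2 + (gim z)\<^sup>2"

definition gcnj :: "gint \<Rightarrow> gint" where "gcnj z = GInt (gre z) (- gim z)"

lemma gcnj_simps [simp]: "gre (gcnj z) = gre z" "gim (gcnj z) = - gim z"
  by (simp_all add: gcnj_def)

lemma gcnj_mult [simp]: "gcnj (x * y) = gcnj x * gcnj y" and gcnj_diff [simp]: "gcnj (x - y) = gcnj x - gcnj y"
  and gcnj_gcnj [simp]: "gcnj (gcnj x) = x"
  by (simp_all add: gint_eq_iff)

lemma mult_gcnj: "z * gcnj z = of_int (gnm z)"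
  by (simp add: gint_eq_iff gnm_def power2_eq_square)

lemma gnm_mult: "gnm (x * y) = gnm x * gnm y"
  by (simp add: gnm_def power2_eq_square algebra_simps)

lemma gnm_nonneg [simp]: "gnm z \<ge> 0"
  by (simp add: gnm_def)

lemma gnm_eq_0_iff [simp]: "gnm z = 0 \<longleftrightarrow> z = 0"
  by (simp add: gnm_def gint_eq_iff sum_power2_eq_zero_iff)

lemma gnm_0 [simp]: "gnm 0 = 0" and gnm_1 [simp]: "gnm 1 = 1" and gnm_gcnj [simp]: "gnm (gcnj z) = gnm z"
  and gnm_minus [simp]: "gnm (- z) = gnm z"
  by (simp_all add: gnm_def)

lemma gnm_pos_iff [simp]: "gnm z > 0 \<longleftrightarrow> z \<noteq> 0"
  using gnm_nonneg[of z] gnm_eq_0_iff[of z] by linarith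

instance gint :: idom
proof
  fix x y :: gint assume "x \<noteq> 0" "y \<noteq> 0"
  then show "x * y \<noteq> 0" using gnm_mult[of x y] gnm_eq_0_iff[of "x * y"] by auto
qed

text \<open>Division rounds to the nearest Gaussian integer. Thus \<open>a mod b\<close> depends only on the class of \<open>a\<close>,
  and \<open>(a mod b) / b\<close> lies in the unit square centred at \<open>0\<close>.\<close>

definition rdiv :: "int \<Rightarrow> int \<Rightarrow> int" where "rdiv a n = (2 * a + n) div (2 * n)"

lemma rdiv_add_mult: "n \<noteq> 0 \<Longrightarrow> rdiv (a + c * n) n = c + rdiv a n"
proof -
  assume "n \<noteq> 0"
  have "2 * (a + c * n) + n = (2 * a + n) + c * (2 * n)" by (simp add: algebra_simps)
  then show ?thesis using \<open>n \<noteq> 0\<close> unfolding rdiv_def by (metis div_mult_self1 mult_eq_0_iff zero_neq_numeral add.commute)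
qed

lemma rdiv_mult: "n \<noteq> 0 \<Longrightarrow> rdiv (c * n) n = c"
  using rdiv_add_mult[of n 0 c] by (cases "n > 0") (simp_all add: rdiv_def div_pos_pos_trivial div_neg_neg_trivial)

lemma rdiv_mult_mult: "c > 0 \<Longrightarrow> rdiv (c * a) (c * n) = rdiv a n"
proof -
  assume "c > 0"
  have "2 * (c * a) + c * n = c * (2 * a + n)" "2 * (c * n) = c * (2 * n)" by (simp_all add: algebra_simps)
  then show ?thesis using \<open>c > 0\<close> unfolding rdiv_def by simp
qed

lemma rdiv_bound:
  assumes "n > 0"
  shows "2 * \<bar>a - rdiv a n * n\<bar> \<le> n"
proof -
  define k where "k = rdiv a n"
  have "2 * a + n = (2 * n) * k + (2 * a + n) mod (2 * n)" unfolding k_def rdiv_def by simp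
  moreover have "0 \<le> (2 * a + n) mod (2 * n)" "(2 * a + n) mod (2 * n) < 2 * n" using assms by simp_all
  ultimately have "- n \<le> 2 * (a - k * n)" "2 * (a - k * n) < n" by (simp_all add: algebra_simps)
  then show ?thesis unfolding k_def by (simp add: abs_if)
qed

instantiation gint :: "{divide, modulo}"
begin
definition "x div y = GInt (rdiv (gre (x * gcnj y)) (gnm y)) (rdiv (gim (x * gcnj y)) (gnm y))"
definition "x mod y = x - (x div y) * (y :: gint)"
instance ..
end

text \<open>Rounding commutes with translation by integers. Through this \<open>a mod b\<close> is
  constant on residue classes, so that the fixed points of \<open>mod\<close> can serve as
  representatives.\<close>

lemma gint_div_add_mult: "b \<noteq> 0 \<Longrightarrow> (a + c * b) div b = c + a div (b::gint)"
proof -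
  assume b: "b \<noteq> 0"
  have "(a + c * b) * gcnj b = a * gcnj b + c * of_int (gnm b)"
    by (simp only: mult_gcnj[symmetric] algebra_simps)
  then show ?thesis using b by (simp add: divide_gint_def gint_eq_iff rdiv_add_mult)
qed

lemma gint_div_mult_self: "b \<noteq> 0 \<Longrightarrow> (c * b) div b = (c::gint)"
  using gint_div_add_mult[of b 0 c] rdiv_mult[of "gnm b" 0] by (simp add: divide_gint_def gint_eq_iff)

lemma gint_div_mult_mult: "c \<noteq> 0 \<Longrightarrow> (c * a) div (c * b) = a div (b::gint)"
proof -
  assume c: "c \<noteq> 0"
  have "c * a * gcnj (c * b) = of_int (gnm c) * (a * gcnj b)"
    by (simp only: mult_gcnj[symmetric] gcnj_mult algebra_simps)
  then show ?thesis using c by (simp add: divide_gint_def gint_eq_iff rdiv_mult_mult gnm_mult)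
qed

text \<open>Each coordinate of (a mod b)/b is at most 1/2 in absolute value, and 1/4 + 1/4 = 1/2.
  This gives both the Euclidean descent and the bound on least residues.\<close>

lemma gnm_mod_le:
  fixes a b :: gint
  assumes b: "b \<noteq> 0"
  shows "2 * gnm (a mod b) \<le> gnm b"
proof -
  define w where "w = (a mod b) * gcnj b"
  define n where "n = gnm b"
  have n: "n > 0" using b by (simp add: n_def)
  have "w = a * gcnj b - (a div b) * of_int n"
    by (simp only: w_def n_def mult_gcnj[symmetric] modulo_gint_def algebra_simps)
  then have "gre w = gre (a * gcnj b) - rdiv (gre (a * gcnj b)) n * n"
    "gim w = gim (a * gcnj b) - rdiv (gim (a * gcnj b)) n * n"
    by (simp_all add: divide_gint_def n_def)
  then have "2 * \<bar>gre w\<bar> \<le> n" "2 * \<bar>gim w\<bar> \<le> n"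
    using rdiv_bound[OF n] by metis+
  then have "(2 * \<bar>gre w\<bar>)\<^sup>2 \<le> n\<^sup>2" "(2 * \<bar>gim w\<bar>)\<^sup>2 \<le> n\<^sup>2"
    using power_mono[of "2 * \<bar>gre w\<bar>" n 2] power_mono[of "2 * \<bar>gim w\<bar>" n 2] by simp_all
  then have "2 * gnm w \<le> n\<^sup>2" by (simp add: gnm_def[of w] power_mult_distrib)
  moreover have "gnm w = gnm (a mod b) * n" by (simp only: w_def n_def gnm_mult gnm_gcnj)
  ultimately have "(2 * gnm (a mod b)) * n \<le> n * n" by (simp add: power2_eq_square)
  then show ?thesis using n unfolding n_def by simp
qed

lemma gint_unit_iff: "(a::gint) dvd 1 \<longleftrightarrow> gnm a = 1"
proof
  assume "a dvd 1"
  then obtain b where "1 = a * b" by (elim dvdE)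
  then have "gnm a * gnm b = 1" using gnm_mult[of a b] by simp
  then show "gnm a = 1" using gnm_nonneg[of a] by (metis pos_zmult_eq_1_iff gnm_pos_iff gnm_eq_0_iff mult_zero_left zero_neq_one)
next
  assume "gnm a = 1"
  then have "a * gcnj a = 1" by (simp add: mult_gcnj)
  then show "a dvd 1" by (metis dvd_triv_left)
qed

lemma gnm_eq_1_cases:
  assumes "gnm a = 1"
  shows "a = 1 \<or> a = - 1 \<or> a = GInt 0 1 \<or> a = GInt 0 (-1)"
proof -
  have "(gre a)\<^sup>2 \<le> 1" "(gim a)\<^sup>2 \<le> 1" using assms unfolding gnm_def by (smt (verit) zero_le_power2)+
  then have "\<bar>gre a\<bar> \<le> 1" "\<bar>gim a\<bar> \<le> 1" using abs_le_square_iff[of _ "1::int"] by simp_all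
  then have "gre a \<in> {-1,0,1}" "gim a \<in> {-1,0,1}" by auto
  then show ?thesis using assms by (auto simp: gnm_def gint_eq_iff)
qed

section \<open>Euclidean ring structure and normalised associates\<close>

instantiation gint :: normalization_semidom
begin

text \<open>The cases are the four half-open quadrants, each a unit multiple of the first. Nonzero
  normalised elements have positive real and nonnegative imaginary part, which fixes one prime in
  each class of associates.\<close>

definition "unit_factor z = (if z = 0 then 0 else if gre z > 0 \<and> gim z \<ge> 0 then 1
  else if gre z \<le> 0 \<and> gim z > 0 then GInt 0 1 else if gre z < 0 \<and> gim z \<le> 0 then - 1 else GInt 0 (-1))"
definition "normalize z = z * gcnj (unit_factor z)" for z :: gint

instance
proof
  fix a b :: gint
  show "a div 0 = 0" by (simp add: divide_gint_def rdiv_def gint_eq_iff)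
  show "b \<noteq> 0 \<Longrightarrow> (a * b) div b = a" by (rule gint_div_mult_self)
  show "unit_factor (0::gint) = 0" by (simp add: unit_factor_gint_def)
  show "unit_factor a = a" if "a dvd 1"
  proof -
    have "a = 1 \<or> a = - 1 \<or> a = GInt 0 1 \<or> a = GInt 0 (-1)"
      using that by (intro gnm_eq_1_cases) (simp add: gint_unit_iff)
    then show ?thesis by (elim disjE) (simp_all add: unit_factor_gint_def gint_eq_iff)
  qed
  show "a \<noteq> 0 \<Longrightarrow> unit_factor a dvd 1"
    by (auto simp: gint_unit_iff unit_factor_gint_def gnm_def)
  show "unit_factor (a * b) = a * unit_factor b" if "a dvd 1"
  proof -
    have "a = 1 \<or> a = - 1 \<or> a = GInt 0 1 \<or> a = GInt 0 (-1)"
      using that by (intro gnm_eq_1_cases) (simp add: gint_unit_iff)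
    then show ?thesis
    proof (elim disjE)
      assume "a = - 1" show ?thesis unfolding \<open>a = - 1\<close>
        by (cases b) (auto simp: unit_factor_gint_def gint_eq_iff)
    next
      assume "a = GInt 0 1" show ?thesis unfolding \<open>a = GInt 0 1\<close>
        by (cases b) (auto simp: unit_factor_gint_def gint_eq_iff)
    next
      assume "a = GInt 0 (-1)" show ?thesis unfolding \<open>a = GInt 0 (-1)\<close>
        by (cases b) (auto simp: unit_factor_gint_def gint_eq_iff)
    qed simp
  qed
  show "unit_factor a * normalize a = a"
    by (cases a) (auto simp: normalize_gint_def unit_factor_gint_def gint_eq_iff)
  show "normalize (0::gint) = 0" by (simp add: normalize_gint_def)
qed
end

instantiation gint :: normalization_euclidean_semiring
begin
definition "euclidean_size z = nat (gnm z)"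
instance
proof
  fix a b :: gint
  show "a div b * b + a mod b = a" by (simp add: modulo_gint_def)
  show "euclidean_size (0::gint) = 0" by (simp add: euclidean_size_gint_def)
  show "b \<noteq> 0 \<Longrightarrow> euclidean_size (a mod b) < euclidean_size b"
  proof -
    assume "b \<noteq> 0"
    then have "gnm b > 0" "2 * gnm (a mod b) \<le> gnm b" by (simp_all add: gnm_mod_le)
    then have "gnm (a mod b) < gnm b" by linarith
    then show ?thesis unfolding euclidean_size_gint_def using gnm_nonneg[of "a mod b"] by linarith
  qed
  show "b \<noteq> 0 \<Longrightarrow> euclidean_size a \<le> euclidean_size (a * b)"
  proof -
    assume "b \<noteq> 0"
    then have "1 \<le> gnm b" by (simp add: int_one_le_iff_zero_less)
    then have "gnm a * 1 \<le> gnm a * gnm b" by (intro mult_left_mono) auto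
    then show ?thesis by (simp add: euclidean_size_gint_def gnm_mult nat_mono)
  qed
qed
end

instantiation gint :: euclidean_ring_gcd
begin
definition "(gcd :: gint \<Rightarrow> _) = Euclidean_Algorithm.gcd"
definition "(lcm :: gint \<Rightarrow> _) = Euclidean_Algorithm.lcm"
definition "(Gcd :: gint set \<Rightarrow> _) = Euclidean_Algorithm.Gcd"
definition "(Lcm :: gint set \<Rightarrow> _) = Euclidean_Algorithm.Lcm"
instance by standard (simp_all add: gcd_gint_def lcm_gint_def Gcd_gint_def Lcm_gint_def)
end

instance gint :: euclidean_ring_cancel
proof
  fix a b c :: gint
  show "b \<noteq> 0 \<Longrightarrow> (a + c * b) div b = c + a div b" by (rule gint_div_add_mult)
  show "c \<noteq> 0 \<Longrightarrow> (c * a) div (c * b) = a div b" by (rule gint_div_mult_mult)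
qed

section \<open>Embedding into the complex numbers\<close>

definition cof :: "gint \<Rightarrow> complex" where "cof z = Complex (of_int (gre z)) (of_int (gim z))"

lemma Re_cof [simp]: "Re (cof z) = of_int (gre z)" and Im_cof [simp]: "Im (cof z) = of_int (gim z)"
  by (simp_all add: cof_def)

lemma cof_simps [simp]: "cof 0 = 0" "cof 1 = 1" "cof (x + y) = cof x + cof y" "cof (x - y) = cof x - cof y"
  "cof (- x) = - cof x" "cof (x * y) = cof x * cof y"
  by (simp_all add: complex_eq_iff)

lemma cof_numeral [simp]: "cof (numeral n) = numeral n"
  by (simp add: complex_eq_iff)

lemma cof_eq_iff [simp]: "cof x = cof y \<longleftrightarrow> x = y"
  by (simp add: complex_eq_iff gint_eq_iff)

lemma cof_eq_0_iff [simp]: "cof x = 0 \<longleftrightarrow> x = 0"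
  using cof_eq_iff[of x 0] by (simp del: cof_eq_iff)

lemma cmod_cof_power2: "(cmod (cof x))\<^sup>2 = of_int (gnm x)"
  by (simp add: cmod_power2 gnm_def)

lemma gnorm_cof: "gnorm (cof x) = of_int (gnm x)"
  by (simp add: gnorm_def gnm_def)

lemma range_cof: "range cof = carrier gauss_int"
proof -
  have "z \<in> range cof" if "Re z \<in> \<int>" "Im z \<in> \<int>" for z
  proof -
    from that(1) obtain a where "Re z = of_int a" by (rule Ints_cases)
    moreover from that(2) obtain b where "Im z = of_int b" by (rule Ints_cases)
    ultimately have "z = cof (GInt a b)" by (simp add: complex_eq_iff)
    then show ?thesis by simp
  qed
  then show ?thesis by (auto simp: gauss_int_def)
qed

section \<open>Characters of finite abelian groups\<close>

abbreviation chars :: "('a, 'b) monoid_scheme \<Rightarrow> ('a \<Rightarrow> complex) set" where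
  "chars G \<equiv> hom G circle_group \<inter> extensional (carrier G)"

lemma circle_group_simps [simp]: "carrier circle_group = {z. cmod z = 1}" "x \<otimes>\<^bsub>circle_group\<^esub> y = x * y"
  "\<one>\<^bsub>circle_group\<^esub> = 1"
  by (simp_all add: circle_group_def)

lemma char_norm: "\<phi> \<in> chars G \<Longrightarrow> x \<in> carrier G \<Longrightarrow> cmod (\<phi> x) = 1"
  by (auto simp: hom_def Pi_def)

lemma char_mult: "\<phi> \<in> chars G \<Longrightarrow> x \<in> carrier G \<Longrightarrow> y \<in> carrier G \<Longrightarrow> \<phi> (x \<otimes>\<^bsub>G\<^esub> y) = \<phi> x * \<phi> y"
  by (auto simp: hom_def)

context comm_group
begin

lemma char_one: "\<phi> \<in> chars G \<Longrightarrow> \<phi> \<one> = 1"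
  using char_mult[of \<phi> G \<one> \<one>] char_norm[of \<phi> G \<one>] by force

text \<open>One cyclic step: if n is the order of x modulo H, then
  \<open>h \<otimes> x [^] k \<mapsto> \<psi> h * c ^ k\<close> is well defined, because two ways of
  writing an element differ in the exponent by a multiple of n. The value at x stays prescribed,
  which is what a separating character needs.\<close>

lemma extend_char_step:
  assumes H: "subgroup H G" and x: "x \<in> carrier G"
    and \<psi>: "\<And>a b. a \<in> H \<Longrightarrow> b \<in> H \<Longrightarrow> \<psi> (a \<otimes> b) = \<psi> a * (\<psi> b :: complex)"
       "\<And>a. a \<in> H \<Longrightarrow> cmod (\<psi> a) = 1"
    and n: "n > 0" "\<And>j. x [^] j \<in> H \<longleftrightarrow> n dvd (j::nat)" and c: "c ^ n = \<psi> (x [^] n)"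
  shows "\<exists>H' \<psi>'. subgroup H' G \<and> H \<subseteq> H' \<and> x \<in> H' \<and> (\<forall>a\<in>H'. \<forall>b\<in>H'. \<psi>' (a \<otimes> b) = \<psi>' a * \<psi>' b)
     \<and> (\<forall>a\<in>H'. cmod (\<psi>' a) = 1) \<and> (\<forall>a\<in>H. \<psi>' a = \<psi> a) \<and> \<psi>' x = c"
proof -
  interpret H: subgroup H G by (rule H)
  have nH: "x [^] n \<in> H" using n(2)[of n] by simp
  have psi1: "\<psi> \<one> = 1" using \<psi>(1)[of \<one> \<one>] \<psi>(2)[of \<one>] by force
  have pow: "\<psi> (x [^] (n * m)) = c ^ (n * m)" for m
  proof (induction m)
    case (Suc m)
    have "x [^] (n * Suc m) = x [^] n \<otimes> x [^] (n * m)" using x by (simp add: nat_pow_mult)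
    moreover have "x [^] (n * m) \<in> H" using n(2) by simp
    ultimately show ?case using \<psi>(1) nH Suc c by (simp add: power_add)
  qed (simp add: psi1)
  have wd_aux: "\<psi> h * c ^ k = \<psi> h' * c ^ k'"
    if "h \<in> H" "h' \<in> H" "h \<otimes> x [^] k = h' \<otimes> x [^] k'" "k \<le> k'" for h h' and k k' :: nat
  proof -
    have "h \<otimes> x [^] k = (h' \<otimes> x [^] (k' - k)) \<otimes> x [^] k"
      using that x by (simp add: m_assoc nat_pow_mult)
    then have e: "h = h' \<otimes> x [^] (k' - k)" using that x by (metis H.mem_carrier m_closed nat_pow_closed right_cancel)
    then have "x [^] (k' - k) = inv h' \<otimes> h" using that x by (metis H.mem_carrier inv_closed inv_solve_left nat_pow_closed m_closed)
    then have inH: "x [^] (k' - k) \<in> H" using that by simp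
    then obtain m where "k' - k = n * m" using n(2) by (meson dvdE)
    then have "\<psi> (x [^] (k' - k)) = c ^ (k' - k)" using pow by simp
    then have "\<psi> h = \<psi> h' * c ^ (k' - k)" using e \<psi>(1) that inH by simp
    then show ?thesis using that(4) by (simp add: power_add[symmetric] mult.assoc)
  qed
  have wd: "\<psi> h * c ^ k = \<psi> h' * c ^ k'"
    if "h \<in> H" "h' \<in> H" "h \<otimes> x [^] k = h' \<otimes> x [^] k'" for h h' and k k' :: nat
  proof (cases "k \<le> k'")
    case True show ?thesis by (rule wd_aux[OF that True])
  next
    case False
    then have "k' \<le> k" by simp
    from wd_aux[OF that(2,1) that(3)[symmetric] this] show ?thesis by (rule sym)
  qed
  define H' where "H' = {h \<otimes> x [^] (k::nat) | h k. h \<in> H}"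
  define \<psi>' where "\<psi>' y = (SOME v. \<exists>h (k::nat). h \<in> H \<and> y = h \<otimes> x [^] k \<and> v = \<psi> h * c ^ k)" for y
  have psi': "\<psi>' (h \<otimes> x [^] k) = \<psi> h * c ^ k" if "h \<in> H" for h and k :: nat
    unfolding \<psi>'_def
  proof (rule some_equality)
    show "\<exists>h' k'. h' \<in> H \<and> h \<otimes> x [^] k = h' \<otimes> x [^] (k'::nat) \<and> \<psi> h * c ^ k = \<psi> h' * c ^ k'"
      using that by blast
    fix v assume "\<exists>h' k'. h' \<in> H \<and> h \<otimes> x [^] k = h' \<otimes> x [^] (k'::nat) \<and> v = \<psi> h' * c ^ k'"
    then obtain h' k' where *: "h' \<in> H" "h \<otimes> x [^] k = h' \<otimes> x [^] (k'::nat)" "v = \<psi> h' * c ^ k'" by blast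
    show "v = \<psi> h * c ^ k" unfolding *(3) by (rule wd[OF *(1) that *(2)[symmetric]])
  qed
  have "cmod c ^ n = 1" using c \<psi>(2)[OF nH] by (metis norm_power)
  then have nc: "cmod c = 1" using n(1) power_eq_imp_eq_base[of "cmod c" n 1] by simp
  have H'I: "h \<otimes> x [^] k \<in> H'" if "h \<in> H" for h and k :: nat using that unfolding H'_def by blast
  have "subgroup H' G"
  proof (rule subgroupI)
    show "H' \<subseteq> carrier G" using x unfolding H'_def by auto
    show "H' \<noteq> {}" using H'I[of \<one> 0] by auto
    fix a assume "a \<in> H'"
    then obtain h k where a: "a = h \<otimes> x [^] (k::nat)" "h \<in> H" unfolding H'_def by auto
    \<comment> \<open>Elements of \<open>H'\<close> are written with natural exponents, so the
      inverse of x^k is taken as x^(nk - k) times the inverse of x^(nk), where the latter factor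
      lies in H.\<close>
    have "x [^] (n * k) \<in> H" using n(2) by simp
    then have hh: "inv h \<otimes> inv (x [^] (n * k)) \<in> H" using a by auto
    define X where "X = x [^] (n * k)"
    define Y where "Y = x [^] (n * k - k)"
    have XY: "X \<in> carrier G" "Y \<in> carrier G" "x [^] k \<in> carrier G" "h \<in> carrier G"
      using x a by (simp_all add: X_def Y_def)
    have "k \<le> n * k" using n(1) by simp
    then have e: "x [^] k \<otimes> Y = X" using x by (simp add: nat_pow_mult X_def Y_def)
    have "a \<otimes> ((inv h \<otimes> inv X) \<otimes> Y) = (h \<otimes> inv h) \<otimes> ((x [^] k \<otimes> Y) \<otimes> inv X)"
      unfolding a(1) using XY by (simp only: m_ac m_closed inv_closed)
    also have "\<dots> = \<one>" unfolding e using XY by simp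
    finally have "inv a = (inv h \<otimes> inv X) \<otimes> Y"
      using XY a(1) by (intro comm_inv_char) auto
    then have "inv a = (inv h \<otimes> inv (x [^] (n * k))) \<otimes> x [^] (n * k - k)" by (simp only: X_def Y_def)
    then show "inv a \<in> H'" using H'I[OF hh] by simp
    fix b assume "b \<in> H'"
    then obtain h' k' where b: "b = h' \<otimes> x [^] (k'::nat)" "h' \<in> H" unfolding H'_def by auto
    have "a \<otimes> b = (h \<otimes> h') \<otimes> x [^] (k + k')" using a b x by (simp add: nat_pow_mult[symmetric] m_ac)
    then show "a \<otimes> b \<in> H'" using H'I[of "h \<otimes> h'"] a b by simp
  qed
  moreover have "H \<subseteq> H'" using H'I[of _ 0] by force
  moreover have "x \<in> H'" using H'I[of \<one> 1] x by simp
  moreover have "\<psi>' (a \<otimes> b) = \<psi>' a * \<psi>' b" if "a \<in> H'" "b \<in> H'" for a b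
  proof -
    from that obtain h k h' k' where ab: "a = h \<otimes> x [^] (k::nat)" "h \<in> H" "b = h' \<otimes> x [^] (k'::nat)" "h' \<in> H"
      unfolding H'_def by auto
    have "a \<otimes> b = (h \<otimes> h') \<otimes> x [^] (k + k')" using ab x by (simp add: nat_pow_mult[symmetric] m_ac)
    then show ?thesis using psi'[of "h \<otimes> h'" "k + k'"] ab by (simp add: psi' \<psi>(1) power_add)
  qed
  moreover have "cmod (\<psi>' a) = 1" if "a \<in> H'" for a
    using that \<psi>(2) nc unfolding H'_def by (auto simp: psi' norm_mult norm_power)
  moreover have "\<psi>' a = \<psi> a" if "a \<in> H" for a using psi'[OF that, of 0] that by simp
  moreover have "\<psi>' x = c" using psi'[of \<one> 1] x psi1 by simp
  ultimately show ?thesis by (intro exI[of _ H'] exI[of _ \<psi>']) simp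
qed

text \<open>The order of x in the quotient by H, found as a least exponent without forming the
  quotient group. The bound 2 outside H leaves room for a root of unity other than 1.\<close>

lemma order_mod_subgroup:
  assumes fin: "finite (carrier G)" and H: "subgroup H G" and x: "x \<in> carrier G"
  obtains n where "n > 0" "\<And>j. x [^] j \<in> H \<longleftrightarrow> n dvd (j::nat)" "x \<notin> H \<Longrightarrow> n \<ge> 2"
proof -
  interpret H: subgroup H G by (rule H)
  have "x [^] order G = \<one>" using pow_order_eq_1 x by simp
  moreover have "order G > 0" using fin order_gt_0_iff_finite by simp
  ultimately have ex: "\<exists>n>0. x [^] (n::nat) \<in> H" by (intro exI[of _ "order G"]) simp
  define n where "n = (LEAST n. n > 0 \<and> x [^] (n::nat) \<in> H)"
  have n: "n > 0" "x [^] n \<in> H" using LeastI_ex[OF ex] unfolding n_def by auto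
  have least: "n \<le> m" if "m > 0" "x [^] m \<in> H" for m unfolding n_def using that by (intro Least_le) auto
  have mul: "x [^] (n * m) \<in> H" for m using n(2) by (induction m) (auto simp: nat_pow_mult[symmetric] x)
  have "x [^] j \<in> H \<longleftrightarrow> n dvd j" for j
  proof
    assume j: "x [^] j \<in> H"
    have "x [^] j = x [^] (n * (j div n)) \<otimes> x [^] (j mod n)" using x by (simp add: nat_pow_mult)
    then have "x [^] (j mod n) = inv (x [^] (n * (j div n))) \<otimes> x [^] j"
      using x by (metis inv_closed inv_solve_left nat_pow_closed)
    then have "x [^] (j mod n) \<in> H" using j mul by simp
    then show "n dvd j" using least[of "j mod n"] n(1) by (metis dvd_eq_mod_eq_0 mod_less_divisor leD gr0I)
  qed (use mul in auto)
  moreover have "n \<ge> 2" if "x \<notin> H"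
  proof (rule ccontr)
    assume "\<not> n \<ge> 2" then have "n = 1" using n(1) by simp
    then show False using n(2) that x by simp
  qed
  ultimately show ?thesis using n(1) that by blast
qed

text \<open>Nonzero complex numbers have n-th roots, so a step of \<open>extend_char_step\<close> is
  always available; each step enlarges the subgroup, and finiteness ends the process at the whole
  group.\<close>

lemma extend_char:
  assumes fin: "finite (carrier G)" and H: "subgroup H G"
    and \<psi>: "\<And>a b. a \<in> H \<Longrightarrow> b \<in> H \<Longrightarrow> \<psi> (a \<otimes> b) = \<psi> a * (\<psi> b :: complex)"
       "\<And>a. a \<in> H \<Longrightarrow> cmod (\<psi> a) = 1"
  shows "\<exists>\<phi>\<in>chars G. \<forall>a\<in>H. \<phi> a = \<psi> a"
  using H \<psi>
proof (induction "card (carrier G) - card H" arbitrary: H \<psi> rule: less_induct)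
  case less
  interpret H: subgroup H G by (rule less.prems)
  show ?case
  proof (cases "H = carrier G")
    case True
    define \<phi> where "\<phi> = restrict \<psi> (carrier G)"
    have "\<phi> \<in> chars G" using less.prems True by (auto simp: hom_def \<phi>_def)
    then show ?thesis using True by (intro bexI[of _ \<phi>]) (auto simp: \<phi>_def)
  next
    case False
    then obtain x where x: "x \<in> carrier G" "x \<notin> H" using H.subset by auto
    obtain n where n: "n > 0" "\<And>j. x [^] j \<in> H \<longleftrightarrow> n dvd (j::nat)" using order_mod_subgroup[OF fin less.prems(1) x(1)] by blast
    obtain c where c: "c ^ n = \<psi> (x [^] n)"
    proof
      show "(if \<psi> (x [^] n) = 0 then 0 else exp (Ln (\<psi> (x [^] n)) / of_nat n)) ^ n = \<psi> (x [^] n)"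
        using n(1) by (auto simp: exp_of_nat_mult[symmetric])
    qed
    obtain H' \<psi>' where H': "subgroup H' G" "H \<subseteq> H'" "x \<in> H'" "\<forall>a\<in>H'. \<forall>b\<in>H'. \<psi>' (a \<otimes> b) = \<psi>' a * \<psi>' b"
      "\<forall>a\<in>H'. cmod (\<psi>' a) = 1" "\<forall>a\<in>H. \<psi>' a = \<psi> a"
      using extend_char_step[OF less.prems(1) x(1) less.prems(2,3) n c] by blast
    have "H \<subset> H'" using H' x by blast
    moreover have sub: "H' \<subseteq> carrier G" using H' subgroup.subset by blast
    ultimately have "card H < card H'" using fin finite_subset psubset_card_mono by metis
    moreover have "card H' \<le> card (carrier G)" using sub fin card_mono by blast
    ultimately have "\<exists>\<phi>\<in>chars G. \<forall>a\<in>H'. \<phi> a = \<psi>' a"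
      using H' by (intro less.hyps) auto
    then show ?thesis using H' by (metis subsetD)
  qed
qed

text \<open>Starting from the trivial subgroup, x is sent to a primitive n-th root of unity, where n
  is its order, and the character of the cyclic group so obtained is extended.\<close>

lemma exists_separating_char:
  assumes fin: "finite (carrier G)" and x: "x \<in> carrier G" "x \<noteq> \<one>"
  shows "\<exists>\<phi>\<in>chars G. \<phi> x \<noteq> 1"
proof -
  have sub: "subgroup {\<one>} G" by (rule triv_subgroup)
  obtain n where n: "n > 0" "\<And>j. x [^] j \<in> {\<one>} \<longleftrightarrow> n dvd (j::nat)" "x \<notin> {\<one>} \<Longrightarrow> n \<ge> 2"
    using order_mod_subgroup[OF fin sub x(1)] by blast
  define c where "c = cis (2 * pi / n)"
  have "c ^ n = cis (real n * (2 * pi / n))" unfolding c_def by (rule Complex.DeMoivre)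
  also have "real n * (2 * pi / n) = 2 * pi" using n(1) by simp
  finally have "c ^ n = 1" by simp
  moreover have "c \<noteq> 1"
  proof
    assume "c = 1"
    then have "sin (2 * pi / n) = 0" "cos (2 * pi / n) = 1" by (auto simp: c_def complex_eq_iff)
    then obtain k :: int where "2 * pi / n = 2 * pi * k" using cos_one_2pi_int by (metis mult.commute mult.assoc)
    then have "(2 * pi) * (1 / real n) = (2 * pi) * real_of_int k" by simp
    then have k: "1 / real n = real_of_int k" by (subst (asm) mult_cancel_left) simp
    then have "real_of_int k > 0" "real_of_int k < 1" using n x by (auto simp flip: k)
    then show False by simp
  qed
  moreover obtain H' \<psi>' where H': "subgroup H' G" "x \<in> H'" "\<forall>a\<in>H'. \<forall>b\<in>H'. \<psi>' (a \<otimes> b) = \<psi>' a * \<psi>' b"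
      "\<forall>a\<in>H'. cmod (\<psi>' a) = 1" "\<psi>' x = c"
    using extend_char_step[OF sub x(1), of "\<lambda>_. 1" n c] n \<open>c ^ n = 1\<close> by auto
  ultimately show ?thesis using extend_char[OF fin H'(1), of \<psi>'] by metis
qed

section \<open>Orthogonality relations\<close>

lemma finite_chars:
  assumes fin: "finite (carrier G)"
  shows "finite (chars G)"
proof -
  have "order G > 0" using fin order_gt_0_iff_finite by simp
  have "\<phi> x ^ m = \<phi> (x [^] m)" if "\<phi> \<in> chars G" "x \<in> carrier G" for \<phi> x and m :: nat
    by (induction m) (use that char_one char_mult[of \<phi> G] in \<open>auto simp: mult.commute\<close>)
  then have "\<phi> x ^ order G = 1" if "\<phi> \<in> chars G" "x \<in> carrier G" for \<phi> x
    using that char_one pow_order_eq_1 by metis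
  then have "chars G \<subseteq> (\<Pi>\<^sub>E x\<in>carrier G. {z. z ^ order G = 1})" by (auto simp: PiE_def)
  moreover have "finite {z::complex. z ^ order G = 1}"
    using \<open>order G > 0\<close> by (intro finite_roots_unity) simp
  ultimately show ?thesis using fin by (meson finite_PiE finite_subset)
qed

lemma char_times:
  assumes "\<phi> \<in> chars G" "\<phi>' \<in> chars G"
  shows "restrict (\<lambda>x. \<phi> x * \<phi>' x) (carrier G) \<in> chars G"
  using assms by (auto simp: hom_def Pi_def norm_mult)

text \<open>Multiplication by a character that separates x from the identity permutes all characters
  and multiplies the sum by a number other than 1.\<close>

lemma sum_chars_nontrivial:
  assumes fin: "finite (carrier G)" and x: "x \<in> carrier G" "x \<noteq> \<one>"
  shows "(\<Sum>\<phi>\<in>chars G. \<phi> x) = 0"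
proof -
  obtain \<phi>0 where p: "\<phi>0 \<in> chars G" "\<phi>0 x \<noteq> 1" using exists_separating_char[OF assms] by blast
  define T where "T = (\<lambda>\<phi>. restrict (\<lambda>y. \<phi>0 y * \<phi> y) (carrier G))"
  have "inj_on T (chars G)"
  proof (rule inj_onI)
    fix a b assume ab: "a \<in> chars G" "b \<in> chars G" "T a = T b"
    have "a y = b y" if "y \<in> carrier G" for y
    proof -
      have "\<phi>0 y * a y = \<phi>0 y * b y" using fun_cong[OF ab(3), of y] that unfolding T_def by simp
      then show ?thesis using char_norm[OF p(1) that] by auto
    qed
    then show "a = b" using ab by (intro extensionalityI[of a "carrier G"]) auto
  qed
  moreover have "T ` chars G \<subseteq> chars G" unfolding T_def using char_times[OF p(1)] by blast
  ultimately have "bij_betw T (chars G) (chars G)"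
    unfolding bij_betw_def using finite_chars[OF fin] by (metis endo_inj_surj)
  then have "(\<Sum>\<phi>\<in>chars G. \<phi> x) = (\<Sum>\<phi>\<in>chars G. T \<phi> x)" by (rule sum.reindex_bij_betw[symmetric])
  also have "\<dots> = \<phi>0 x * (\<Sum>\<phi>\<in>chars G. \<phi> x)" using x by (simp add: T_def sum_distrib_left)
  finally have "(1 - \<phi>0 x) * (\<Sum>\<phi>\<in>chars G. \<phi> x) = 0" by (simp add: algebra_simps)
  then show ?thesis using p by simp
qed

lemma sum_subgroup_char:
  assumes fin: "finite (carrier G)" and K: "subgroup K G" and \<phi>: "\<phi> \<in> chars G"
  shows "(\<Sum>k\<in>K. \<phi> k) = (if \<forall>k\<in>K. \<phi> k = 1 then of_nat (card K) else 0)"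
proof (cases "\<forall>k\<in>K. \<phi> k = 1")
  case False
  then obtain k0 where k0: "k0 \<in> K" "\<phi> k0 \<noteq> 1" by auto
  interpret K: subgroup K G by (rule K)
  have "inj_on (\<lambda>k. k0 \<otimes> k) K" using k0 by (intro inj_onI) (metis K.mem_carrier l_cancel)
  moreover have "(\<lambda>k. k0 \<otimes> k) ` K \<subseteq> K" using k0 by auto
  moreover have "finite K" using fin K.subset finite_subset by blast
  ultimately have "bij_betw (\<lambda>k. k0 \<otimes> k) K K" unfolding bij_betw_def by (metis endo_inj_surj)
  then have "(\<Sum>k\<in>K. \<phi> k) = (\<Sum>k\<in>K. \<phi> (k0 \<otimes> k))" by (rule sum.reindex_bij_betw[symmetric])
  also have "\<dots> = \<phi> k0 * (\<Sum>k\<in>K. \<phi> k)"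
    unfolding sum_distrib_left by (intro sum.cong refl char_mult[OF \<phi>]) (use k0 in auto)
  finally have "(1 - \<phi> k0) * (\<Sum>k\<in>K. \<phi> k) = 0" by (simp add: algebra_simps)
  then show ?thesis using k0 False by auto
qed simp

text \<open>The double sum over characters and group elements is evaluated in both orders: one
  leaves only the trivial character, the other only the identity.\<close>

lemma card_chars:
  assumes fin: "finite (carrier G)"
  shows "card (chars G) = card (carrier G)"
proof -
  define \<phi>1 where "\<phi>1 = restrict (\<lambda>_. 1::complex) (carrier G)"
  have p1: "\<phi>1 \<in> chars G" by (auto simp: \<phi>1_def hom_def)
  have triv: "(\<forall>k\<in>carrier G. \<phi> k = 1) \<longleftrightarrow> \<phi> = \<phi>1" if "\<phi> \<in> chars G" for \<phi>
    using that p1 by (auto simp: \<phi>1_def intro!: extensionalityI[of \<phi> "carrier G"])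
  have "(\<Sum>\<phi>\<in>chars G. \<Sum>x\<in>carrier G. \<phi> x) = (\<Sum>\<phi>\<in>chars G. if \<phi> = \<phi>1 then of_nat (card (carrier G)) else 0)"
    by (intro sum.cong refl) (simp add: sum_subgroup_char[OF fin subgroup_self] triv)
  also have "\<dots> = of_nat (card (carrier G))" using p1 finite_chars[OF fin] by (simp add: sum.delta)
  also have "(\<Sum>\<phi>\<in>chars G. \<Sum>x\<in>carrier G. \<phi> x) = (\<Sum>x\<in>carrier G. \<Sum>\<phi>\<in>chars G. \<phi> x)" by (rule sum.swap)
  also have "\<dots> = (\<Sum>x\<in>carrier G. if x = \<one> then of_nat (card (chars G)) else 0)"
    by (intro sum.cong refl) (auto simp: sum_chars_nontrivial[OF fin] char_one)
  also have "\<dots> = of_nat (card (chars G))" using fin by (simp add: sum.delta)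
  finally show ?thesis using of_nat_eq_iff by metis
qed

lemma sum_chars:
  assumes fin: "finite (carrier G)" and x: "x \<in> carrier G"
  shows "(\<Sum>\<phi>\<in>chars G. \<phi> x) = (if x = \<one> then of_nat (card (carrier G)) else 0)"
  using sum_chars_nontrivial[OF fin x] card_chars[OF fin] by (auto simp: char_one)

text \<open>The indicator of triviality on K is the average of the character over K; inserting it
  reduces the claim to the sum over all characters at the elements
  \<open>k \<otimes> x\<close>.\<close>

lemma sum_chars_trivial_on:
  assumes fin: "finite (carrier G)" and K: "subgroup K G" and x: "x \<in> carrier G"
  shows "(\<Sum>\<phi>\<in>{\<phi>\<in>chars G. \<forall>k\<in>K. \<phi> k = 1}. \<phi> x) =
     (if x \<in> K then of_nat (card (carrier G)) / of_nat (card K) else 0)"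
proof -
  interpret K: subgroup K G by (rule K)
  have finK: "finite K" using fin K.subset finite_subset by blast
  have cK: "card K > 0" using finK K.one_closed card_gt_0_iff by blast
  have "of_nat (card K) * (\<Sum>\<phi>\<in>{\<phi>\<in>chars G. \<forall>k\<in>K. \<phi> k = 1}. \<phi> x)
      = (\<Sum>\<phi>\<in>chars G. if \<forall>k\<in>K. \<phi> k = 1 then of_nat (card K) * \<phi> x else 0)"
    by (simp only: sum_distrib_left sum.inter_filter[OF finite_chars[OF fin]]) (intro sum.cong refl, auto)
  also have "\<dots> = (\<Sum>\<phi>\<in>chars G. (\<Sum>k\<in>K. \<phi> k) * \<phi> x)"
    by (intro sum.cong refl) (auto simp: sum_subgroup_char[OF fin K])
  also have "\<dots> = (\<Sum>\<phi>\<in>chars G. \<Sum>k\<in>K. \<phi> (k \<otimes> x))"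
    unfolding sum_distrib_right using x by (intro sum.cong refl) (simp add: char_mult)
  also have "\<dots> = (\<Sum>k\<in>K. \<Sum>\<phi>\<in>chars G. \<phi> (k \<otimes> x))" by (rule sum.swap)
  also have "\<dots> = (\<Sum>k\<in>K. if k = inv x then of_nat (card (carrier G)) else 0)"
  proof (intro sum.cong refl)
    fix k assume k: "k \<in> K"
    have "k \<otimes> x = \<one> \<longleftrightarrow> k = inv x" using k x by (metis K.mem_carrier inv_equality l_inv)
    then show "(\<Sum>\<phi>\<in>chars G. \<phi> (k \<otimes> x)) = (if k = inv x then of_nat (card (carrier G)) else 0)"
      using sum_chars[OF fin, of "k \<otimes> x"] k x by simp
  qed
  also have "\<dots> = (if inv x \<in> K then of_nat (card (carrier G)) else 0)" using finK by (simp add: sum.delta)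
  also have "inv x \<in> K \<longleftrightarrow> x \<in> K" using x K.m_inv_closed inv_inv by metis
  finally show ?thesis using cK by (auto simp: field_simps)
qed

text \<open>Inclusion-exclusion, from expanding the product of 1 - t over P, where t is the
  indicator of triviality on \<open>K p\<close>. Primitive characters are later singled out in this
  way, with \<open>K p\<close> the kernel of reduction to the modulus q/p.\<close>

lemma sum_chars_avoiding:
  assumes fin: "finite (carrier G)" and P: "finite P"
  shows "(\<Sum>\<phi>\<in>{\<phi>\<in>chars G. \<forall>p\<in>P. \<not> (\<forall>k\<in>K p. \<phi> k = 1)}. \<phi> x) =
     (\<Sum>S\<in>Pow P. (-1) ^ card S * (\<Sum>\<phi>\<in>{\<phi>\<in>chars G. \<forall>p\<in>S. \<forall>k\<in>K p. \<phi> k = 1}. \<phi> x))"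
proof -
  define t where "t \<phi> p = (if \<forall>k\<in>K p. \<phi> k = 1 then 1 else 0 :: complex)" for \<phi> :: "'a \<Rightarrow> complex" and p
  have prodt: "(\<Prod>p\<in>S. t \<phi> p) = (if \<forall>p\<in>S. \<forall>k\<in>K p. \<phi> k = 1 then 1 else 0)" if "S \<subseteq> P" for S \<phi>
  proof -
    have "finite S" using that P finite_subset by blast
    then show ?thesis by (induction S) (auto simp: t_def)
  qed
  have prodt': "(\<Prod>p\<in>P. 1 - t \<phi> p) = (if \<forall>p\<in>P. \<not> (\<forall>k\<in>K p. \<phi> k = 1) then 1 else 0)" for \<phi>
    using P by (induction P) (auto simp: t_def)
  have "(\<Sum>\<phi>\<in>{\<phi>\<in>chars G. \<forall>p\<in>P. \<not> (\<forall>k\<in>K p. \<phi> k = 1)}. \<phi> x) = (\<Sum>\<phi>\<in>chars G. (\<Prod>p\<in>P. 1 - t \<phi> p) * \<phi> x)"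
    unfolding prodt' by (subst sum.inter_filter[OF finite_chars[OF fin]]) (intro sum.cong refl, auto)
  also have "\<dots> = (\<Sum>\<phi>\<in>chars G. \<Sum>S\<in>Pow P. (-1) ^ card S * (\<Prod>p\<in>S. t \<phi> p) * \<phi> x)"
    using P by (simp add: prod_diff_conv_sum sum_distrib_right)
  also have "\<dots> = (\<Sum>S\<in>Pow P. \<Sum>\<phi>\<in>chars G. (-1) ^ card S * (\<Prod>p\<in>S. t \<phi> p) * \<phi> x)" by (rule sum.swap)
  also have "\<dots> = (\<Sum>S\<in>Pow P. (-1) ^ card S * (\<Sum>\<phi>\<in>{\<phi>\<in>chars G. \<forall>p\<in>S. \<forall>k\<in>K p. \<phi> k = 1}. \<phi> x))"
  proof (intro sum.cong refl)
    fix S assume "S \<in> Pow P"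
    then have S: "S \<subseteq> P" by simp
    show "(\<Sum>\<phi>\<in>chars G. (-1) ^ card S * (\<Prod>p\<in>S. t \<phi> p) * \<phi> x) =
        (-1) ^ card S * (\<Sum>\<phi>\<in>{\<phi>\<in>chars G. \<forall>p\<in>S. \<forall>k\<in>K p. \<phi> k = 1}. \<phi> x)"
      unfolding prodt[OF S]
      by (simp only: sum.inter_filter[OF finite_chars[OF fin]] sum_distrib_left) (intro sum.cong refl, auto)
  qed
  finally show ?thesis .
qed

text \<open>Triviality on several subgroups becomes triviality on one subgroup M of known order, to
  which \<open>sum_chars_trivial_on\<close> applies. The sets \<open>C S\<close> control the growth:
  M stays inside \<open>C S\<close>, which meets the next \<open>K p\<close> only in the identity,
  so the product is direct and orders multiply.\<close>

lemma subgroup_product: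
  assumes fin: "finite (carrier G)" and P: "finite P" and K: "\<And>p. p \<in> P \<Longrightarrow> subgroup (K p) G"
    and C: "\<And>S. S \<subseteq> P \<Longrightarrow> subgroup (C S) G" "\<And>S T. S \<subseteq> T \<Longrightarrow> T \<subseteq> P \<Longrightarrow> C S \<subseteq> C T"
      "\<And>p S. S \<subseteq> P \<Longrightarrow> p \<in> S \<Longrightarrow> K p \<subseteq> C S" "\<And>p S. S \<subseteq> P \<Longrightarrow> p \<in> P - S \<Longrightarrow> C S \<inter> K p \<subseteq> {\<one>}"
    and S: "S \<subseteq> P"
  shows "\<exists>M. subgroup M G \<and> M \<subseteq> C S \<and> card M = (\<Prod>p\<in>S. card (K p)) \<and>
     (\<forall>\<phi>\<in>chars G. (\<forall>k\<in>M. \<phi> k = 1) \<longleftrightarrow> (\<forall>p\<in>S. \<forall>k\<in>K p. \<phi> k = 1))"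
proof -
  have "finite S" using S P finite_subset by blast
  then show ?thesis using S
  proof (induction S)
    case empty
    show ?case using subgroup.one_closed[OF C(1)[of "{}"]] triv_subgroup
      by (intro exI[of _ "{\<one>}"]) (auto simp: char_one)
  next
    case (insert p S)
    then obtain M where M: "subgroup M G" "M \<subseteq> C S" "card M = (\<Prod>p\<in>S. card (K p))"
      "\<And>\<phi>. \<phi> \<in> chars G \<Longrightarrow> (\<forall>k\<in>M. \<phi> k = 1) \<longleftrightarrow> (\<forall>p\<in>S. \<forall>k\<in>K p. \<phi> k = 1)" by auto
    interpret M: subgroup M G by (rule M)
    have p: "p \<in> P" "S \<subseteq> P" using insert.prems by auto
    interpret Kp: subgroup "K p" G using K p by simp
    interpret CS: subgroup "C (insert p S)" G using C insert.prems by simp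
    have "subgroup (M <#> K p) G" using mult_subgroups M K p by blast
    moreover have "M <#> K p \<subseteq> C (insert p S)"
    proof -
      have "M \<subseteq> C (insert p S)" using M(2) C(2)[of S "insert p S"] insert.prems by blast
      moreover have "K p \<subseteq> C (insert p S)" using C(3) insert.prems by blast
      ultimately show ?thesis by (auto simp: set_mult_def)
    qed
    moreover have "card (M <#> K p) = card M * card (K p)"
    proof -
      have "inj_on (\<lambda>(a,b). a \<otimes> b) (M \<times> K p)"
      proof (rule inj_onI, clarsimp)
        fix a b a' b' assume h: "a \<in> M" "b \<in> K p" "a' \<in> M" "b' \<in> K p" "a \<otimes> b = a' \<otimes> b'"
        have "inv a' \<otimes> a = b' \<otimes> inv b"
        proof -
          have "inv a' \<otimes> a \<otimes> b = b'" using h by (metis M.mem_carrier Kp.mem_carrier inv_closed m_assoc inv_solve_left m_closed)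
          then show ?thesis using h by (metis M.mem_carrier Kp.mem_carrier inv_closed inv_solve_right m_closed)
        qed
        moreover have "inv a' \<otimes> a \<in> M" "b' \<otimes> inv b \<in> K p" using h by auto
        ultimately have "inv a' \<otimes> a = \<one>" "b' \<otimes> inv b = \<one>"
          using C(4)[of S p] p insert.hyps M(2) by auto
        then show "a = a' \<and> b = b'" using h
          by (metis M.mem_carrier Kp.mem_carrier inv_closed inv_equality inv_inv)
      qed
      moreover have "M <#> K p = (\<lambda>(a,b). a \<otimes> b) ` (M \<times> K p)" by (auto simp: set_mult_def)
      ultimately show ?thesis by (simp add: card_image card_cartesian_product)
    qed
    moreover have "(\<forall>k\<in>M <#> K p. \<phi> k = 1) \<longleftrightarrow> (\<forall>p\<in>insert p S. \<forall>k\<in>K p. \<phi> k = 1)" if "\<phi> \<in> chars G" for \<phi>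
    proof -
      have "(\<forall>k\<in>M <#> K p. \<phi> k = 1) \<longleftrightarrow> (\<forall>a\<in>M. \<forall>b\<in>K p. \<phi> a * \<phi> b = 1)"
        using that by (auto simp: set_mult_def char_mult)
      also have "\<dots> \<longleftrightarrow> (\<forall>a\<in>M. \<phi> a = 1) \<and> (\<forall>b\<in>K p. \<phi> b = 1)"
        using char_one[OF that] M.one_closed Kp.one_closed by (metis mult.right_neutral mult.left_neutral)
      finally show ?thesis using M(4)[OF that] by auto
    qed
    ultimately show ?case using M(3) insert.hyps by (intro exI[of _ "M <#> K p"]) auto
  qed
qed

end

section \<open>Gaussian sums over shifted integers\<close>

lemma summable_on_int_even:
  fixes f :: "int \<Rightarrow> real"
  assumes "summable (\<lambda>n. f (int n))" and "\<And>n. f n \<ge> 0" and "\<And>n. f (- n) = f n"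
  shows "f summable_on UNIV"
proof -
  have 1: "f summable_on range int"
    using assms by (subst summable_on_reindex) (auto simp: o_def summable_on_UNIV_nonneg_real_iff)
  have "f summable_on range (\<lambda>n. - int n)"
    using assms by (subst summable_on_reindex) (auto simp: o_def summable_on_UNIV_nonneg_real_iff inj_on_def)
  with 1 have "f summable_on (range int \<union> range (\<lambda>n. - int n))" by (rule summable_on_union)
  also have "range int \<union> range (\<lambda>n. - int n) = UNIV"
  proof -
    have "x \<in> range int \<union> range (\<lambda>n. - int n)" for x by (cases x rule: int_cases2) auto
    then show ?thesis by auto
  qed
  finally show ?thesis .
qed

lemma summable_on_int_square_powr:
  assumes "\<sigma> > 1"
  shows "(\<lambda>n::int. (1 + (of_int n)\<^sup>2 :: real) powr (- \<sigma> / 2)) summable_on UNIV"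
proof (rule summable_on_int_even)
  have S: "summable (\<lambda>n. real n powr (- \<sigma>))" using assms by (simp add: summable_real_powr_iff)
  have L: "(1 + (real n)\<^sup>2) powr (- \<sigma> / 2) \<le> real n powr (- \<sigma>)" if "n \<ge> 1" for n
  proof -
    have "(1 + (real n)\<^sup>2) powr (- \<sigma> / 2) \<le> ((real n)\<^sup>2) powr (- \<sigma> / 2)"
      using that assms by (intro powr_mono2') auto
    also have "\<dots> = real n powr (- \<sigma>)"
      using that powr_powr[of "real n" 2 "- \<sigma> / 2"] by (simp add: powr_numeral)
    finally show ?thesis .
  qed
  show "summable (\<lambda>n. (1 + (real_of_int (int n))\<^sup>2) powr (- \<sigma> / 2))"
  proof (rule summable_comparison_test'[OF S])
    fix n :: nat assume "n \<ge> 1"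
    from L[OF this] show "norm ((1 + (real_of_int (int n))\<^sup>2) powr (- \<sigma> / 2)) \<le> real n powr (- \<sigma>)" by simp
  qed
qed auto

lemma summable_on_int_inverse_square: "(\<lambda>n::int. 1 / (1 + (of_int n)\<^sup>2 :: real)) summable_on UNIV"
proof -
  have *: "1 / (1 + (of_int n)\<^sup>2) = (1 + (of_int n)\<^sup>2 :: real) powr (- 2 / 2)" for n :: int
    using powr_minus[of "1 + (of_int n)\<^sup>2 :: real" 1] by (simp add: field_simps add_pos_nonneg)
  show ?thesis unfolding * by (rule summable_on_int_square_powr) simp
qed

lemma summable_on_product_nonneg:
  fixes f :: "'a \<Rightarrow> real" and g :: "'b \<Rightarrow> real"
  assumes "(f has_sum a) UNIV" "(g has_sum b) UNIV" "\<And>x. f x \<ge> 0" "\<And>y. g y \<ge> 0"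
  shows "((\<lambda>(x, y). f x * g y) has_sum a * b) UNIV"
proof -
  have 1: "((\<lambda>y. case (x, y) of (x, y) \<Rightarrow> f x * g y) has_sum f x * b) UNIV" for x
    unfolding prod.case by (rule has_sum_cmult_right[OF assms(2)])
  have 2: "((\<lambda>x. f x * b) has_sum a * b) UNIV" by (rule has_sum_cmult_left[OF assms(1)])
  have "(\<lambda>(x, y). f x * g y) summable_on (SIGMA x:UNIV. UNIV)"
    using assms 2 by (intro summable_on_SigmaI[OF 1]) (auto simp: summable_on_def)
  from has_sum_SigmaI[OF 1 2 this] show ?thesis by simp
qed

text \<open>A Jacobi theta value, scaled so that no factor \<pi> appears in the exponent.\<close>

definition gauss_sum :: "real \<Rightarrow> real \<Rightarrow> real" where
  "gauss_sum u x = (\<Sum>\<^sub>\<infinity>n::int. exp (- u * (of_int n + x)\<^sup>2))"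

lemma exp_minus_le: "t \<ge> 0 \<Longrightarrow> exp (- t) \<le> 1 / (1 + t :: real)"
proof -
  assume "t \<ge> 0"
  then have "1 + t \<le> exp t" "1 + t > 0" by simp_all
  then show ?thesis by (simp add: exp_minus field_simps)
qed

lemma gauss_majorant:
  assumes a: "a > 0"
  shows "(\<lambda>n::int. exp (- a * (of_int n)\<^sup>2 :: real)) summable_on UNIV"
proof (rule summable_on_comparison_test)
  show "(\<lambda>n::int. (max 1 (1/a)) * (1 / (1 + (of_int n)\<^sup>2 :: real))) summable_on UNIV"
    by (intro summable_on_cmult_right summable_on_int_inverse_square)
  fix n :: int
  define t :: real where "t = (of_int n)\<^sup>2"
  have t: "t \<ge> 0" by (simp add: t_def)
  have "exp (- (a * t)) \<le> 1 / (1 + a * t)" using t a by (intro exp_minus_le) simp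
  also have "\<dots> \<le> max 1 (1/a) * (1 / (1 + t))"
  proof -
    have "1 \<le> max 1 (1/a)" "1 \<le> max 1 (1/a) * a" using a by (auto simp: max_def field_simps)
    then have "1 * 1 + 1 * t \<le> max 1 (1/a) * 1 + (max 1 (1/a) * a) * t" by (intro add_mono mult_right_mono t) auto
    then have "1 + t \<le> max 1 (1/a) * (1 + a * t)" by (simp add: algebra_simps)
    moreover have "1 + a * t > 0" "1 + t > 0" using t a by (auto intro: add_pos_nonneg)
    ultimately show ?thesis by (simp add: field_simps)
  qed
  finally show "exp (- a * (of_int n)\<^sup>2) \<le> max 1 (1/a) * (1 / (1 + (of_int n)\<^sup>2 :: real))" by (simp add: t_def)
qed auto

lemma shift_square_ge: "(a + x)\<^sup>2 \<ge> a\<^sup>2 / 2 - x\<^sup>2" for a x :: real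
proof -
  have "2 * (a + x)\<^sup>2 - (a\<^sup>2 - 2 * x\<^sup>2) = (a + 2 * x)\<^sup>2" by (simp add: power2_eq_square algebra_simps)
  then show ?thesis using zero_le_power2[of "a + 2 * x"] by linarith
qed

lemma gauss_summable:
  assumes "u > 0"
  shows "(\<lambda>n::int. exp (- u * (of_int n + x)\<^sup>2 :: real)) summable_on UNIV"
proof (rule summable_on_comparison_test)
  show "(\<lambda>n::int. exp (u * x\<^sup>2) * exp (- (u / 2) * (of_int n)\<^sup>2)) summable_on UNIV"
    using assms by (intro summable_on_cmult_right gauss_majorant) auto
  fix n :: int
  have "u * ((of_int n)\<^sup>2 / 2 - x\<^sup>2) \<le> u * (of_int n + x)\<^sup>2"
    using assms by (intro mult_left_mono shift_square_ge) auto
  then show "exp (- u * (of_int n + x)\<^sup>2) \<le> exp (u * x\<^sup>2) * exp (- (u / 2) * (of_int n)\<^sup>2)"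
    by (simp add: exp_add[symmetric] algebra_simps)
qed auto

lemma gauss_has_sum: "u > 0 \<Longrightarrow> ((\<lambda>n::int. exp (- u * (of_int n + x)\<^sup>2)) has_sum gauss_sum u x) UNIV"
  unfolding gauss_sum_def using gauss_summable by (rule has_sum_infsum)

lemma gauss_sum_nonneg: "gauss_sum u x \<ge> 0"
  unfolding gauss_sum_def by (intro infsum_nonneg) auto

lemma gauss_sum_shift: "gauss_sum u (x + of_int k) = gauss_sum u x"
proof -
  have "bij_betw (\<lambda>n. n + k) UNIV (UNIV :: int set)" by (rule bij_betwI[of _ _ _ "\<lambda>n. n - k"]) auto
  from infsum_reindex_bij_betw[OF this, of "\<lambda>n. exp (- u * (of_int n + x)\<^sup>2)"]
  show ?thesis unfolding gauss_sum_def by (simp add: add_ac)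
qed

text \<open>The factor 4 is the square of the 2 in |n + x| \<ge> |n|/2, valid for |x| \<le>
  1/2.\<close>

definition gauss_const :: real where "gauss_const = 4 * (\<Sum>\<^sub>\<infinity>n::int. 1 / (1 + (of_int n)\<^sup>2))"

lemma int_shift_abs_ge: "\<bar>x\<bar> \<le> 1/2 \<Longrightarrow> \<bar>of_int n + x\<bar> \<ge> \<bar>of_int n\<bar> / (2::real)"
proof -
  assume x: "\<bar>x\<bar> \<le> 1/2"
  show ?thesis
  proof (cases "n = 0")
    case False
    then have "\<bar>of_int n :: real\<bar> \<ge> 1" by (metis of_int_1_le_iff of_int_abs zero_less_abs_iff int_one_le_iff_zero_less)
    then show ?thesis using x by linarith
  qed simp
qed

text \<open>The true size is of order 1/sqrt(u). The weaker bound 1/u suffices, since the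
  oscillation estimates built on it gain arbitrary powers of u.\<close>

lemma gauss_sum_le:
  assumes u: "0 < u" "u \<le> 1"
  shows "gauss_sum u x \<le> gauss_const / u"
proof -
  define y where "y = x - of_int (round x)"
  have y: "\<bar>y\<bar> \<le> 1/2" using of_int_round_abs_le[of x] by (simp add: y_def abs_minus_commute)
  have "gauss_sum u x = gauss_sum u y" using gauss_sum_shift[of u y "round x"] by (simp add: y_def)
  also have "\<dots> \<le> (\<Sum>\<^sub>\<infinity>n::int. (4 / u) * (1 / (1 + (of_int n)\<^sup>2)))"
    unfolding gauss_sum_def
  proof (rule infsum_mono[OF gauss_summable[OF u(1)]])
    show "(\<lambda>n::int. (4 / u) * (1 / (1 + (of_int n)\<^sup>2) :: real)) summable_on UNIV"
      by (intro summable_on_cmult_right summable_on_int_inverse_square)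
    fix n :: int
    define t :: real where "t = (of_int n)\<^sup>2"
    have t: "t \<ge> 0" by (simp add: t_def)
    have "(\<bar>of_int n\<bar> / 2)\<^sup>2 \<le> \<bar>of_int n + y\<bar>\<^sup>2" using int_shift_abs_ge[OF y, of n] by (intro power_mono) auto
    then have "t / 4 \<le> (of_int n + y)\<^sup>2" by (simp add: power_divide t_def)
    then have "u * (t / 4) \<le> u * (of_int n + y)\<^sup>2" using u by (intro mult_left_mono) auto
    then have "exp (- u * (of_int n + y)\<^sup>2) \<le> exp (- (u * (t / 4)))" by simp
    also have "\<dots> \<le> 1 / (1 + u * (t / 4))" using u t by (intro exp_minus_le) auto
    also have "\<dots> \<le> (4 / u) * (1 / (1 + t))"
    proof -
      have "u * (1 + t) \<le> 4 * (1 + u * (t / 4))" using u by (simp add: algebra_simps)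
      moreover have "1 + u * (t / 4) > 0" "1 + t > 0" using u t by (auto intro!: add_pos_nonneg)
      ultimately have "4 / (4 * (1 + u * (t / 4))) \<le> 4 / (u * (1 + t))"
        using u by (intro divide_left_mono) auto
      moreover have "4 / (4 * (1 + u * (t / 4))) = 1 / (1 + u * (t / 4))"
        using mult_divide_mult_cancel_left[of 4 1 "1 + u * (t / 4)"] by (simp only: mult_1_right)
      ultimately show ?thesis by simp
    qed
    finally show "exp (- u * (of_int n + y)\<^sup>2) \<le> (4 / u) * (1 / (1 + (of_int n)\<^sup>2))" by (simp add: t_def)
  qed
  also have "\<dots> = (4 / u) * (\<Sum>\<^sub>\<infinity>n::int. 1 / (1 + (of_int n)\<^sup>2))" by (rule infsum_cmult_right')
  also have "\<dots> = gauss_const / u" by (simp add: gauss_const_def)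
  finally show ?thesis .
qed

lemma gauss_const_pos: "gauss_const \<ge> 4"
proof -
  have "(\<Sum>n\<in>{0::int}. 1 / (1 + (of_int n)\<^sup>2) :: real) \<le> (\<Sum>\<^sub>\<infinity>n::int. 1 / (1 + (of_int n)\<^sup>2))"
    by (intro finite_sum_le_infsum summable_on_int_inverse_square) auto
  then show ?thesis by (simp add: gauss_const_def)
qed

section \<open>Complex shifts and the oscillation of the Gaussian sum\<close>

definition cgauss :: "real \<Rightarrow> complex \<Rightarrow> complex" where
  "cgauss u w = (\<Sum>\<^sub>\<infinity>n::int. exp (- of_real u * (of_int n + w)\<^sup>2))"

lemma cmod_gauss_term: "cmod (exp (- of_real u * (of_int n + w)\<^sup>2)) =
   exp (u * (Im w)\<^sup>2) * exp (- u * (of_int n + Re w)\<^sup>2)"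
  by (simp add: norm_exp_eq_Re exp_add[symmetric] power2_eq_square algebra_simps)

lemma cgauss_summable: "u > 0 \<Longrightarrow> (\<lambda>n::int. cmod (exp (- of_real u * (of_int n + w)\<^sup>2))) summable_on UNIV"
  unfolding cmod_gauss_term by (intro summable_on_cmult_right gauss_summable)

lemma cmod_cgauss_le:
  assumes "u > 0"
  shows "cmod (cgauss u w) \<le> exp (u * (Im w)\<^sup>2) * gauss_sum u (Re w)"
proof -
  have "cmod (cgauss u w) \<le> (\<Sum>\<^sub>\<infinity>n::int. cmod (exp (- of_real u * (of_int n + w)\<^sup>2)))"
    unfolding cgauss_def by (rule norm_infsum_bound[OF cgauss_summable[OF assms]])
  also have "\<dots> = exp (u * (Im w)\<^sup>2) * gauss_sum u (Re w)"
    unfolding cmod_gauss_term gauss_sum_def by (rule infsum_cmult_right')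
  finally show ?thesis .
qed

lemma cgauss_of_real: "u > 0 \<Longrightarrow> cgauss u (of_real x) = of_real (gauss_sum u x)"
proof -
  assume u: "u > 0"
  have "((\<lambda>n::int. complex_of_real (exp (- u * (of_int n + x)\<^sup>2))) has_sum of_real (gauss_sum u x)) UNIV"
    by (intro has_sum_of_real gauss_has_sum u)
  then show ?thesis unfolding cgauss_def
    by (intro infsumI) (simp add: exp_of_real[symmetric])
qed

lemma cgauss_add_1: "cgauss u (w + 1) = cgauss u w"
proof -
  have "bij_betw (\<lambda>n. n + 1) UNIV (UNIV :: int set)" by (rule bij_betwI[of _ _ _ "\<lambda>n. n - 1"]) auto
  from infsum_reindex_bij_betw[OF this, of "\<lambda>n. exp (- of_real u * (of_int n + w)\<^sup>2)"]
  show ?thesis unfolding cgauss_def by (simp add: add_ac)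
qed

lemma cgauss_holomorphic:
  assumes u: "u > 0"
  shows "cgauss u holomorphic_on UNIV"
proof -
  have "cgauss u holomorphic_on ball 0 R" for R
  proof -
    have "uniform_limit (cball (0::complex) R) (\<lambda>X w. \<Sum>n\<in>X. exp (- of_real u * (of_int n + w)\<^sup>2))
        (\<lambda>w. \<Sum>\<^sub>\<infinity>n::int. exp (- of_real u * (of_int n + w)\<^sup>2)) (finite_subsets_at_top UNIV)"
    proof (rule Weierstrass_m_test_general[where M = "\<lambda>n. exp (u * R\<^sup>2) * exp (- (u / 2) * (of_int n)\<^sup>2)"])
      show "(\<lambda>n::int. exp (u * R\<^sup>2) * exp (- (u / 2) * (of_int n)\<^sup>2)) summable_on UNIV"
        using u by (intro summable_on_cmult_right gauss_majorant) auto
      fix n :: int and w :: complex assume "w \<in> cball 0 R"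
      then have "(cmod w)\<^sup>2 \<le> R\<^sup>2" by (intro power_mono) auto
      then have "(Im w)\<^sup>2 + (Re w)\<^sup>2 \<le> R\<^sup>2" by (simp add: cmod_power2)
      then have "u * ((Im w)\<^sup>2 + (Re w)\<^sup>2) \<le> u * R\<^sup>2" using u by simp
      moreover have "u * ((of_int n)\<^sup>2 / 2 - (Re w)\<^sup>2) \<le> u * (of_int n + Re w)\<^sup>2"
        using u by (intro mult_left_mono shift_square_ge) auto
      ultimately show "cmod (exp (- of_real u * (of_int n + w)\<^sup>2)) \<le> exp (u * R\<^sup>2) * exp (- (u / 2) * (of_int n)\<^sup>2)"
        unfolding cmod_gauss_term by (simp add: exp_add[symmetric] algebra_simps)
    qed
    then have "uniform_limit (cball (0::complex) R) (\<lambda>X w. \<Sum>n\<in>X. exp (- of_real u * (of_int n + w)\<^sup>2)) (cgauss u) (finite_subsets_at_top UNIV)"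
      unfolding cgauss_def[abs_def] .
    then show ?thesis
      by (rule holomorphic_uniform_limit[rotated]) (auto intro!: always_eventually continuous_intros holomorphic_intros)
  qed
  then show ?thesis
    by (metis UNIV_I analytic_on_holomorphic analytic_on_def holomorphic_on_open open_ball open_UNIV centre_in_ball mem_ball_0 less_add_one norm_ge_zero holomorphic_on_def field_differentiable_at_within at_within_open)
qed

text \<open>Cauchy's inequality on discs of radius Y bounds the k-th derivative. All derivatives are
  periodic, so by Rolle each one of order at least 1 vanishes somewhere in every unit interval, and
  the bound descends from order k to order 1 without loss.\<close>

lemma periodic_osc:
  fixes F :: "complex \<Rightarrow> complex"
  assumes hol: "F holomorphic_on UNIV" and per: "\<And>w. F (w + 1) = F w"
    and bd: "\<And>w. \<bar>Im w\<bar> \<le> Y \<Longrightarrow> cmod (F w) \<le> M" and Y: "Y > 0" and k: "k \<ge> 1" and xy: "\<bar>x - y\<bar> \<le> 1"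
  shows "\<bar>Re (F (of_real x)) - Re (F (of_real y))\<bar> \<le> fact k * M / Y ^ k"
proof -
  define f where "f j t = Re ((deriv ^^ j) F (of_real t))" for j and t :: real
  have holj: "(deriv ^^ j) F holomorphic_on UNIV" for j
    by (rule holomorphic_higher_deriv[OF hol]) auto
  have perj: "(deriv ^^ j) F (w + 1) = (deriv ^^ j) F w" for j w
  proof (induction j arbitrary: w)
    case (Suc j)
    have d: "((deriv ^^ j) F has_field_derivative (deriv ^^ Suc j) F v) (at v)" for v
      using holj[of j] by (auto intro!: holomorphic_derivI[of _ UNIV])
    have "((\<lambda>v. (deriv ^^ j) F (v + 1)) has_field_derivative (deriv ^^ Suc j) F (w + 1) * 1) (at w)"
      by (rule DERIV_chain2[OF d]) (auto intro!: derivative_eq_intros)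
    then have "((deriv ^^ j) F has_field_derivative (deriv ^^ Suc j) F (w + 1)) (at w)"
      using Suc by simp
    with d[of w] show ?case using DERIV_unique by blast
  qed (simp add: per)
  have df: "(f j has_real_derivative f (Suc j) t) (at t)" for j t
  proof -
    have "((deriv ^^ j) F has_field_derivative (deriv ^^ Suc j) F (of_real t)) (at (of_real t))"
      using holj[of j] by (auto intro!: holomorphic_derivI[of _ UNIV])
    then have "((\<lambda>t. (deriv ^^ j) F (of_real t)) has_vector_derivative (deriv ^^ Suc j) F (of_real t)) (at t)"
      by (rule has_vector_derivative_real_field)
    then show ?thesis unfolding f_def
      by (subst has_real_derivative_iff_has_vector_derivative)
         (intro bounded_linear.has_vector_derivative[OF bounded_linear_Re])
  qed
  have perf: "f j (t + 1) = f j t" for j t using perj[of j "of_real t"] by (simp add: f_def)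
  define B where "B = fact k * M / Y ^ k"
  have Bk: "\<bar>f k t\<bar> \<le> B" for t
  proof -
    have "cmod ((deriv ^^ k) F (of_real t)) \<le> fact k * M / Y ^ k"
    proof (rule Cauchy_inequality)
      show "F holomorphic_on ball (of_real t) Y" using hol holomorphic_on_subset by blast
      show "continuous_on (cball (of_real t) Y) F"
        using hol holomorphic_on_imp_continuous_on continuous_on_subset by blast
      fix w assume "cmod (of_real t - w) = Y"
      then have "\<bar>Im w\<bar> \<le> Y" using abs_Im_le_cmod[of "of_real t - w"] by simp
      then show "cmod (F w) \<le> M" by (rule bd)
    qed (rule Y)
    then show ?thesis unfolding f_def B_def using abs_Re_le_cmod order_trans by blast
  qed
  have step: "\<bar>f j t - f j s\<bar> \<le> B * \<bar>t - s\<bar>" if "\<And>t. \<bar>f (Suc j) t\<bar> \<le> B" for j t s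
    using field_differentiable_bound[of UNIV "f j" "f (Suc j)" B t s] that df by (auto simp: has_field_derivative_at_within)
  have Bj: "\<forall>t. \<bar>f (Suc j) t\<bar> \<le> B" if "Suc j \<le> k" for j
    using that
  proof (induction "k - Suc j" arbitrary: j)
    case 0
    then have "Suc j = k" by simp
    then show ?case using Bk by simp
  next
    case (Suc d)
    then have "Suc (Suc j) \<le> k" "d = k - Suc (Suc j)" by auto
    then have IH: "\<bar>f (Suc (Suc j)) t\<bar> \<le> B" for t using Suc.hyps(1)[of "Suc j"] by blast
    show ?case
    proof
      fix t
      have "\<exists>z>t. z < t + 1 \<and> (f j has_real_derivative 0) (at z)"
      proof (rule Rolle)
        show "f j t = f j (t + 1)" using perf by simp
        show "continuous_on {t..t + 1} (f j)" using df by (meson DERIV_continuous_on has_field_derivative_at_within)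
        show "\<And>x. t < x \<Longrightarrow> x < t + 1 \<Longrightarrow> f j differentiable at x" using df real_differentiable_def by blast
      qed simp
      then obtain z where z: "t < z" "z < t + 1" "(f j has_real_derivative 0) (at z)" by blast
      then have "f (Suc j) z = 0" using df DERIV_unique by blast
      then have "\<bar>f (Suc j) t\<bar> \<le> B * \<bar>t - z\<bar>" using step[OF IH, of t z] by simp
      also have "\<dots> \<le> B * 1" using z Bk[of 0] by (intro mult_left_mono) auto
      finally show "\<bar>f (Suc j) t\<bar> \<le> B" by simp
    qed
  qed
  have "\<bar>f 0 x - f 0 y\<bar> \<le> B * \<bar>x - y\<bar>" using Bj[of 0] k by (intro step) auto
  also have "\<dots> \<le> B * 1" using xy Bk[of 0] by (intro mult_left_mono) auto
  finally show ?thesis by (simp add: f_def B_def)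
qed

text \<open>This replaces Poisson summation: \<open>cgauss u\<close> is bounded on a strip of width \<open>1/\<surd>u\<close>, so
  Cauchy's inequality makes its high derivatives on the real line small.\<close>

lemma gauss_sum_osc:
  "\<exists>C\<ge>0. \<forall>u x y. 0 < u \<longrightarrow> u \<le> 1 \<longrightarrow> \<bar>x - y\<bar> \<le> 1 \<longrightarrow> \<bar>gauss_sum u x - gauss_sum u y\<bar> \<le> C * u ^ A"
proof -
  \<comment> \<open>On a strip of width 1/sqrt(u), k derivatives gain u^(k/2) = u^(A + 1); the
    additional power of u pays for the 1/u in \<open>gauss_sum_le\<close>.\<close>
  define k where "k = 2 * A + 2"
  define C where "C = fact k * (exp 1 * gauss_const)"
  have "\<bar>gauss_sum u x - gauss_sum u y\<bar> \<le> C * u ^ A" if u: "0 < u" "u \<le> 1" and xy: "\<bar>x - y\<bar> \<le> 1" for u x y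
  proof -
    have "\<bar>Re (cgauss u (of_real x)) - Re (cgauss u (of_real y))\<bar> \<le> fact k * (exp 1 * (gauss_const / u)) / (1 / sqrt u) ^ k"
    proof (rule periodic_osc)
      fix w assume w: "\<bar>Im w\<bar> \<le> 1 / sqrt u"
      have "(Im w)\<^sup>2 \<le> (1 / sqrt u)\<^sup>2" using w u by (intro abs_le_square_iff[THEN iffD1]) auto
      then have "u * (Im w)\<^sup>2 \<le> 1" using u by (simp add: power_divide field_simps)
      then have "exp (u * (Im w)\<^sup>2) * gauss_sum u (Re w) \<le> exp 1 * (gauss_const / u)"
        using u gauss_sum_nonneg by (intro mult_mono gauss_sum_le) auto
      then show "cmod (cgauss u w) \<le> exp 1 * (gauss_const / u)" using cmod_cgauss_le[OF u(1), of w] by linarith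
    qed (use u xy cgauss_holomorphic cgauss_add_1 in \<open>auto simp: k_def\<close>)
    also have "(1 / sqrt u) ^ k = 1 / (u ^ A * u)"
    proof -
      have "k = 2 * (A + 1)" by (simp add: k_def)
      then have "(1 / sqrt u) ^ k = ((1 / sqrt u)\<^sup>2) ^ (A + 1)" by (simp only: power_mult)
      also have "\<dots> = 1 / (u ^ A * u)" using u by (simp add: power_divide)
      finally show ?thesis .
    qed
    also have "fact k * (exp 1 * (gauss_const / u)) / (1 / (u ^ A * u)) = C * u ^ A"
      using u by (simp add: C_def field_simps)
    finally show ?thesis using u by (simp add: cgauss_of_real)
  qed
  moreover have "C \<ge> 0" using gauss_const_pos by (simp add: C_def)
  ultimately show ?thesis by blast
qed

section \<open>The theta function of a shifted square lattice\<close>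

definition theta :: "real \<Rightarrow> real \<Rightarrow> real \<Rightarrow> real" where
  "theta u x y = gauss_sum u x * gauss_sum u y"

abbreviation latsq :: "real \<Rightarrow> real \<Rightarrow> int \<times> int \<Rightarrow> real" where
  "latsq x y b \<equiv> (of_int (fst b) + x)\<^sup>2 + (of_int (snd b) + y)\<^sup>2"

lemma theta_has_sum:
  assumes "u > 0"
  shows "((\<lambda>b. exp (- u * latsq x y b)) has_sum theta u x y) UNIV"
proof -
  have "((\<lambda>(m, n). exp (- u * (of_int m + x)\<^sup>2) * exp (- u * (of_int n + y)\<^sup>2)) has_sum theta u x y) (UNIV :: (int \<times> int) set)"
    unfolding theta_def by (intro summable_on_product_nonneg gauss_has_sum assms) auto
  also have "(\<lambda>(m, n). exp (- u * (of_int m + x)\<^sup>2) * exp (- u * (of_int n + y)\<^sup>2)) = (\<lambda>b. exp (- u * latsq x y b))"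
    by (auto simp: fun_eq_iff exp_add[symmetric] algebra_simps)
  finally show ?thesis .
qed

lemma gauss_sum_le_exp:
  assumes u: "u \<ge> 1" and x: "\<bar>x\<bar> \<le> 1/2"
  shows "gauss_sum u x \<le> exp (- (u - 1) * x\<^sup>2) * gauss_const"
proof -
  have "gauss_sum u x \<le> exp (- (u - 1) * x\<^sup>2) * gauss_sum 1 x"
  proof (rule has_sum_mono[OF gauss_has_sum has_sum_cmult_right[OF gauss_has_sum]])
    fix n :: int
    have "\<bar>x\<bar> \<le> \<bar>of_int n + x\<bar>"
    proof (cases "n = 0")
      case False
      then have "\<bar>of_int n :: real\<bar> \<ge> 1" by (metis of_int_1_le_iff of_int_abs zero_less_abs_iff int_one_le_iff_zero_less)
      then show ?thesis using x by linarith
    qed simp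
    then have "x\<^sup>2 \<le> (of_int n + x)\<^sup>2" by (simp add: abs_le_square_iff)
    then have "(u - 1) * x\<^sup>2 \<le> (u - 1) * (of_int n + x)\<^sup>2" using u by (intro mult_left_mono) auto
    then show "exp (- u * (of_int n + x)\<^sup>2) \<le> exp (- (u - 1) * x\<^sup>2) * exp (- 1 * (of_int n + x)\<^sup>2)"
      by (simp add: exp_add[symmetric] algebra_simps)
  qed (use u in auto)
  also have "\<dots> \<le> exp (- (u - 1) * x\<^sup>2) * gauss_const" using gauss_sum_le[of 1 x] by simp
  finally show ?thesis .
qed

text \<open>Without n = 0 all points n + x have absolute value at least 1/2, whose square is the
  rate 1/4. One unit of u is held back in every term so that the remaining series can still be
  summed.\<close>

lemma gauss_sum_rest:
  assumes u: "u \<ge> 1" and x: "\<bar>x\<bar> \<le> 1/2"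
  shows "gauss_sum u x - exp (- u * x\<^sup>2) \<ge> 0" "gauss_sum u x - exp (- u * x\<^sup>2) \<le> exp (- (u - 1) / 4) * gauss_const"
proof -
  have single: "((\<lambda>n::int. if n = 0 then exp (- u * x\<^sup>2) else 0) has_sum exp (- u * x\<^sup>2)) UNIV"
    by (rule has_sum_finite_neutralI[of "{0}"]) auto
  have "exp (- u * x\<^sup>2) \<le> gauss_sum u x"
    by (rule has_sum_mono[OF single gauss_has_sum]) (use u in auto)
  then show "gauss_sum u x - exp (- u * x\<^sup>2) \<ge> 0" by simp
  have "gauss_sum u x \<le> exp (- u * x\<^sup>2) + exp (- (u - 1) / 4) * gauss_sum 1 x"
  proof (rule has_sum_mono[OF gauss_has_sum has_sum_add[OF single has_sum_cmult_right[OF gauss_has_sum]]])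
    fix n :: int
    show "exp (- u * (of_int n + x)\<^sup>2) \<le> (if n = 0 then exp (- u * x\<^sup>2) else 0) + exp (- (u - 1) / 4) * exp (- 1 * (of_int n + x)\<^sup>2)"
    proof (cases "n = 0")
      case False
      then have "\<bar>of_int n :: real\<bar> \<ge> 1" by (metis of_int_1_le_iff of_int_abs zero_less_abs_iff int_one_le_iff_zero_less)
      then have "\<bar>1/2\<bar> \<le> \<bar>of_int n + x\<bar>" using x by linarith
      then have "(1/2)\<^sup>2 \<le> (of_int n + x)\<^sup>2" by (simp only: abs_le_square_iff)
      then have "(u - 1) * (1/2)\<^sup>2 \<le> (u - 1) * (of_int n + x)\<^sup>2" using u by (intro mult_left_mono) auto
      moreover have "(1/2 :: real)\<^sup>2 = 1/4" by (simp add: power2_eq_square)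
      ultimately have "(u - 1) * (1/4) \<le> u * (of_int n + x)\<^sup>2 - (of_int n + x)\<^sup>2"
        by (simp only: left_diff_distrib mult_1_left)
      then have "- u * (of_int n + x)\<^sup>2 \<le> - (u - 1) / 4 + - 1 * (of_int n + x)\<^sup>2" by linarith
      then have "exp (- u * (of_int n + x)\<^sup>2) \<le> exp (- (u - 1) / 4) * exp (- 1 * (of_int n + x)\<^sup>2)"
        by (simp only: exp_add[symmetric] exp_le_cancel_iff)
      then show ?thesis using False by simp
    qed simp
  qed (use u in auto)
  also have "exp (- (u - 1) / 4) * gauss_sum 1 x \<le> exp (- (u - 1) / 4) * gauss_const" using gauss_sum_le[of 1 x] by simp
  finally show "gauss_sum u x - exp (- u * x\<^sup>2) \<le> exp (- (u - 1) / 4) * gauss_const" by simp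
qed

lemma gauss_sum_continuous: "continuous_on {0<..} (\<lambda>u. gauss_sum u x)"
proof -
  have "continuous_on {a<..} (\<lambda>u. gauss_sum u x)" if a: "a > 0" for a
  proof -
    have "uniform_limit {a<..} (\<lambda>X u. \<Sum>n\<in>X. exp (- u * (of_int n + x)\<^sup>2))
        (\<lambda>u. \<Sum>\<^sub>\<infinity>n::int. exp (- u * (of_int n + x)\<^sup>2)) (finite_subsets_at_top UNIV)"
    proof (rule Weierstrass_m_test_general[where M = "\<lambda>n. exp (- a * (of_int n + x)\<^sup>2)"])
      fix n :: int and u :: real assume "u \<in> {a<..}"
      then show "norm (exp (- u * (of_int n + x)\<^sup>2)) \<le> exp (- a * (of_int n + x)\<^sup>2)"
        by (simp add: mult_right_mono)
    qed (rule gauss_summable[OF a])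
    then show ?thesis unfolding gauss_sum_def
      by (rule uniform_limit_theorem[rotated]) (auto intro!: always_eventually continuous_intros)
  qed
  then have "continuous_on (\<Union>a\<in>{0<..}. {a<..}) (\<lambda>u. gauss_sum u x)"
    by (intro continuous_on_open_UN) auto
  also have "(\<Union>a\<in>{0<..}. {a<..}) = {0::real<..}"
  proof -
    have "\<exists>a>0. a < x" if "x > 0" for x :: real using that by (intro exI[of _ "x/2"]) auto
    then show ?thesis by (auto intro: less_trans)
  qed
  finally show ?thesis .
qed

text \<open>The reference point is the centre of the lattice cell. Its squared distance 1/2 to the
  lattice is the largest possible, so subtracting it never slows the decay for large u, while for
  small u it removes the part of \<open>theta\<close> that blows up.\<close>

definition thdiff :: "real \<Rightarrow> real \<Rightarrow> real \<Rightarrow> real" where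
  "thdiff x y u = theta u x y - theta u (1/2) (1/2)"

lemma thdiff_continuous: "continuous_on {0<..} (thdiff x y)"
  unfolding thdiff_def[abs_def] theta_def by (intro continuous_intros gauss_sum_continuous)

text \<open>The difference of products is telescoped into two terms, each a difference of
  one-dimensional sums times a factor of size 1/u. The exponent \<open>Suc k\<close> in the
  oscillation bound compensates for that factor.\<close>

lemma thdiff_small:
  "\<exists>C\<ge>0. \<forall>x y u. \<bar>x\<bar> \<le> 1/2 \<longrightarrow> \<bar>y\<bar> \<le> 1/2 \<longrightarrow> 0 < u \<longrightarrow> u \<le> 1 \<longrightarrow> \<bar>thdiff x y u\<bar> \<le> C * u ^ k"
proof -
  obtain C where C: "C \<ge> 0" "\<And>u x y. 0 < u \<Longrightarrow> u \<le> 1 \<Longrightarrow> \<bar>x - y\<bar> \<le> 1 \<Longrightarrow> \<bar>gauss_sum u x - gauss_sum u y\<bar> \<le> C * u ^ Suc k"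
    using gauss_sum_osc[of "Suc k"] by blast
  have "\<bar>thdiff x y u\<bar> \<le> 2 * C * gauss_const * u ^ k" if "\<bar>x\<bar> \<le> 1/2" "\<bar>y\<bar> \<le> 1/2" "0 < u" "u \<le> 1" for x y u
  proof -
    define g where "g = gauss_sum u"
    have g: "0 \<le> g t" "g t \<le> gauss_const / u" for t using gauss_sum_nonneg gauss_sum_le that by (auto simp: g_def)
    have d: "\<bar>g x - g (1/2)\<bar> \<le> C * u ^ Suc k" "\<bar>g y - g (1/2)\<bar> \<le> C * u ^ Suc k"
      unfolding g_def using that by (intro C; linarith)+
    have "thdiff x y u = (g x - g (1/2)) * g y + (g y - g (1/2)) * g (1/2)"
      by (simp add: thdiff_def theta_def g_def algebra_simps)
    also have "\<bar>\<dots>\<bar> \<le> \<bar>g x - g (1/2)\<bar> * g y + \<bar>g y - g (1/2)\<bar> * g (1/2)"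
      using g by (intro order_trans[OF abs_triangle_ineq]) (simp add: abs_mult)
    also have "\<dots> \<le> (C * u ^ Suc k) * (gauss_const / u) + (C * u ^ Suc k) * (gauss_const / u)"
      using d g by (intro add_mono mult_mono) (use C(1) that in auto)
    also have "\<dots> = 2 * C * gauss_const * u ^ k" using that by simp
    finally show ?thesis .
  qed
  then show ?thesis using C(1) gauss_const_pos by (intro exI[of _ "2 * C * gauss_const"]) auto
qed

lemma theta_large:
  assumes "u \<ge> 1" "\<bar>x\<bar> \<le> 1/2" "\<bar>y\<bar> \<le> 1/2"
  shows "0 \<le> theta u x y" "theta u x y \<le> gauss_const\<^sup>2 * exp (- (u - 1) * (x\<^sup>2 + y\<^sup>2))"
proof -
  show "0 \<le> theta u x y" by (simp add: theta_def gauss_sum_nonneg)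
  have "theta u x y \<le> (exp (- (u - 1) * x\<^sup>2) * gauss_const) * (exp (- (u - 1) * y\<^sup>2) * gauss_const)"
    unfolding theta_def using assms gauss_const_pos by (intro mult_mono gauss_sum_le_exp gauss_sum_nonneg) auto
  also have "\<dots> = gauss_const\<^sup>2 * exp (- (u - 1) * (x\<^sup>2 + y\<^sup>2))"
    by (simp add: power2_eq_square exp_add[symmetric] algebra_simps)
  finally show "theta u x y \<le> gauss_const\<^sup>2 * exp (- (u - 1) * (x\<^sup>2 + y\<^sup>2))" .
qed

text \<open>These are the decay hypotheses of \<open>mellin_entire\<close>. For u \<le> 1 the power
  comes from the oscillation bound; for u \<ge> 1 both theta values decay at least like exp(-mu)
  with m = x^2 + y^2, the reference point because m \<le> 1/2.\<close>

lemma thdiff_decay: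
  assumes xy: "\<bar>x\<bar> \<le> 1/2" "\<bar>y\<bar> \<le> 1/2"
  shows "\<exists>C. \<forall>u>0. \<bar>thdiff x y u\<bar> \<le> C * u ^ k * exp (- (x\<^sup>2 + y\<^sup>2) * u)"
proof -
  define m where "m = x\<^sup>2 + y\<^sup>2"
  have "x\<^sup>2 \<le> (1/2)\<^sup>2" "y\<^sup>2 \<le> (1/2)\<^sup>2" using xy by (intro abs_le_square_iff[THEN iffD1]; simp)+
  then have m: "0 \<le> m" "m \<le> 1/2" by (auto simp: m_def power2_eq_square)
  obtain C where C: "C \<ge> 0" "\<And>u. 0 < u \<Longrightarrow> u \<le> 1 \<Longrightarrow> \<bar>thdiff x y u\<bar> \<le> C * u ^ k"
    using thdiff_small[of k] xy by blast
  define C' where "C' = max (C * exp m) (gauss_const\<^sup>2 * exp m)"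
  have "\<bar>thdiff x y u\<bar> \<le> C' * u ^ k * exp (- m * u)" if u: "u > 0" for u
  proof (cases "u \<le> 1")
    case True
    have "\<bar>thdiff x y u\<bar> \<le> C * u ^ k" using C u True by blast
    also have "\<dots> \<le> C * u ^ k * exp (m * (1 - u))"
      using C(1) u m True mult_left_mono[of 1 "exp (m * (1 - u))" "C * u ^ k"] by simp
    also have "\<dots> = (C * exp m) * u ^ k * exp (- m * u)" by (simp add: exp_diff exp_minus field_simps)
    also have "\<dots> \<le> C' * u ^ k * exp (- m * u)" using u by (intro mult_right_mono) (auto simp: C'_def)
    finally show ?thesis .
  next
    case False
    then have u1: "u \<ge> 1" by simp
    have half: "0 \<le> theta u (1/2) (1/2)" "theta u (1/2) (1/2) \<le> gauss_const\<^sup>2 * exp (- (u - 1) * m)"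
    proof -
      have "theta u (1/2) (1/2) \<le> gauss_const\<^sup>2 * exp (- (u - 1) * ((1/2)\<^sup>2 + (1/2)\<^sup>2))"
        using u1 by (intro theta_large) auto
      also have "\<dots> \<le> gauss_const\<^sup>2 * exp (- (u - 1) * m)"
      proof -
        have "(u - 1) * m \<le> (u - 1) * ((1/2)\<^sup>2 + (1/2)\<^sup>2)" using m u1 by (intro mult_left_mono) (auto simp: power2_eq_square)
        then have "exp (- (u - 1) * ((1/2)\<^sup>2 + (1/2)\<^sup>2)) \<le> exp (- (u - 1) * m)"
          by (simp only: mult_minus_left neg_le_iff_le exp_le_cancel_iff)
        then show ?thesis by (rule mult_left_mono) simp
      qed
      finally show "theta u (1/2) (1/2) \<le> gauss_const\<^sup>2 * exp (- (u - 1) * m)" .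
    qed (use theta_large u1 in auto)
    have "\<bar>thdiff x y u\<bar> \<le> gauss_const\<^sup>2 * exp (- (u - 1) * m)"
      using half theta_large[OF u1 xy] unfolding thdiff_def m_def by linarith
    also have "\<dots> = (gauss_const\<^sup>2 * exp m) * 1 * exp (- m * u)" by (simp add: exp_diff exp_minus field_simps)
    also have "\<dots> \<le> C' * u ^ k * exp (- m * u)"
      using u1 C(1) by (intro mult_right_mono mult_mono) (auto simp: C'_def max_def)
    finally show ?thesis .
  qed
  then show ?thesis unfolding m_def by blast
qed

text \<open>The decay rate in \<open>thdiff_decay\<close> degenerates as the point approaches the
  lattice. Only one lattice vector is responsible, and once its term is removed the remainder decays
  at the rate 1/4 with a constant uniform in the point. That uniformity becomes the error O(1/|Q|)
  in the central value.\<close>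

lemma thdiff_main_term:
  "\<exists>C\<ge>0. \<forall>x y u. \<bar>x\<bar> \<le> 1/2 \<longrightarrow> \<bar>y\<bar> \<le> 1/2 \<longrightarrow> 0 < u \<longrightarrow> \<bar>thdiff x y u - exp (- (x\<^sup>2 + y\<^sup>2) * u)\<bar> \<le> C * exp (- (1/4) * u)"
proof -
  obtain C where C: "C \<ge> 0" "\<And>x y u. \<bar>x\<bar> \<le> 1/2 \<Longrightarrow> \<bar>y\<bar> \<le> 1/2 \<Longrightarrow> 0 < u \<Longrightarrow> u \<le> 1 \<Longrightarrow> \<bar>thdiff x y u\<bar> \<le> C"
    using thdiff_small[of 0] by auto
  define G where "G = gauss_const"
  have G: "G \<ge> 1" using gauss_const_pos by (simp add: G_def)
  define C' where "C' = (C + 1 + 4 * G\<^sup>2) * exp (1/4)"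
  have "\<bar>thdiff x y u - exp (- (x\<^sup>2 + y\<^sup>2) * u)\<bar> \<le> C' * exp (- (1/4) * u)"
    if xy: "\<bar>x\<bar> \<le> 1/2" "\<bar>y\<bar> \<le> 1/2" and u: "0 < u" for x y u
  proof (cases "u \<le> 1")
    case True
    have "\<bar>thdiff x y u - exp (- (x\<^sup>2 + y\<^sup>2) * u)\<bar> \<le> C + 1"
      using C(2)[OF xy u True] u by (smt (verit) exp_le_one_iff exp_ge_zero mult_minus_left mult_nonneg_nonneg sum_power2_ge_zero)
    also have "\<dots> \<le> C + 1 + 4 * G\<^sup>2" by simp
    also have "\<dots> \<le> (C + 1 + 4 * G\<^sup>2) * exp (1/4 - (1/4) * u)"
      using C(1) True mult_left_mono[of 1 "exp (1/4 - (1/4) * u)" "C + 1 + 4 * G\<^sup>2"] by simp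
    also have "exp (1/4 - (1/4) * u) = exp (1/4) * exp (- (1/4) * u)" by (simp add: exp_add[symmetric])
    also have "(C + 1 + 4 * G\<^sup>2) * (exp (1/4) * exp (- (1/4) * u)) = C' * exp (- (1/4) * u)" by (simp add: C'_def)
    finally show ?thesis .
  next
    case False
    then have u1: "u \<ge> 1" by simp
    define e where "e = exp (- (u - 1) / 4)"
    have e: "0 \<le> e" "e \<le> 1" using u1 by (auto simp: e_def)
    define a b where "a = exp (- u * x\<^sup>2)" and "b = exp (- u * y\<^sup>2)"
    define h h' where "h = gauss_sum u x - a" and "h' = gauss_sum u y - b"
    have ab: "0 \<le> a" "a \<le> 1" "0 \<le> b" "b \<le> 1" using u by (auto simp: a_def b_def)
    have h: "0 \<le> h" "h \<le> e * G" "0 \<le> h'" "h' \<le> e * G"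
      unfolding h_def h'_def a_def b_def e_def G_def using gauss_sum_rest[OF u1] xy by auto
    have "theta u x y - a * b = a * h' + h * b + h * h'"
      by (simp add: theta_def h_def h'_def algebra_simps)
    moreover have "a * h' \<le> 1 * (e * G)" "h * b \<le> (e * G) * 1" "h * h' \<le> (e * G) * (1 * G)"
      using ab h e G by (intro mult_mono order_trans[OF h(4)]; auto)+
    moreover have "e * G \<le> e * (G * G)" using e G by (intro mult_left_mono) auto
    moreover have "0 \<le> a * h'" "0 \<le> h * b" "0 \<le> h * h'" using ab h by auto
    moreover have "a * b = exp (- (x\<^sup>2 + y\<^sup>2) * u)" by (simp add: a_def b_def exp_add[symmetric] algebra_simps)
    moreover have "theta u (1/2) (1/2) \<ge> 0" using theta_large(1)[of u "1/2" "1/2"] u1 by simp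
    moreover have "theta u (1/2) (1/2) \<le> e * (G * G)"
    proof -
      have "theta u (1/2) (1/2) \<le> G\<^sup>2 * exp (- (u - 1) * ((1/2)\<^sup>2 + (1/2)\<^sup>2))"
        unfolding G_def using u1 by (intro theta_large) auto
      also have "\<dots> \<le> G\<^sup>2 * e" using u1 by (intro mult_left_mono) (auto simp: e_def power2_eq_square)
      finally show ?thesis by (simp add: power2_eq_square mult_ac)
    qed
    ultimately have "\<bar>thdiff x y u - exp (- (x\<^sup>2 + y\<^sup>2) * u)\<bar> \<le> 4 * (e * (G * G))"
      unfolding thdiff_def by (simp add: mult.assoc)
    also have "\<dots> \<le> (C + 1 + 4 * G\<^sup>2) * e"
      using C(1) e by (simp add: power2_eq_square algebra_simps)
    also have "e = exp (1/4) * exp (- (1/4) * u)" by (simp add: e_def exp_add[symmetric] field_simps)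
    also have "(C + 1 + 4 * G\<^sup>2) * (exp (1/4) * exp (- (1/4) * u)) = C' * exp (- (1/4) * u)" by (simp add: C'_def)
    finally show ?thesis .
  qed
  moreover have "C' \<ge> 0" using C(1) by (simp add: C'_def)
  ultimately show ?thesis by blast
qed

section \<open>Mellin transforms and the Epstein zeta function\<close>

lemma cmod_powr_of_real: "u > 0 \<Longrightarrow> cmod (of_real u powr s) = u powr Re s"
  by (simp add: norm_powr_real_powr)

lemma continuous_on_of_real_powr: "continuous_on {0<..} (\<lambda>u. of_real u powr s :: complex)"
  by (intro continuous_intros) (auto simp: complex_nonpos_Reals_iff)

lemma set_measurable_cont:
  fixes f :: "real \<Rightarrow> 'a::real_normed_vector"
  assumes "continuous_on {0<..} f"
  shows "set_borel_measurable borel {0<..} f"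
  unfolding set_borel_measurable_def using assms by (intro borel_measurable_continuous_on_indicator) auto

lemma Gamma_integrable:
  assumes "Re s > 0" "c > 0"
  shows "set_integrable lborel {0<..} (\<lambda>u. of_real u powr (s - 1) * of_real (exp (- c * u)) :: complex)"
proof -
  have "(\<lambda>t. complex_of_real t powr (s - 1) / of_real (exp (c * t))) absolutely_integrable_on {0<..}"
    by (rule absolutely_integrable_Gamma_integral[OF assms])
  also have "(\<lambda>t. complex_of_real t powr (s - 1) / of_real (exp (c * t))) = (\<lambda>u. of_real u powr (s - 1) * of_real (exp (- c * u)))"
    by (simp add: fun_eq_iff exp_minus divide_inverse)
  finally have "integrable lebesgue (\<lambda>u. indicator {0<..} u *\<^sub>R (of_real u powr (s - 1) * of_real (exp (- c * u)) :: complex))"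
    by (simp add: set_integrable_def)
  moreover have "(\<lambda>u. indicator {0<..} u *\<^sub>R (of_real u powr (s - 1) * of_real (exp (- c * u)) :: complex)) \<in> borel_measurable lborel"
    by (subst measurable_cong_sets[OF sets_lborel refl], intro borel_measurable_continuous_on_indicator continuous_intros continuous_on_of_real_powr) auto
  ultimately show ?thesis by (simp add: set_integrable_def integrable_completion)
qed

lemma Gamma_integral_1:
  assumes "Re s > 0"
  shows "(LINT u:{0<..}|lborel. of_real u powr (s - 1) * of_real (exp (- u)) :: complex) = Gamma s"
proof -
  have "(LINT u:{0<..}|lborel. of_real u powr (s - 1) * of_real (exp (- u)) :: complex) =
      integral {0<..} (\<lambda>u. of_real u powr (s - 1) * of_real (exp (- u)))"
    using Gamma_integrable[OF assms, of 1] by (intro set_borel_integral_eq_integral) auto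
  also have "\<dots> = integral {0<..} (\<lambda>t. complex_of_real t powr (s - 1) / of_real (exp t))"
    by (simp add: exp_minus divide_inverse)
  also have "\<dots> = Gamma s" using Gamma_integral_complex'[OF assms] by (rule integral_unique)
  finally show ?thesis .
qed

lemma Gamma_integral:
  assumes "Re s > 0" "c > 0"
  shows "(LINT u:{0<..}|lborel. of_real u powr (s - 1) * of_real (exp (- c * u)) :: complex) = Gamma s * of_real c powr (- s)"
proof -
  define f where "f u = indicator {0<..} u *\<^sub>R (of_real u powr (s - 1) * of_real (exp (- c * u)) :: complex)" for u
  have "(LINT u:{0<..}|lborel. of_real u powr (s - 1) * of_real (exp (- c * u)) :: complex) = (\<integral>u. f u \<partial>lborel)"
    by (simp add: set_lebesgue_integral_def f_def)
  also have "\<dots> = \<bar>1 / c\<bar> *\<^sub>R (\<integral>u. f (0 + (1 / c) * u) \<partial>lborel)"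
    using assms by (intro lborel_integral_real_affine) simp
  also have "(\<lambda>u. f (0 + (1 / c) * u)) = (\<lambda>u. of_real (1 / c) powr (s - 1) * (indicator {0<..} u *\<^sub>R (of_real u powr (s - 1) * of_real (exp (- u)))))"
  proof
    fix u :: real
    show "f (0 + (1 / c) * u) = of_real (1 / c) powr (s - 1) * (indicator {0<..} u *\<^sub>R (of_real u powr (s - 1) * of_real (exp (- u))))"
    proof (cases "u > 0")
      case True
      have "complex_of_real ((1 / c) * u) powr (s - 1) = of_real (1 / c) powr (s - 1) * of_real u powr (s - 1)"
        unfolding of_real_mult using assms True by (intro powr_times_real) auto
      then show ?thesis using True assms by (simp add: f_def zero_less_divide_iff)
    next
      case False
      then show ?thesis using assms by (simp add: f_def zero_less_divide_iff)
    qed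
  qed
  also have "(\<integral>u. of_real (1 / c) powr (s - 1) * (indicator {0<..} u *\<^sub>R (of_real u powr (s - 1) * of_real (exp (- u)))) \<partial>lborel)
      = of_real (1 / c) powr (s - 1) * Gamma s"
    unfolding Gamma_integral_1[OF assms(1), unfolded set_lebesgue_integral_def, symmetric] by (rule integral_mult_right_zero)
  also have "\<bar>1 / c\<bar> *\<^sub>R (of_real (1 / c) powr (s - 1) * Gamma s) = Gamma s * (of_real (1 / c) powr (s - 1) * of_real (1 / c))"
    using assms by (simp add: scaleR_conv_of_real)
  also have "of_real (1 / c) powr (s - 1) * of_real (1 / c) = (of_real c powr (- s) :: complex)"
  proof -
    have "of_real (1 / c) powr (s - 1) * of_real (1 / c) = exp ((s - 1) * of_real (ln (1 / c))) * of_real (exp (ln (1 / c)))"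
      using assms by (simp add: powr_def Ln_of_real del: of_real_divide)
    also have "\<dots> = exp ((s - 1) * of_real (ln (1 / c)) + of_real (ln (1 / c)))"
      by (simp only: exp_of_real[symmetric] exp_add)
    also have "\<dots> = exp (- s * of_real (ln c))" using assms by (simp add: ln_div algebra_simps)
    also have "\<dots> = of_real c powr (- s)" using assms by (simp add: powr_def Ln_of_real)
    finally show ?thesis .
  qed
  finally show ?thesis .
qed

section \<open>Mellin transforms of rapidly decaying functions\<close>

definition mellin :: "(real \<Rightarrow> real) \<Rightarrow> complex \<Rightarrow> complex" where
  "mellin D s = (LINT u:{0<..}|lborel. of_real u powr (s - 1) * of_real (D u))"

lemma set_integrable_dominated:
  fixes f :: "real \<Rightarrow> complex" and g :: "real \<Rightarrow> real"
  assumes g: "set_integrable lborel {0<..} g" and f: "continuous_on {0<..} f"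
    and le: "\<And>u. u > 0 \<Longrightarrow> cmod (f u) \<le> g u"
  shows "set_integrable lborel {0<..} f"
proof (rule set_integrable_bound[OF g])
  show "set_borel_measurable lborel {0<..} f" using set_measurable_cont[OF f] by (simp add: set_borel_measurable_def)
  show "AE x in lborel. x \<in> {0<..} \<longrightarrow> cmod (f x) \<le> norm (g x)"
  proof (intro always_eventually allI impI)
    fix x :: real assume "x \<in> {0<..}"
    then have "cmod (f x) \<le> g x" using le by simp
    then show "cmod (f x) \<le> norm (g x)" by simp
  qed
qed

lemma power_exp_integrable:
  assumes "c > 0"
  shows "set_integrable lborel {0<..} (\<lambda>u::real. u ^ n * exp (- c * u))"
proof -
  have "set_integrable lborel {0<..} (\<lambda>u. of_real u powr (of_nat (Suc n) - 1) * of_real (exp (- c * u)) :: complex)"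
    using assms by (intro Gamma_integrable) auto
  then have "set_integrable lborel {0<..} (\<lambda>u. Re (of_real u powr (of_nat (Suc n) - 1) * of_real (exp (- c * u)) :: complex))"
    unfolding set_integrable_def
    by (drule_tac integrable_Re) simp
  also have "?this \<longleftrightarrow> ?thesis"
  proof (rule set_integrable_cong)
    fix u :: real assume "u \<in> {0<..}"
    then have "complex_of_real u powr (of_nat (Suc n) - 1) = of_real (u ^ n)" by (simp add: powr_nat')
    then show "Re (of_real u powr (of_nat (Suc n) - 1) * of_real (exp (- c * u)) :: complex) = u ^ n * exp (- c * u)"
      by (simp flip: of_real_mult)
  qed auto
  finally show ?thesis .
qed

text \<open>Integrals over compact intervals are holomorphic by differentiation under the integral
  sign. They converge uniformly on each closed unit disc, because a single integrable function
  dominates the integrand for all s in the disc and the error is its tail.\<close>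

lemma mellin_entire:
  assumes cont: "continuous_on {0<..} D" and c: "c > 0"
    and bd: "\<And>k. \<exists>C. \<forall>u>0. \<bar>D u\<bar> \<le> C * u ^ k * exp (- c * u)"
  shows "set_integrable lborel {0<..} (\<lambda>u. of_real u powr (s - 1) * of_real (D u) :: complex)"
    and "mellin D holomorphic_on UNIV"
proof -
  define f where "f s u = of_real u powr (s - 1) * of_real (D u)" for s :: complex and u :: real
  have contf: "continuous_on {0<..} (f s)" for s
    unfolding f_def by (intro continuous_intros continuous_on_of_real_powr cont)
  have dom: "\<exists>B. set_integrable lborel {0<..} B \<and> (\<forall>u>0. 0 \<le> B u) \<and> (\<forall>s\<in>cball s0 1. \<forall>u>0. cmod (f s u) \<le> B u)" for s0
  proof -
    \<comment> \<open>For k \<ge> |s0| + 2 every s in the unit disc about s0 satisfies |Re s - 1|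
      \<le> k, so the factor u^k of the decay hypothesis absorbs the singularity at 0 and one bound
      serves the whole disc.\<close>
    define k where "k = nat \<lceil>cmod s0 + 2\<rceil>"
    have k: "real k \<ge> cmod s0 + 2" unfolding k_def by linarith
    obtain C where C: "\<And>u. u > 0 \<Longrightarrow> \<bar>D u\<bar> \<le> C * u ^ k * exp (- c * u)" using bd by blast
    define N where "N = 2 * k"
    define B where "B u = C * (u ^ 0 * exp (- c * u) + u ^ N * exp (- c * u))" for u
    have C0: "C \<ge> 0" using C[of 1] by (smt (verit) exp_gt_zero mult_1_right power_one zero_less_one mult_less_0_iff)
    have "set_integrable lborel {0<..} B"
      unfolding B_def by (intro set_integrable_mult_right set_integral_add power_exp_integrable c)
    moreover have "0 \<le> B u" if "u > 0" for u using that C0 by (simp add: B_def)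
    moreover have "cmod (f s u) \<le> B u" if s: "s \<in> cball s0 1" and u: "u > 0" for s u
    proof -
      have "cmod s \<le> cmod s0 + 1" using s norm_triangle_ineq2[of s s0] by (simp add: dist_norm norm_minus_commute)
      then have r: "- real k \<le> Re s - 1" "Re s - 1 \<le> real k" using k abs_Re_le_cmod[of s] by linarith+
      have "u powr (Re s - 1) * u ^ k \<le> 1 + u ^ N"
      proof -
        have "u powr (Re s - 1) * u ^ k = u powr (Re s - 1 + real k)" using u by (simp add: powr_add powr_realpow)
        also have "\<dots> \<le> 1 + u powr (real N)"
        proof (cases "u \<le> 1")
          case True
          then have "u powr (Re s - 1 + real k) \<le> 1" using u r by (intro powr_le1) auto
          then show ?thesis using powr_ge_zero[of u "real N"] by linarith
        next
          case False
          then have "u powr (Re s - 1 + real k) \<le> u powr (real N)" using r by (intro powr_mono) (auto simp: N_def)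
          then show ?thesis by simp
        qed
        also have "\<dots> = 1 + u ^ N" using u by (simp add: powr_realpow)
        finally show ?thesis .
      qed
      then have "C * exp (- c * u) * (u powr (Re s - 1) * u ^ k) \<le> C * exp (- c * u) * (1 + u ^ N)"
        using C0 by (intro mult_left_mono) auto
      moreover have "cmod (f s u) \<le> u powr (Re s - 1) * (C * u ^ k * exp (- c * u))"
        unfolding f_def using C[OF u] u by (simp add: norm_mult cmod_powr_of_real mult_left_mono)
      ultimately show ?thesis by (simp add: B_def algebra_simps)
    qed
    ultimately show ?thesis by blast
  qed
  have int: "set_integrable lborel {0<..} (f s)" for s
  proof -
    obtain B where B: "set_integrable lborel {0<..} B" "\<forall>u>0. 0 \<le> B u" "\<forall>s'\<in>cball s 1. \<forall>u>0. cmod (f s' u) \<le> B u"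
      using dom by blast
    then show ?thesis using contf by (intro set_integrable_dominated[OF B(1)]) auto
  qed
  then show "set_integrable lborel {0<..} (\<lambda>u. of_real u powr (s - 1) * of_real (D u) :: complex)"
    by (simp add: f_def[abs_def])
  define A where "A n = {1 / real (Suc n) .. real (Suc n)}" for n
  have Apos: "A n \<subseteq> {0<..}" for n
  proof
    fix x assume "x \<in> A n"
    then have "1 / real (Suc n) \<le> x" by (simp add: A_def)
    moreover have "1 / real (Suc n) > 0" by simp
    ultimately have "x > 0" by linarith
    then show "x \<in> {0<..}" by simp
  qed
  have Ainc: "incseq A"
  proof (rule incseq_SucI)
    show "A n \<subseteq> A (Suc n)" for n
    proof -
      have "1 / real (Suc (Suc n)) \<le> 1 / real (Suc n)" by (intro divide_left_mono) auto
      then show ?thesis unfolding A_def by auto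
    qed
  qed
  have AU: "(\<Union>n. A n) = {0<..}"
  proof
    show "{0<..} \<subseteq> (\<Union>n. A n)"
    proof
      fix x :: real assume "x \<in> {0<..}"
      then have x: "x > 0" by simp
      obtain n where n: "real n \<ge> max x (1 / x)" using real_arch_simple by blast
      then have "real (Suc n) \<ge> x" "real (Suc n) \<ge> 1 / x" by auto
      then have "x \<in> A n" using x by (auto simp: A_def field_simps)
      then show "x \<in> (\<Union>n. A n)" by blast
    qed
  qed (use Apos in auto)
  have Am: "A n \<in> sets lborel" for n by (simp add: A_def)
  have intA: "set_integrable lborel (A n) (f s)" for n s
    using int by (rule set_integrable_subset) (use Apos Am in auto)
  show "mellin D holomorphic_on UNIV"
  proof (rule holomorphic_uniform_sequence[of _ "\<lambda>n s. LINT u:A n|lborel. f s u"])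
    fix n
    have "(\<lambda>s. integral (cbox (1 / real (Suc n)) (real (Suc n))) (f s)) holomorphic_on UNIV"
    proof (rule leibniz_rule_holomorphic[where fx = "\<lambda>s u. of_real u powr (s - 1) * Ln (of_real u) * of_real (D u)"])
      fix s :: complex and u :: real assume "u \<in> cbox (1 / real (Suc n)) (real (Suc n))"
      then have "u \<in> A n" by (simp add: A_def)
      then have "u > 0" using Apos by auto
      then show "((\<lambda>s. f s u) has_field_derivative of_real u powr (s - 1) * Ln (of_real u) * of_real (D u)) (at s within UNIV)"
        unfolding f_def powr_def by (auto intro!: derivative_eq_intros)
    next
      fix s show "f s integrable_on cbox (1 / real (Suc n)) (real (Suc n))"
        using set_borel_integral_eq_integral(1)[OF intA[of n s]] by (simp add: A_def)
    next
      have *: "continuous_on (UNIV \<times> A n) (\<lambda>(s, u). exp ((s - 1) * of_real (ln u)) * of_real (ln u) * of_real (D u) :: complex)"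
        unfolding case_prod_unfold
        using Apos[of n] by (intro continuous_intros continuous_on_compose2[OF cont]) auto
      have "?this \<longleftrightarrow> continuous_on (UNIV \<times> A n) (\<lambda>(s, u). of_real u powr (s - 1) * Ln (of_real u) * of_real (D u) :: complex)"
      proof (rule continuous_on_cong[OF refl])
        fix p :: "complex \<times> real" assume "p \<in> UNIV \<times> A n"
        then have "snd p > 0" using Apos[of n] by auto
        then show "(\<lambda>(s, u). exp ((s - 1) * of_real (ln u)) * of_real (ln u) * of_real (D u)) p =
            (\<lambda>(s, u). of_real u powr (s - 1) * Ln (of_real u) * of_real (D u)) p"
          by (simp add: case_prod_unfold powr_def Ln_of_real)
      qed
      then show "continuous_on (UNIV \<times> cbox (1 / real (Suc n)) (real (Suc n))) (\<lambda>(s, u). of_real u powr (s - 1) * Ln (of_real u) * of_real (D u) :: complex)"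
        using * by (simp add: A_def)
    qed auto
    moreover have "(LINT u:A n|lborel. f s u) = integral (cbox (1 / real (Suc n)) (real (Suc n))) (f s)" for s
      using set_borel_integral_eq_integral(2)[OF intA[of n s]] by (simp add: A_def)
    ultimately show "(\<lambda>s. LINT u:A n|lborel. f s u) holomorphic_on UNIV" by simp
  next
    fix s0 :: complex
    obtain B where B: "set_integrable lborel {0<..} B" "\<forall>u>0. 0 \<le> B u" "\<forall>s\<in>cball s0 1. \<forall>u>0. cmod (f s u) \<le> B u"
      using dom by blast
    have intBA: "set_integrable lborel (A n) B" for n
      using B(1) by (rule set_integrable_subset) (use Apos Am in auto)
    have intBA': "set_integrable lborel ({0<..} - A n) B" for n
      using B(1) by (rule set_integrable_subset) (use Am in auto)
    have intfA': "set_integrable lborel ({0<..} - A n) (f s)" for n s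
      using int by (rule set_integrable_subset) (use Am in auto)
    have split: "{0<..} = A n \<union> ({0<..} - A n)" for n using Apos by auto
    define e where "e n = (LINT u:{0<..}|lborel. B u) - (LINT u:A n|lborel. B u)" for n
    have e: "e n = (LINT u:{0<..} - A n|lborel. B u)" for n
      unfolding e_def by (subst (1) split[of n], subst set_integral_Un) (auto intro!: intBA intBA')
    have "(\<lambda>n. LINT u:A n|lborel. B u) \<longlonglongrightarrow> (LINT u:(\<Union>n. A n)|lborel. B u)"
      using Am Ainc B(1) by (intro set_integral_cont_up) (auto simp: AU)
    then have "e \<longlonglongrightarrow> (LINT u:{0<..}|lborel. B u) - (LINT u:{0<..}|lborel. B u)"
      unfolding e_def AU by (intro tendsto_intros)
    then have e0: "e \<longlonglongrightarrow> 0" by simp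
    have diff: "cmod ((LINT u:A n|lborel. f s u) - mellin D s) \<le> e n" if "s \<in> cball s0 1" for s n
    proof -
      have "mellin D s = (LINT u:A n|lborel. f s u) + (LINT u:{0<..} - A n|lborel. f s u)"
        unfolding mellin_def f_def[symmetric]
        by (subst (1) split[of n], subst set_integral_Un) (auto intro!: intA intfA')
      then have "cmod ((LINT u:A n|lborel. f s u) - mellin D s) = cmod (LINT u:{0<..} - A n|lborel. f s u)" by simp
      also have "\<dots> \<le> (LINT u:{0<..} - A n|lborel. cmod (f s u))" by (rule set_integral_norm_bound[OF intfA'])
      also have "\<dots> \<le> (LINT u:{0<..} - A n|lborel. B u)"
        using that B by (intro set_integral_mono set_integrable_norm intfA' intBA') auto
      finally show ?thesis unfolding e .
    qed
    have "uniform_limit (cball s0 1) (\<lambda>n s. LINT u:A n|lborel. f s u) (mellin D) sequentially"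
    proof (rule uniform_limitI)
      fix \<epsilon> :: real assume "\<epsilon> > 0"
      then have "eventually (\<lambda>n. e n < \<epsilon>) sequentially" by (rule order_tendstoD(2)[OF e0])
      then show "\<forall>\<^sub>F n in sequentially. \<forall>s\<in>cball s0 1. dist (LINT u:A n|lborel. f s u) (mellin D s) < \<epsilon>"
      proof (rule eventually_mono)
        fix n assume n: "e n < \<epsilon>"
        show "\<forall>s\<in>cball s0 1. dist (LINT u:A n|lborel. f s u) (mellin D s) < \<epsilon>"
        proof
          fix s assume "s \<in> cball s0 1"
          from diff[OF this, of n] n show "dist (LINT u:A n|lborel. f s u) (mellin D s) < \<epsilon>"
            unfolding dist_norm by linarith
        qed
      qed
    qed
    then show "\<exists>d. 0 < d \<and> cball s0 d \<subseteq> UNIV \<and> uniform_limit (cball s0 d) (\<lambda>n s. LINT u:A n|lborel. f s u) (mellin D) sequentially"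
      by (intro exI[of _ 1]) auto
  qed auto
qed

section \<open>Lattice sums as Mellin transforms of theta functions\<close>

lemma lattice_summable:
  assumes xy: "\<bar>x\<bar> \<le> 1/2" "\<bar>y\<bar> \<le> 1/2" "(x, y) \<noteq> (0, 0)" and \<sigma>: "\<sigma> > 1"
  shows "(\<lambda>b. latsq x y b powr (- \<sigma>)) summable_on UNIV"
proof -
  define \<mu> where "\<mu> = x\<^sup>2 + y\<^sup>2"
  have mu: "\<mu> > 0" using xy(3) by (auto simp: \<mu>_def sum_power2_gt_zero_iff)
  have "x\<^sup>2 \<le> (1/2)\<^sup>2" "y\<^sup>2 \<le> (1/2)\<^sup>2" using xy by (intro abs_le_square_iff[THEN iffD1]; simp)+
  then have mu2: "\<mu> \<le> 1/2" by (auto simp: \<mu>_def power2_eq_square)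
  define w where "w n = (1 + (of_int n)\<^sup>2 :: real) powr (- \<sigma> / 2)" for n :: int
  obtain W where W: "(w has_sum W) UNIV"
    using summable_on_int_square_powr[OF \<sigma>] unfolding w_def summable_on_def by blast
  have "(\<lambda>(m, n). w m * w n) summable_on UNIV"
    using summable_on_product_nonneg[OF W W] by (auto simp: summable_on_def w_def)
  then have "(\<lambda>b. (\<mu> / 5) powr (- \<sigma>) * (case b of (m, n) \<Rightarrow> w m * w n)) summable_on UNIV"
    by (rule summable_on_cmult_right)
  then show ?thesis
  proof (rule summable_on_comparison_test)
    fix b :: "int \<times> int"
    obtain m n where b: "b = (m, n)" by fastforce
    define P Q where "P = (of_int m :: real)\<^sup>2" and "Q = (of_int n :: real)\<^sup>2"
    have PQ: "P \<ge> 0" "Q \<ge> 0" by (auto simp: P_def Q_def)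
    have sq: "t\<^sup>2 / 4 \<le> (t + s)\<^sup>2 \<and> s\<^sup>2 \<le> (t + s)\<^sup>2" if "t = of_int k" "\<bar>s\<bar> \<le> 1/2" for t s :: real and k :: int
    proof -
      have "\<bar>t / 2\<bar> \<le> \<bar>t + s\<bar>" using int_shift_abs_ge[OF that(2), of k] that(1) by simp
      moreover have "\<bar>s\<bar> \<le> \<bar>t + s\<bar>"
      proof (cases "k = 0")
        case False
        then have "\<bar>of_int k :: real\<bar> \<ge> 1" by (metis of_int_1_le_iff of_int_abs zero_less_abs_iff int_one_le_iff_zero_less)
        then show ?thesis using that by linarith
      qed (use that in simp)
      ultimately have "(t / 2)\<^sup>2 \<le> (t + s)\<^sup>2 \<and> s\<^sup>2 \<le> (t + s)\<^sup>2" by (simp only: abs_le_square_iff)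
      then show ?thesis by (simp add: power_divide)
    qed
    have "P / 4 + Q / 4 \<le> latsq x y b" "\<mu> \<le> latsq x y b"
      using sq[of _ m x] sq[of _ n y] xy by (auto simp: b P_def Q_def \<mu>_def intro!: add_mono)
    moreover define L where "L = latsq x y b"
    \<comment> \<open>Four times the first lower bound for L plus once the second; this is the
      origin of the 5.\<close>
    ultimately have "5 * L \<ge> (P + Q) + \<mu>" by simp
    moreover have "(P + Q) + \<mu> \<ge> \<mu> * (1 + P + Q)"
      using mult_right_mono[of \<mu> 1 "P + Q"] mu2 PQ by (simp add: algebra_simps)
    ultimately have ge: "latsq x y b \<ge> (\<mu> / 5) * (1 + P + Q)" unfolding L_def[symmetric] by simp
    have "latsq x y b powr (- \<sigma>) \<le> ((\<mu> / 5) * (1 + P + Q)) powr (- \<sigma>)"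
      using ge mu PQ \<sigma> by (intro powr_mono2') auto
    also have "\<dots> = (\<mu> / 5) powr (- \<sigma>) * (1 + P + Q) powr (- \<sigma>)" using mu PQ by (intro powr_mult)
    also have "(1 + P + Q) powr (- \<sigma>) = ((1 + P + Q)\<^sup>2) powr (- \<sigma> / 2)"
      using PQ powr_powr[of "1 + P + Q" 2 "- \<sigma> / 2"] by (simp add: powr_numeral)
    \<comment> \<open>This separates the variables, so that the majorant is a product of two
      one-dimensional series, each convergent for \<sigma> > 1.\<close>
    also have "\<dots> \<le> ((1 + P) * (1 + Q)) powr (- \<sigma> / 2)"
    proof (rule powr_mono2')
      have "(1 + P + Q)\<^sup>2 = (1 + P) * (1 + Q) + (P + Q + P * P + Q * Q + P * Q)" by (simp add: power2_eq_square algebra_simps)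
      then show "(1 + P) * (1 + Q) \<le> (1 + P + Q)\<^sup>2" using PQ by simp
    qed (use PQ \<sigma> in \<open>auto intro!: mult_pos_pos add_pos_nonneg\<close>)
    also have "\<dots> = w m * w n" using PQ by (simp add: w_def P_def Q_def powr_mult)
    finally show "latsq x y b powr (- \<sigma>) \<le> (\<mu> / 5) powr (- \<sigma>) * (case b of (m, n) \<Rightarrow> w m * w n)"
      using mu by (simp add: b mult_left_mono)
  qed auto
qed

lemma latsq_pos:
  assumes "\<bar>x\<bar> \<le> 1/2" "\<bar>y\<bar> \<le> 1/2" "(x, y) \<noteq> (0, 0)"
  shows "latsq x y b > 0"
proof -
  have "t = 0" if "of_int k + t = 0" "\<bar>t\<bar> \<le> 1/2" for k :: int and t :: real
  proof -
    have "\<bar>of_int k :: real\<bar> \<le> 1/2" using that by linarith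
    then have "\<bar>of_int k :: real\<bar> < 1" by linarith
    then have "k = 0" by (metis of_int_abs of_int_less_1_iff abs_ge_zero int_one_le_iff_zero_less abs_le_zero_iff not_less zero_less_abs_iff)
    then show ?thesis using that by simp
  qed
  then show ?thesis using assms by (auto simp: sum_power2_gt_zero_iff)
qed

text \<open>Termwise integration, along an enumeration \<open>e\<close> of the lattice because the
  interchange concerns series. It is licensed by absolute convergence: the integrals of the norms
  add up to \<open>Gamma \<sigma>\<close> times the lattice sum at \<sigma> = Re s. The factor
  \<open>rGamma\<close> takes the place of a division by Gamma because it is entire.\<close>

lemma mellin_theta:
  assumes xy: "\<bar>x\<bar> \<le> 1/2" "\<bar>y\<bar> \<le> 1/2" "(x, y) \<noteq> (0, 0)" and s: "Re s > 1"
  shows "set_integrable lborel {0<..} (\<lambda>u. of_real u powr (s - 1) * of_real (theta u x y) :: complex)"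
    and "((\<lambda>b. of_real (latsq x y b) powr (- s)) has_sum (rGamma s * mellin (\<lambda>u. theta u x y) s)) UNIV"
proof -
  define e where "e = from_nat_into (UNIV :: (int \<times> int) set)"
  have "infinite (UNIV :: (int \<times> int) set)" by (simp add: finite_prod)
  then have e: "bij_betw e UNIV UNIV" unfolding e_def by (intro bij_betw_from_nat_into) auto
  define a where "a i = latsq x y (e i)" for i
  have a: "a i > 0" for i unfolding a_def by (rule latsq_pos[OF xy])
  define \<sigma> where "\<sigma> = Re s"
  define f where "f i u = indicator {0<..} u *\<^sub>R (of_real u powr (s - 1) * of_real (exp (- a i * u)) :: complex)" for i u
  have f_int: "integrable lborel (f i)" for i
    using Gamma_integrable[of s "a i"] a s by (simp add: f_def[abs_def] set_integrable_def)
  have f_val: "(\<integral>u. f i u \<partial>lborel) = Gamma s * of_real (a i) powr (- s)" for i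
    using Gamma_integral[of s "a i"] a s by (simp add: f_def[abs_def] set_lebesgue_integral_def)
  have f_norm: "(\<integral>u. norm (f i u) \<partial>lborel) = Gamma \<sigma> * a i powr (- \<sigma>)" for i
  proof -
    have "complex_of_real (\<integral>u. norm (f i u) \<partial>lborel) = (\<integral>u. of_real (norm (f i u)) \<partial>lborel)"
      by (rule integral_complex_of_real[symmetric])
    also have "\<dots> = (LINT u:{0<..}|lborel. of_real u powr (of_real \<sigma> - 1) * of_real (exp (- a i * u)))"
      unfolding set_lebesgue_integral_def
    proof (rule Bochner_Integration.integral_cong[OF refl])
      fix u :: real
      show "complex_of_real (norm (f i u)) = indicator {0<..} u *\<^sub>R (of_real u powr (of_real \<sigma> - 1) * of_real (exp (- a i * u)))"
      proof (cases "u > 0")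
        case True
        have "of_real u powr (of_real \<sigma> - 1) = complex_of_real (u powr (\<sigma> - 1))"
          using True powr_of_real[of u "\<sigma> - 1"] by simp
        then show ?thesis using True by (simp add: f_def norm_mult cmod_powr_of_real \<sigma>_def)
      qed (simp add: f_def)
    qed
    also have "\<dots> = Gamma (of_real \<sigma>) * of_real (a i) powr (- of_real \<sigma>)"
      using s a by (intro Gamma_integral) (auto simp: \<sigma>_def)
    also have "\<dots> = complex_of_real (Gamma \<sigma> * a i powr (- \<sigma>))"
      using a[of i] powr_of_real[of "a i" "- \<sigma>"] by (simp add: Gamma_complex_of_real)
    finally show ?thesis by (simp only: of_real_eq_iff)
  qed
  have sum_a: "summable (\<lambda>i. a i powr (- \<sigma>))"
  proof -
    have "(\<lambda>i. latsq x y (e i) powr (- \<sigma>)) summable_on UNIV"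
      using lattice_summable[OF xy, of \<sigma>] s by (subst summable_on_reindex_bij_betw[OF e]) (auto simp: \<sigma>_def)
    then show ?thesis unfolding a_def by (rule summable_on_imp_summable)
  qed
  have th: "((\<lambda>i. exp (- u * a i)) sums theta u x y)" if "u > 0" for u
  proof -
    have "((\<lambda>i. exp (- u * latsq x y (e i))) has_sum theta u x y) UNIV"
      using theta_has_sum[OF that, of x y] by (subst has_sum_reindex_bij_betw[OF e])
    then show ?thesis unfolding a_def by (rule has_sum_imp_sums)
  qed
  have f_sums: "(\<lambda>i. f i u) sums (indicator {0<..} u *\<^sub>R (of_real u powr (s - 1) * of_real (theta u x y)))" for u
  proof (cases "u > 0")
    case True
    have "(\<lambda>i. of_real u powr (s - 1) * complex_of_real (exp (- u * a i))) sums (of_real u powr (s - 1) * of_real (theta u x y))"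
      by (intro sums_mult sums_of_real th True)
    then show ?thesis using True by (simp add: f_def mult.commute)
  qed (simp add: f_def)
  have f_abs: "summable (\<lambda>i. norm (f i u))" for u
  proof (cases "u > 0")
    case True
    have "summable (\<lambda>i. u powr (\<sigma> - 1) * exp (- u * a i))"
      using th[OF True] by (intro summable_mult) (simp add: sums_iff)
    then show ?thesis using True by (simp add: f_def norm_mult cmod_powr_of_real \<sigma>_def mult.commute)
  qed (simp add: f_def)
  have int_abs: "summable (\<lambda>i. \<integral>u. norm (f i u) \<partial>lborel)"
    unfolding f_norm by (intro summable_mult sum_a)
  have eq: "(\<lambda>u. \<Sum>i. f i u) = (\<lambda>u. indicator {0<..} u *\<^sub>R (of_real u powr (s - 1) * of_real (theta u x y)))"
    using f_sums by (simp add: sums_iff)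
  have "integrable lborel (\<lambda>u. \<Sum>i. f i u)"
    using f_abs by (intro integrable_suminf f_int int_abs) auto
  then show "set_integrable lborel {0<..} (\<lambda>u. of_real u powr (s - 1) * of_real (theta u x y) :: complex)"
    unfolding eq set_integrable_def .
  have "(\<lambda>i. \<integral>u. f i u \<partial>lborel) sums (\<integral>u. (\<Sum>i. f i u) \<partial>lborel)"
    using f_abs by (intro sums_integral f_int int_abs) auto
  then have "(\<lambda>i. Gamma s * of_real (a i) powr (- s)) sums mellin (\<lambda>u. theta u x y) s"
    unfolding eq f_val mellin_def set_lebesgue_integral_def .
  from sums_mult[OF this, of "rGamma s"]
  have "(\<lambda>i. (rGamma s * Gamma s) * of_real (a i) powr (- s)) sums (rGamma s * mellin (\<lambda>u. theta u x y) s)"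
    by (simp only: mult.assoc)
  moreover have "rGamma s * Gamma s = 1"
  proof -
    have "s \<notin> \<int>\<^sub>\<le>\<^sub>0" using s by (auto elim!: nonpos_Ints_cases)
    then show ?thesis by (simp add: rGamma_inverse_Gamma Gamma_eq_zero_iff)
  qed
  ultimately have "(\<lambda>i. of_real (a i) powr (- s)) sums (rGamma s * mellin (\<lambda>u. theta u x y) s)" by simp
  moreover have "norm (complex_of_real (a i) powr (- s)) = a i powr (- \<sigma>)" for i
    using a[of i] by (simp add: cmod_powr_of_real \<sigma>_def)
  ultimately have "((\<lambda>i. of_real (a i) powr (- s)) has_sum (rGamma s * mellin (\<lambda>u. theta u x y) s)) UNIV"
    using sum_a by (intro norm_summable_imp_has_sum) auto
  then show "((\<lambda>b. of_real (latsq x y b) powr (- s)) has_sum (rGamma s * mellin (\<lambda>u. theta u x y) s)) UNIV"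
    unfolding a_def by (subst (asm) has_sum_reindex_bij_betw[OF e])
qed

text \<open>\<open>E\<close> does not depend on the point \<open>(x, y)\<close>, so it cancels in sums against a nontrivial character.\<close>

theorem epstein_continuation:
  "\<exists>C E. C \<ge> 0 \<and> (\<forall>x y. \<bar>x\<bar> \<le> 1/2 \<longrightarrow> \<bar>y\<bar> \<le> 1/2 \<longrightarrow> (x, y) \<noteq> (0, 0) \<longrightarrow> (\<exists>K. K holomorphic_on UNIV
     \<and> (\<forall>s. Re s > 1 \<longrightarrow> ((\<lambda>b. of_real (latsq x y b) powr (- s)) has_sum (K s + E s)) UNIV)
     \<and> cmod (K (1/2) - of_real (1 / sqrt (x\<^sup>2 + y\<^sup>2))) \<le> C))"
proof -
  \<comment> \<open>\<open>E\<close> is needed only for Re s > 1 and is never continued: in the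
    L-series its coefficient is the sum of a nontrivial character over all residues, which is
    zero.\<close>
  define E where "E s = rGamma s * mellin (\<lambda>u. theta u (1/2) (1/2)) s" for s :: complex
  obtain C where C: "C \<ge> 0" "\<And>x y u. \<bar>x\<bar> \<le> 1/2 \<Longrightarrow> \<bar>y\<bar> \<le> 1/2 \<Longrightarrow> 0 < u \<Longrightarrow> \<bar>thdiff x y u - exp (- (x\<^sup>2 + y\<^sup>2) * u)\<bar> \<le> C * exp (- (1/4) * u)"
    using thdiff_main_term by blast
  have Bi: "set_integrable lborel {0<..} (\<lambda>u. of_real u powr (1/2 - 1) * of_real (exp (- (1/4) * u)) :: complex)"
    by (rule Gamma_integrable) auto
  have Bn: "cmod (of_real u powr (1/2 - 1) * of_real (exp (- (1/4) * u))) = u powr (-1/2) * exp (- (1/4) * u)" if "u > 0" for u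
    using that by (simp add: norm_mult cmod_powr_of_real)
  define J where "J = (LINT u:{0<..}|lborel. cmod (of_real u powr (1/2 - 1) * of_real (exp (- (1/4) * u)) :: complex))"
  have J0: "J \<ge> 0" unfolding J_def set_lebesgue_integral_def by (intro integral_nonneg_AE always_eventually) (auto simp: indicator_def)
  define C' where "C' = cmod (rGamma (1/2)) * (C * J)"
  have "\<exists>K. K holomorphic_on UNIV
     \<and> (\<forall>s. Re s > 1 \<longrightarrow> ((\<lambda>b. of_real (latsq x y b) powr (- s)) has_sum (K s + E s)) UNIV)
     \<and> cmod (K (1/2) - of_real (1 / sqrt (x\<^sup>2 + y\<^sup>2))) \<le> C'"
    if xy: "\<bar>x\<bar> \<le> 1/2" "\<bar>y\<bar> \<le> 1/2" "(x, y) \<noteq> (0, 0)" for x y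
  proof -
    define m where "m = x\<^sup>2 + y\<^sup>2"
    have m: "m > 0" using xy(3) by (auto simp: m_def sum_power2_gt_zero_iff)
    define K where "K s = rGamma s * mellin (thdiff x y) s" for s :: complex
    have ent: "set_integrable lborel {0<..} (\<lambda>u. of_real u powr (s - 1) * of_real (thdiff x y u) :: complex)"
      "mellin (thdiff x y) holomorphic_on UNIV" for s
      using mellin_entire[OF thdiff_continuous m, of x y] thdiff_decay[OF xy(1,2)] unfolding m_def by auto
    have "K holomorphic_on UNIV" unfolding K_def[abs_def] by (intro holomorphic_intros ent)
    moreover have "((\<lambda>b. of_real (latsq x y b) powr (- s)) has_sum (K s + E s)) UNIV" if s: "Re s > 1" for s
    proof -
      have half: "set_integrable lborel {0<..} (\<lambda>u. of_real u powr (s - 1) * of_real (theta u (1/2) (1/2)) :: complex)"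
        by (rule mellin_theta(1)) (use s in auto)
      have "mellin (thdiff x y) s = (LINT u:{0<..}|lborel. of_real u powr (s - 1) * of_real (theta u x y) - of_real u powr (s - 1) * of_real (theta u (1/2) (1/2)))"
        unfolding mellin_def thdiff_def by (simp add: right_diff_distrib)
      also have "\<dots> = mellin (\<lambda>u. theta u x y) s - mellin (\<lambda>u. theta u (1/2) (1/2)) s"
        unfolding mellin_def by (rule set_integral_diff(2)[OF mellin_theta(1)[OF xy s] half])
      finally have "K s + E s = rGamma s * mellin (\<lambda>u. theta u x y) s"
        unfolding K_def E_def by (simp only: right_diff_distrib) simp
      then show ?thesis using mellin_theta(2)[OF xy s] by simp
    qed
    moreover have "cmod (K (1/2) - of_real (1 / sqrt m)) \<le> C'"
    proof -
      \<comment> \<open>At s = 1/2 the subtracted term exp(-mu) has Mellin transform Gamma(1/2) /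
        sqrt(m), the source of the main term; the difference is integrated against the uniform bound
        of \<open>thdiff_main_term\<close>.\<close>
      define g where "g u = (of_real u powr (1/2 - 1) * of_real (thdiff x y u) - of_real u powr (1/2 - 1) * of_real (exp (- m * u)) :: complex)" for u :: real
      have gi: "set_integrable lborel {0<..} (\<lambda>u. of_real u powr (1/2 - 1) * of_real (exp (- m * u)) :: complex)"
        by (rule Gamma_integrable) (use m in auto)
      have g: "set_integrable lborel {0<..} g" unfolding g_def[abs_def] by (intro set_integral_diff(1) ent gi)
      have "(LINT u:{0<..}|lborel. g u) = mellin (thdiff x y) (1/2) - Gamma (1/2) * of_real m powr (- (1/2))"
        unfolding g_def mellin_def using Gamma_integral[of "1/2" m] m
        by (subst set_integral_diff(2)[OF ent(1) gi]) simp_all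
      moreover have "cmod (LINT u:{0<..}|lborel. g u) \<le> C * J"
      proof -
        have "cmod (LINT u:{0<..}|lborel. g u) \<le> (LINT u:{0<..}|lborel. cmod (g u))" by (rule set_integral_norm_bound[OF g])
        also have "\<dots> \<le> (LINT u:{0<..}|lborel. C * cmod (of_real u powr (1/2 - 1) * of_real (exp (- (1/4) * u)) :: complex))"
        proof (rule set_integral_mono)
          show "set_integrable lborel {0<..} (\<lambda>u. cmod (g u))" by (rule set_integrable_norm[OF g])
          show "set_integrable lborel {0<..} (\<lambda>u. C * cmod (of_real u powr (1/2 - 1) * of_real (exp (- (1/4) * u)) :: complex))"
            by (intro set_integrable_mult_right set_integrable_norm Bi)
          fix u :: real assume "u \<in> {0<..}"
          then have u: "u > 0" by simp
          have "g u = of_real u powr (1/2 - 1) * of_real (thdiff x y u - exp (- m * u))" by (simp add: g_def right_diff_distrib)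
          then have "cmod (g u) = u powr (-1/2) * \<bar>thdiff x y u - exp (- m * u)\<bar>"
            using u by (simp add: norm_mult cmod_powr_of_real del: of_real_diff)
          also have "\<dots> \<le> u powr (-1/2) * (C * exp (- (1/4) * u))"
            using C(2)[OF xy(1,2) u] by (intro mult_left_mono) (auto simp: m_def)
          finally show "cmod (g u) \<le> C * cmod (of_real u powr (1/2 - 1) * of_real (exp (- (1/4) * u)) :: complex)"
            unfolding Bn[OF u] by (simp add: mult_ac)
        qed
        also have "\<dots> = C * J" unfolding J_def by (rule set_integral_mult_right)
        finally show ?thesis .
      qed
      moreover have "K (1/2) - of_real (1 / sqrt m) = rGamma (1/2) * (mellin (thdiff x y) (1/2) - Gamma (1/2) * of_real m powr (- (1/2)))"
      proof -
        have "rGamma (1/2) * Gamma (1/2 :: complex) = 1" by (simp add: rGamma_inverse_Gamma Gamma_one_half_complex)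
        moreover have "complex_of_real m powr (- (1/2)) = of_real (1 / sqrt m)"
        proof -
          have "m powr (- (1/2)) = 1 / m powr (1/2)" by (rule powr_minus_divide)
          also have "m powr (1/2) = sqrt m" using m by (intro powr_half_sqrt) simp
          finally have "m powr (- (1/2)) = 1 / sqrt m" .
          moreover have "complex_of_real m powr of_real (- (1/2)) = of_real (m powr (- (1/2)))"
            using m by (intro powr_of_real) simp
          ultimately show ?thesis by simp
        qed
        ultimately have "rGamma (1/2) * (Gamma (1/2) * complex_of_real m powr (- (1/2))) = of_real (1 / sqrt m)"
          by (metis mult.assoc mult_1_left)
        then show ?thesis by (simp only: K_def right_diff_distrib)
      qed
      ultimately have le: "cmod (mellin (thdiff x y) (1/2) - Gamma (1/2) * of_real m powr (- (1/2))) \<le> C * J"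
        and eq: "K (1/2) - of_real (1 / sqrt m) = rGamma (1/2) * (mellin (thdiff x y) (1/2) - Gamma (1/2) * of_real m powr (- (1/2)))"
        by metis+
      show ?thesis unfolding C'_def eq norm_mult by (rule mult_left_mono[OF le norm_ge_zero])
    qed
    ultimately show ?thesis unfolding m_def by (intro exI[of _ K]) auto
  qed
  moreover have "C' \<ge> 0" using C(1) J0 by (simp add: C'_def)
  ultimately show ?thesis by (intro exI[of _ C'] exI[of _ E]) auto
qed

section \<open>Residue systems\<close>

abbreviation gprime :: "gint \<Rightarrow> bool" where "gprime \<equiv> normalization_semidom_class.prime"

text \<open>For nonzero q these are the points of a half-open square centred at the origin with
  sides q and iq, one for each class.\<close>

definition res :: "gint \<Rightarrow> gint set" where "res q = {r. r mod q = r}"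

lemma mod_in_res [simp]: "a mod q \<in> res q"
  by (simp add: res_def)

lemma res_eqI: "r \<in> res q \<Longrightarrow> s \<in> res q \<Longrightarrow> q dvd r - s \<Longrightarrow> r = s"
  by (metis (mono_tags, lifting) res_def mem_Collect_eq mod_eq_dvd_iff)

lemma dvd_mod_minus: "q dvd (a mod q) - (a :: gint)"
  using mod_eq_dvd_iff[of "a mod q" q a] by simp

lemma finite_gnm_le: "finite {z. gnm z \<le> X}"
proof (rule finite_subset)
  show "{z. gnm z \<le> X} \<subseteq> (\<lambda>(a, b). GInt a b) ` ({- \<bar>X\<bar>..\<bar>X\<bar>} \<times> {- \<bar>X\<bar>..\<bar>X\<bar>})"
  proof
    fix z assume "z \<in> {z. gnm z \<le> X}"
    then have X: "(gre z)\<^sup>2 + (gim z)\<^sup>2 \<le> X" by (simp add: gnm_def)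
    have sq: "\<bar>t\<bar> \<le> t\<^sup>2" for t :: int using self_le_power[of "\<bar>t\<bar>" 2] by (cases "t = 0") auto
    have "\<bar>gre z\<bar> \<le> \<bar>X\<bar>" "\<bar>gim z\<bar> \<le> \<bar>X\<bar>" using X sq[of "gre z"] sq[of "gim z"] zero_le_power2[of "gre z"] zero_le_power2[of "gim z"] by linarith+
    then show "z \<in> (\<lambda>(a, b). GInt a b) ` ({- \<bar>X\<bar>..\<bar>X\<bar>} \<times> {- \<bar>X\<bar>..\<bar>X\<bar>})"
      by (intro image_eqI[of _ _ "(gre z, gim z)"]) auto
  qed
qed auto

lemma finite_res: "q \<noteq> 0 \<Longrightarrow> finite (res q)"
proof (rule finite_subset[OF _ finite_gnm_le])
  assume q: "q \<noteq> 0"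
  show "res q \<subseteq> {z. gnm z \<le> gnm q}"
  proof
    fix z assume "z \<in> res q"
    then have "2 * gnm z \<le> gnm q" using gnm_mod_le[OF q, of z] by (simp add: res_def)
    then show "z \<in> {z. gnm z \<le> gnm q}" using gnm_nonneg[of z] by (simp del: gnm_nonneg)
  qed
qed

text \<open>Mixed radix digits: the residue modulo x, then the next digit modulo y. Unlike the
  Chinese remainder theorem this covers factors with common divisors, such as a number and its
  conjugate in \<open>card_res\<close>.\<close>

lemma card_res_mult:
  assumes "x \<noteq> 0" "y \<noteq> 0"
  shows "card (res (x * y)) = card (res x) * card (res y)"
proof -
  define T where "T = (\<lambda>(r, s). (r + x * s) mod (x * y))"
  have "bij_betw T (res x \<times> res y) (res (x * y))"
    unfolding bij_betw_def
  proof
    show "inj_on T (res x \<times> res y)"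
    proof (rule inj_onI, clarify)
      fix r s r' s' assume h: "r \<in> res x" "s \<in> res y" "r' \<in> res x" "s' \<in> res y" "T (r, s) = T (r', s')"
      have d: "x * y dvd (r - r') + x * (s - s')"
        using h(5) by (simp add: T_def mod_eq_dvd_iff algebra_simps)
      then have "x dvd (r - r') + x * (s - s')" by (rule dvd_mult_left)
      then have "x dvd r - r'" by (metis dvd_add_left_iff dvd_triv_left)
      then have r: "r = r'" using h res_eqI by blast
      then have "y dvd s - s'" using d assms by simp
      then show "r = r' \<and> s = s'" using r h res_eqI by blast
    qed
    show "T ` (res x \<times> res y) = res (x * y)"
    proof
      show "T ` (res x \<times> res y) \<subseteq> res (x * y)" by (auto simp: T_def)
      show "res (x * y) \<subseteq> T ` (res x \<times> res y)"
      proof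
        fix a assume a: "a \<in> res (x * y)"
        define s where "s = a div x"
        obtain t where t: "s mod y - s = y * t" using dvd_mod_minus[of y s] by (elim dvdE)
        have "a = a mod x + x * s" by (simp add: s_def)
        then have "(a mod x + x * (s mod y)) - a = x * (s mod y - s)" by (simp add: algebra_simps)
        also have "\<dots> = x * y * t" by (simp add: t mult.assoc)
        finally have "(a mod x + x * (s mod y)) mod (x * y) = a mod (x * y)" by (simp add: mod_eq_dvd_iff)
        also have "\<dots> = a" using a by (simp add: res_def)
        finally have "a = T (a mod x, s mod y)" by (simp add: T_def)
        then show "a \<in> T ` (res x \<times> res y)" by (intro image_eqI[of _ _ "(a mod x, s mod y)"]) auto
      qed
    qed
  qed
  from bij_betw_same_card[OF this] show ?thesis by (simp add: card_cartesian_product)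
qed

lemma of_int_dvd_gint_iff: "of_int n dvd z \<longleftrightarrow> n dvd gre z \<and> n dvd gim z"
proof
  assume "of_int n dvd z"
  then show "n dvd gre z \<and> n dvd gim z" by (elim dvdE) simp
next
  assume "n dvd gre z \<and> n dvd gim z"
  then obtain a b where "gre z = n * a" "gim z = n * b" by (meson dvdE)
  then have "z = of_int n * GInt a b" by (simp add: gint_eq_iff)
  then show "of_int n dvd z" by simp
qed

lemma card_res_of_int:
  assumes n: "n > 0"
  shows "card (res (of_int n)) = (nat n)\<^sup>2"
proof -
  define f where "f = (\<lambda>z. (gre z mod n, gim z mod n))"
  have "bij_betw f (res (of_int n)) ({0..<n} \<times> {0..<n})"
    unfolding bij_betw_def
  proof
    show "inj_on f (res (of_int n))"
    proof (rule inj_onI)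
      fix z w assume h: "z \<in> res (of_int n)" "w \<in> res (of_int n)" "f z = f w"
      then have "of_int n dvd z - w" by (simp add: f_def of_int_dvd_gint_iff mod_eq_dvd_iff)
      then show "z = w" using h res_eqI by blast
    qed
    show "f ` res (of_int n) = {0..<n} \<times> {0..<n}"
    proof
      show "f ` res (of_int n) \<subseteq> {0..<n} \<times> {0..<n}" using n by (auto simp: f_def)
      show "{0..<n} \<times> {0..<n} \<subseteq> f ` res (of_int n)"
      proof clarify
        fix a b assume ab: "a \<in> {0..<n}" "b \<in> {0..<n}"
        define z where "z = GInt a b mod of_int n"
        have "of_int n dvd z - GInt a b" unfolding z_def by (rule dvd_mod_minus)
        then have "gre z mod n = a mod n" "gim z mod n = b mod n" by (simp_all add: of_int_dvd_gint_iff mod_eq_dvd_iff)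
        then have "f z = (a, b)" using ab by (simp add: f_def)
        then show "(a, b) \<in> f ` res (of_int n)" by (intro image_eqI[of _ _ z]) (auto simp: z_def)
      qed
    qed
  qed
  from bij_betw_same_card[OF this] show ?thesis by (simp add: card_cartesian_product power2_eq_square)
qed

lemma gcnj_dvd: "a dvd b \<Longrightarrow> gcnj a dvd gcnj b"
  by (elim dvdE) simp

lemma gcnj_eq_0_iff [simp]: "gcnj z = 0 \<longleftrightarrow> z = 0"
  by (metis gnm_eq_0_iff gnm_gcnj)

lemma card_res_gcnj_le: "q \<noteq> 0 \<Longrightarrow> card (res q) \<le> card (res (gcnj q))"
proof (rule card_inj_on_le)
  assume q: "q \<noteq> 0"
  show "inj_on (\<lambda>z. gcnj z mod gcnj q) (res q)"
  proof (rule inj_onI)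
    fix z w assume h: "z \<in> res q" "w \<in> res q" "gcnj z mod gcnj q = gcnj w mod gcnj q"
    then have "gcnj q dvd gcnj (z - w)" by (simp add: mod_eq_dvd_iff)
    then have "q dvd z - w" using gcnj_dvd by fastforce
    then show "z = w" using h res_eqI by blast
  qed
  show "finite (res (gcnj q))" using q by (intro finite_res) simp
qed auto

text \<open>Conjugation preserves the number of residues, so its square is the number of residues
  modulo the rational integer N(q), that is N(q)^2.\<close>

lemma card_res: "q \<noteq> 0 \<Longrightarrow> card (res q) = nat (gnm q)"
proof -
  assume q: "q \<noteq> 0"
  have "card (res q) = card (res (gcnj q))"
    using card_res_gcnj_le[OF q] card_res_gcnj_le[of "gcnj q"] q by simp
  then have "(card (res q))\<^sup>2 = card (res (q * gcnj q))"
    using card_res_mult[of q "gcnj q"] q by (simp add: power2_eq_square)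
  also have "\<dots> = (nat (gnm q))\<^sup>2" unfolding mult_gcnj using q by (intro card_res_of_int) simp
  finally show ?thesis by (simp add: power2_eq_iff_nonneg)
qed

lemma mod_box:
  assumes b: "b \<noteq> 0" and r: "r \<in> res b"
  shows "\<bar>Re (cof r / cof b)\<bar> \<le> 1/2" "\<bar>Im (cof r / cof b)\<bar> \<le> 1/2"
proof -
  define n where "n = gnm b"
  define w where "w = r * gcnj b"
  have n: "n > 0" using b by (simp add: n_def)
  have "w = (r - (r div b) * b) * gcnj b" using r by (simp add: w_def res_def modulo_gint_def)
  also have "\<dots> = r * gcnj b - (r div b) * of_int n"
    by (simp only: n_def mult_gcnj[symmetric] algebra_simps)
  finally have "gre w = gre (r * gcnj b) - rdiv (gre (r * gcnj b)) n * n"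
    "gim w = gim (r * gcnj b) - rdiv (gim (r * gcnj b)) n * n"
    by (simp_all add: divide_gint_def n_def)
  then have "2 * \<bar>gre w\<bar> \<le> n" "2 * \<bar>gim w\<bar> \<le> n" using rdiv_bound[OF n] by metis+
  then have ww: "2 * \<bar>real_of_int (gre w)\<bar> \<le> of_int n" "2 * \<bar>real_of_int (gim w)\<bar> \<le> of_int n" by linarith+
  have "cof r / cof b = cof w / of_int n"
  proof -
    have *: "of_int n = cof b * cof (gcnj b)" unfolding cof_simps(6)[symmetric] mult_gcnj n_def[symmetric]
      by (simp add: complex_eq_iff)
    have "cof (gcnj b) \<noteq> 0" using b by simp
    then show ?thesis unfolding * w_def cof_simps by simp
  qed
  then have "cof r / cof b = cof w / of_real (of_int n)" by simp
  then have "Re (cof r / cof b) = of_int (gre w) / of_int n" "Im (cof r / cof b) = of_int (gim w) / of_int n"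
    by (simp_all only: Re_divide_of_real Im_divide_of_real Re_cof Im_cof)
  moreover have "real_of_int n > 0" using n by simp
  ultimately show "\<bar>Re (cof r / cof b)\<bar> \<le> 1/2" "\<bar>Im (cof r / cof b)\<bar> \<le> 1/2"
    using ww by (simp_all only: abs_divide) (simp_all add: field_simps)
qed

lemma gprime_dvd_mult_iff: "gprime p \<Longrightarrow> p dvd a * b \<longleftrightarrow> p dvd a \<or> p dvd b"
  by (rule prime_dvd_mult_iff)

text \<open>Induction over the primes for all moduli at once: the residues modulo q divisible by p
  are p times the residues modulo q/p, and the primes still to be treated divide q/p because they
  differ from p.\<close>

lemma card_res_avoiding:
  assumes "finite T" "q \<noteq> 0" "T \<subseteq> prime_factors q"
  shows "real (card {a\<in>res q. \<forall>p\<in>T. \<not> p dvd a}) = of_int (gnm q) * (\<Prod>p\<in>T. 1 - 1 / of_int (gnm p))"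
  using assms
proof (induction T arbitrary: q)
  case empty
  then show ?case by (simp add: card_res)
next
  case (insert p T)
  have p: "gprime p" "p dvd q" using insert.prems by auto
  then obtain q' where q': "q = p * q'" by (elim dvdE)
  have nz: "p \<noteq> 0" "q' \<noteq> 0" using insert.prems q' by auto
  have Tq': "T \<subseteq> prime_factors q'"
  proof
    fix r assume r: "r \<in> T"
    then have "r \<in> prime_factors q" using insert.prems by auto
    then have r': "gprime r" "r dvd p * q'" by (auto simp: q')
    have "\<not> r dvd p"
    proof
      assume "r dvd p"
      then have "r = p" using p r' primes_dvd_imp_eq by blast
      then show False using r insert.hyps by simp
    qed
    then show "r \<in> prime_factors q'" using r' nz gprime_dvd_mult_iff[OF r'(1)] by (simp add: in_prime_factors_iff)
  qed
  define A where "A = {a\<in>res q. \<forall>r\<in>T. \<not> r dvd a}"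
  define B where "B = {b\<in>res q'. \<forall>r\<in>T. \<not> r dvd b}"
  have fin: "finite A" using finite_res[OF insert.prems(1)] by (simp add: A_def)
  have "{a\<in>res q. \<forall>r\<in>insert p T. \<not> r dvd a} = A - {a\<in>A. p dvd a}" by (auto simp: A_def)
  moreover have "card (A - {a\<in>A. p dvd a}) = card A - card {a\<in>A. p dvd a}" using fin by (intro card_Diff_subset) auto
  moreover have "card {a\<in>A. p dvd a} \<le> card A" using fin by (intro card_mono) auto
  moreover have "card {a\<in>A. p dvd a} = card B"
  proof -
    have "{a\<in>A. p dvd a} = (\<lambda>b. p * b) ` B"
    proof (intro equalityI subsetI)
      fix a assume "a \<in> {a\<in>A. p dvd a}"
      then obtain b where b: "a = p * b" "a \<in> res q" "\<forall>r\<in>T. \<not> r dvd a" by (auto simp: A_def elim!: dvdE)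
      have "(p * b) mod (p * q') = p * b" using b(2) unfolding res_def b(1) q' by blast
      then have "b \<in> res q'" using nz by (simp add: res_def)
      moreover have "\<forall>r\<in>T. \<not> r dvd b" using b(1,3) by auto
      ultimately show "a \<in> (\<lambda>b. p * b) ` B" using b by (auto simp: B_def)
    next
      fix a assume "a \<in> (\<lambda>b. p * b) ` B"
      then obtain b where b: "a = p * b" "b \<in> res q'" "\<forall>r\<in>T. \<not> r dvd b" by (auto simp: B_def)
      have "b mod q' = b" using b(2) by (simp add: res_def)
      then have "a \<in> res q" unfolding res_def b(1) q' by simp
      moreover have "\<not> r dvd a" if r: "r \<in> T" for r
      proof
        assume "r dvd a"
        moreover have r': "gprime r" using r Tq' by auto
        ultimately have "r dvd p" using b r gprime_dvd_mult_iff[OF r'] by auto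
        then have "r = p" using p r' primes_dvd_imp_eq by blast
        then show False using r insert.hyps by simp
      qed
      ultimately show "a \<in> {a\<in>A. p dvd a}" using b by (auto simp: A_def)
    qed
    then show ?thesis using nz by (simp add: card_image inj_on_def)
  qed
  ultimately have "real (card {a\<in>res q. \<forall>r\<in>insert p T. \<not> r dvd a}) = real (card A) - real (card B)"
    by (simp add: of_nat_diff)
  also have "real (card A) = of_int (gnm q) * (\<Prod>p\<in>T. 1 - 1 / of_int (gnm p))"
    unfolding A_def using insert.prems by (intro insert.IH) auto
  also have "real (card B) = of_int (gnm q') * (\<Prod>p\<in>T. 1 - 1 / of_int (gnm p))"
    unfolding B_def using nz Tq' by (intro insert.IH) auto
  also have "of_int (gnm q) * (\<Prod>p\<in>T. 1 - 1 / of_int (gnm p)) - of_int (gnm q') * (\<Prod>p\<in>T. 1 - 1 / of_int (gnm p))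
      = of_int (gnm q) * (\<Prod>p\<in>insert p T. 1 - 1 / real_of_int (gnm p))"
  proof -
    have "real_of_int (gnm q') = of_int (gnm q) * (1 / of_int (gnm p))" using nz by (simp add: q' gnm_mult)
    then show ?thesis using insert.hyps by (simp add: algebra_simps)
  qed
  finally show ?case .
qed

lemma coprime_iff_prime_factors: "q \<noteq> 0 \<Longrightarrow> coprime a q \<longleftrightarrow> (\<forall>p\<in>prime_factors q. \<not> p dvd (a :: gint))"
proof
  assume "coprime a q"
  then show "\<forall>p\<in>prime_factors q. \<not> p dvd a"
    by (metis in_prime_factors_iff coprime_common_divisor not_prime_unit)
next
  assume q: "q \<noteq> 0" and h: "\<forall>p\<in>prime_factors q. \<not> p dvd a"
  show "coprime a q"
  proof (rule ccontr)
    assume "\<not> coprime a q"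
    then have "\<not> is_unit (gcd a q)" by (simp add: coprime_iff_gcd_eq_1 is_unit_gcd_iff)
    moreover have "gcd a q \<noteq> 0" using q by simp
    ultimately obtain p where "gprime p" "p dvd gcd a q" using prime_divisor_exists by blast
    then show False using h q by (auto simp: in_prime_factors_iff)
  qed
qed

lemma card_res_coprime:
  assumes "q \<noteq> 0"
  shows "real (card {a\<in>res q. coprime a q}) = of_int (gnm q) * (\<Prod>p\<in>prime_factors q. 1 - 1 / of_int (gnm p))"
proof -
  have "{a\<in>res q. coprime a q} = {a\<in>res q. \<forall>p\<in>prime_factors q. \<not> p dvd a}"
    using coprime_iff_prime_factors[OF assms] by blast
  then show ?thesis using card_res_avoiding[OF _ assms order_refl] by simp
qed

section \<open>Lattice sums and Euler products\<close>

text \<open>Level sets of the max norm are boundaries of squares and have an elementary count;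
  \<open>gmax_sq_le\<close> carries the estimates over to the Euclidean norm.\<close>

definition gmax :: "gint \<Rightarrow> nat" where "gmax z = nat (max \<bar>gre z\<bar> \<bar>gim z\<bar>)"

lemma gmax_sq_le: "int (gmax z) ^ 2 \<le> gnm z"
  by (auto simp: gmax_def gnm_def max_def)

lemma gmax_pos: "z \<noteq> 0 \<Longrightarrow> gmax z \<ge> 1"
  by (auto simp: gmax_def gint_eq_iff max_def)

text \<open>Four sides of 2k + 1 points each, the corners counted twice, and 8k + 4 \<le> 12k for k
  \<ge> 1.\<close>

lemma card_shell:
  assumes "k \<ge> 1"
  shows "finite {z. gmax z = k}" "card {z. gmax z = k} \<le> 12 * k"
proof -
  define I where "I = {- int k..int k}"
  define A where "A = (\<lambda>(s, t). GInt s t) ` ({int k, - int k} \<times> I) \<union> (\<lambda>(s, t). GInt t s) ` ({int k, - int k} \<times> I)"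
  have sub: "{z. gmax z = k} \<subseteq> A"
  proof
    fix z assume "z \<in> {z. gmax z = k}"
    then have "max \<bar>gre z\<bar> \<bar>gim z\<bar> = int k" by (simp add: gmax_def)
    then consider "\<bar>gre z\<bar> = int k" "\<bar>gim z\<bar> \<le> int k" | "\<bar>gim z\<bar> = int k" "\<bar>gre z\<bar> \<le> int k" by (auto simp: max_def split: if_splits)
    then show "z \<in> A"
    proof cases
      case 1
      then have "z = (\<lambda>(s, t). GInt s t) (gre z, gim z)" "(gre z, gim z) \<in> {int k, - int k} \<times> I" by (auto simp: I_def)
      then show ?thesis unfolding A_def by blast
    next
      case 2
      then have "z = (\<lambda>(s, t). GInt t s) (gim z, gre z)" "(gim z, gre z) \<in> {int k, - int k} \<times> I" by (auto simp: I_def)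
      then show ?thesis unfolding A_def by blast
    qed
  qed
  have "card I = 2 * k + 1" by (simp add: I_def)
  then have "card ({int k, - int k} \<times> I) \<le> 2 * (2 * k + 1)" unfolding card_cartesian_product using card_insert_le_m1[of 2 "{- int k}" "int k"] by (intro mult_le_mono) auto
  moreover have finI: "finite ({int k, - int k} \<times> I)" by (simp add: I_def)
  ultimately have "card A \<le> 2 * (2 * k + 1) + 2 * (2 * k + 1)"
    unfolding A_def by (intro order_trans[OF card_Un_le] add_mono order_trans[OF card_image_le])
  moreover have "finite A" unfolding A_def using finI by blast
  ultimately have A: "card A \<le> 2 * (2 * k + 1) + 2 * (2 * k + 1)" "finite A" by blast+
  show "finite {z. gmax z = k}" using sub A(2) finite_subset by blast
  show "card {z. gmax z = k} \<le> 12 * k" 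
  proof -
    have "card {z. gmax z = k} \<le> card A" by (rule card_mono[OF A(2) sub])
    also have "\<dots> \<le> 2 * (2 * k + 1) + 2 * (2 * k + 1)" by (rule A(1))
    also have "\<dots> \<le> 12 * k" using assms by simp
    finally show ?thesis .
  qed
qed

lemma sum_shells:
  fixes f :: "gint \<Rightarrow> real"
  assumes F: "finite F" "\<And>z. z \<in> F \<Longrightarrow> z \<noteq> 0 \<and> gmax z \<le> Y"
    and f: "\<And>z. z \<in> F \<Longrightarrow> f z \<le> g (gmax z)" and g: "\<And>k. g k \<ge> 0"
  shows "sum f F \<le> (\<Sum>k=1..Y. 12 * real k * g k)"
proof -
  have "sum f F \<le> (\<Sum>z\<in>F. g (gmax z))" by (intro sum_mono f)
  also have "\<dots> = (\<Sum>k=1..Y. \<Sum>z\<in>{z\<in>F. gmax z = k}. g (gmax z))"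
    using F gmax_pos by (intro sum.group[symmetric]) auto
  also have "\<dots> \<le> (\<Sum>k=1..Y. 12 * real k * g k)"
  proof (rule sum_mono)
    fix k assume k: "k \<in> {1..Y}"
    have "card {z\<in>F. gmax z = k} \<le> card {z. gmax z = k}" using card_shell[of k] k by (intro card_mono) auto
    also have "\<dots> \<le> 12 * k" using card_shell[of k] k by simp
    finally have "real (card {z\<in>F. gmax z = k}) \<le> 12 * real k" by linarith
    then have "real (card {z\<in>F. gmax z = k}) * g k \<le> 12 * real k * g k" using g by (intro mult_right_mono) auto
    then show "(\<Sum>z\<in>{z\<in>F. gmax z = k}. g (gmax z)) \<le> 12 * real k * g k" by simp
  qed
  finally show ?thesis .
qed

lemma gmax_le_of_gnm: "of_int (gnm z) \<le> X\<^sup>2 \<Longrightarrow> X \<ge> 0 \<Longrightarrow> gmax z \<le> nat \<lfloor>X\<rfloor>" for X :: real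
proof -
  assume X: "of_int (gnm z) \<le> X\<^sup>2" "X \<ge> 0"
  have "(real (gmax z))\<^sup>2 \<le> of_int (gnm z)" using gmax_sq_le[of z] by (metis of_int_le_iff of_int_of_nat_eq of_int_power)
  then have "(real (gmax z))\<^sup>2 \<le> X\<^sup>2" using X by linarith
  then have "real (gmax z) \<le> X" using X(2) by (rule power2_le_imp_le)
  then show ?thesis by (simp add: le_nat_floor)
qed

lemma gnm_ge_gmax_real: "(real (gmax z))\<^sup>2 \<le> real_of_int (gnm z)"
  using gmax_sq_le[of z] by (metis of_int_le_iff of_int_of_nat_eq of_int_power)

lemma harm_le: "n \<ge> 1 \<Longrightarrow> (\<Sum>k=1..n. 1 / real k) \<le> 1 + ln (real n)"
proof (induction n rule: dec_induct)
  case (step n)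
  have "1 / real (Suc n) \<le> ln (real (Suc n)) - ln (real n)"
  proof -
    have "ln (real n / real (Suc n)) \<le> real n / real (Suc n) - 1" using step by (intro ln_le_minus_one) auto
    moreover have "real n / real (Suc n) - 1 = - (1 / real (Suc n))" by (simp add: field_simps)
    moreover have "ln (real n / real (Suc n)) = ln (real n) - ln (real (Suc n))" using step by (simp add: ln_div)
    ultimately show ?thesis by linarith
  qed
  then show ?case using step.IH by simp
qed auto

text \<open>A shell of radius k has O(k) points of norm at least k^2, so the sum is at most a
  harmonic one. This is the source of the logarithm in the second moment.\<close>

lemma sum_inverse_gnm:
  assumes F: "finite F" "0 \<notin> F" "\<And>z. z \<in> F \<Longrightarrow> of_int (gnm z) \<le> X" and X: "X \<ge> 1"
  shows "(\<Sum>z\<in>F. 1 / real_of_int (gnm z)) \<le> 12 * (1 + ln X)"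
proof -
  define Y where "Y = nat \<lfloor>sqrt X\<rfloor>"
  have Y: "Y \<ge> 1" using X by (simp add: Y_def le_nat_iff le_floor_iff)
  have "(\<Sum>z\<in>F. 1 / real_of_int (gnm z)) \<le> (\<Sum>k=1..Y. 12 * real k * (1 / (real k)\<^sup>2))"
  proof (rule sum_shells[OF F(1)])
    fix z assume z: "z \<in> F"
    show "z \<noteq> 0 \<and> gmax z \<le> Y" using z F X gmax_le_of_gnm[of z "sqrt X"] by (auto simp: Y_def)
    then have "gmax z \<ge> 1" using gmax_pos by blast
    then have "0 < (real (gmax z))\<^sup>2" by simp
    then show "1 / real_of_int (gnm z) \<le> 1 / (real (gmax z))\<^sup>2"
      using gnm_ge_gmax_real[of z] by (intro divide_left_mono mult_pos_pos) linarith+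
  qed auto
  also have "\<dots> = 12 * (\<Sum>k=1..Y. 1 / real k)" unfolding sum_distrib_left by (intro sum.cong refl) (auto simp: power2_eq_square)
  also have "\<dots> \<le> 12 * (1 + ln (real Y))" using harm_le[OF Y] by simp
  also have "ln (real Y) \<le> ln X"
  proof -
    have "real Y \<le> sqrt X" using X by (simp add: Y_def)
    also have "\<dots> \<le> X" using X sqrt_le_D[of X X] by (simp add: real_le_lsqrt power2_eq_square)
    finally show ?thesis using Y by simp
  qed
  finally show ?thesis by simp
qed

lemma sum_inverse_abs:
  assumes F: "finite F" "0 \<notin> F" "\<And>z. z \<in> F \<Longrightarrow> cmod (cof z) \<le> X" and X: "X \<ge> 0"
  shows "(\<Sum>z\<in>F. 1 / cmod (cof z)) \<le> 12 * X"
proof -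
  define Y where "Y = nat \<lfloor>X\<rfloor>"
  have "(\<Sum>z\<in>F. 1 / cmod (cof z)) \<le> (\<Sum>k=1..Y. 12 * real k * (1 / real k))"
  proof (rule sum_shells[OF F(1)])
    fix z assume z: "z \<in> F"
    have "(cmod (cof z))\<^sup>2 \<le> X\<^sup>2" using F(3)[OF z] by (intro power_mono) auto
    then show "z \<noteq> 0 \<and> gmax z \<le> Y" using z F X gmax_le_of_gnm[of z X] by (auto simp: Y_def cmod_cof_power2)
    then have "gmax z \<ge> 1" using gmax_pos by blast
    moreover have "real (gmax z) \<le> cmod (cof z)" 
      by (rule power2_le_imp_le) (simp_all add: cmod_cof_power2 gnm_ge_gmax_real)
    ultimately show "1 / cmod (cof z) \<le> 1 / real (gmax z)" by (intro divide_left_mono mult_pos_pos) linarith+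
  qed auto
  also have "\<dots> = 12 * real Y" by simp
  also have "\<dots> \<le> 12 * X" using X by (simp add: Y_def)
  finally show ?thesis .
qed

lemma sum_inverse_gnm_sq:
  assumes F: "finite F" "0 \<notin> F"
  shows "(\<Sum>z\<in>F. 1 / (real_of_int (gnm z))\<^sup>2) \<le> 24"
proof -
  define Y where "Y = Suc (Max (insert 0 (gmax ` F)))"
  have "(\<Sum>z\<in>F. 1 / (real_of_int (gnm z))\<^sup>2) \<le> (\<Sum>k=1..Y. 12 * real k * (1 / ((real k)\<^sup>2)\<^sup>2))"
  proof (rule sum_shells[OF F(1)])
    fix z assume z: "z \<in> F"
    have "gmax z \<le> Max (insert 0 (gmax ` F))" using z F by (intro Max_ge) auto
    then have "gmax z \<le> Y" unfolding Y_def by (rule le_SucI)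
    then show "z \<noteq> 0 \<and> gmax z \<le> Y" using z F by metis
    then have "gmax z \<ge> 1" using gmax_pos by blast
    then have *: "0 < (real (gmax z))\<^sup>2" by simp
    then have **: "0 < real_of_int (gnm z)" using gnm_ge_gmax_real[of z] by linarith
    have "0 < (real_of_int (gnm z))\<^sup>2 * ((real (gmax z))\<^sup>2)\<^sup>2"
      by (rule mult_pos_pos[OF zero_less_power[OF **] zero_less_power[OF *]])
    moreover have "((real (gmax z))\<^sup>2)\<^sup>2 \<le> (real_of_int (gnm z))\<^sup>2" by (rule power_mono[OF gnm_ge_gmax_real]) simp
    ultimately show "1 / (real_of_int (gnm z))\<^sup>2 \<le> 1 / ((real (gmax z))\<^sup>2)\<^sup>2"
      by (intro divide_left_mono) auto
  qed auto
  \<comment> \<open>Weakening 1/k^3 to 2/(k(k + 1)) makes the series telescope and gives the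
    explicit bound 24.\<close>
  also have "\<dots> \<le> (\<Sum>k=1..Y. 12 * (2 / (real k * (real k + 1))))"
  proof (rule sum_mono)
    fix k assume "k \<in> {1..Y}"
    then have k: "real k \<ge> 1" by simp
    have "real k * (real k + 1) \<le> 2 * (real k)\<^sup>2" using k by (simp add: power2_eq_square algebra_simps)
    also have "\<dots> \<le> 2 * real k ^ 3" using k by (simp add: power_increasing)
    finally have "2 / (2 * real k ^ 3) \<le> 2 / (real k * (real k + 1))" using k by (intro divide_left_mono) auto
    moreover have "12 * real k * (1 / ((real k)\<^sup>2)\<^sup>2) = 12 * (2 / (2 * real k ^ 3))" using k by (simp add: field_simps eval_nat_numeral)
    ultimately show "12 * real k * (1 / ((real k)\<^sup>2)\<^sup>2) \<le> 12 * (2 / (real k * (real k + 1)))" by simp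
  qed
  also have "\<dots> = 24 * (1 - 1 / (real Y + 1))"
  proof (induction Y)
    case (Suc Y)
    have "12 * (2 / (real (Suc Y) * (real (Suc Y) + 1))) = 24 * (1 / (real Y + 1) - 1 / (real (Suc Y) + 1))" by (simp add: field_simps)
    then show ?case using Suc by simp
  qed simp
  also have "\<dots> \<le> 24" by simp
  finally show ?thesis .
qed

section \<open>Products of distinct primes and Euler products\<close>

lemma gnm_prod: "gnm (\<Prod>p\<in>S. f p) = (\<Prod>p\<in>S. gnm (f p))"
  by (induction S rule: infinite_finite_induct) (auto simp: gnm_mult)

lemma prime_dvd_prod_primes:
  fixes S :: "gint set"
  assumes "finite S" "\<And>p. p \<in> S \<Longrightarrow> gprime p" "gprime r"
  shows "r dvd \<Prod>S \<longleftrightarrow> r \<in> S"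
proof
  assume "r dvd \<Prod>S"
  then obtain p where "p \<in> S" "r dvd p" using assms by (auto simp: prime_dvd_prod_iff)
  then show "r \<in> S" using assms primes_dvd_imp_eq by metis
qed (use assms in \<open>auto intro: dvd_prodI\<close>)

lemma prod_primes_dvd:
  fixes S :: "gint set"
  assumes "q \<noteq> 0" "S \<subseteq> prime_factors q"
  shows "\<Prod>S dvd q"
proof -
  have "finite S" using assms(2) finite_subset by blast
  then show ?thesis using assms
  proof (induction S arbitrary: q)
    case (insert p S)
    have p: "gprime p" "p dvd q" using insert.prems by auto
    then obtain q' where q': "q = p * q'" by (elim dvdE)
    have "S \<subseteq> prime_factors q'"
    proof
      fix r assume r: "r \<in> S"
      then have r': "gprime r" "r dvd p * q'" using insert.prems by (auto simp: q')
      have "\<not> r dvd p" using p r' primes_dvd_imp_eq r insert.hyps by metis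
      then show "r \<in> prime_factors q'" using r' q' insert.prems gprime_dvd_mult_iff[OF r'(1)] by (auto simp: in_prime_factors_iff)
    qed
    then have "\<Prod>S dvd q'" using q' insert.prems by (intro insert.IH) auto
    then show ?case using insert.hyps q' by (simp add: mult_dvd_mono)
  qed simp
qed

lemma gnm_dvd_le: "a dvd b \<Longrightarrow> b \<noteq> 0 \<Longrightarrow> gnm a \<le> gnm b"
proof -
  assume "a dvd b" "b \<noteq> 0"
  then obtain c where c: "b = a * c" "c \<noteq> 0" by (auto elim!: dvdE)
  then have "1 \<le> gnm c" by (simp add: int_one_le_iff_zero_less)
  then have "gnm a * 1 \<le> gnm a * gnm c" by (intro mult_left_mono) auto
  then show ?thesis by (simp add: c gnm_mult)
qed

text \<open>An upper bound sieve for free: multiplying out, the products \<open>r \<Prod>S\<close> are distinct.\<close>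

lemma sum_coprime_sieve:
  assumes q: "q \<noteq> 0" and R: "finite R" "0 \<notin> R" "\<And>r. r \<in> R \<Longrightarrow> coprime r q \<and> of_int (gnm r) \<le> X" and X: "X \<ge> 1"
  shows "(\<Sum>r\<in>R. 1 / real_of_int (gnm r)) * (\<Prod>p\<in>prime_factors q. 1 + 1 / of_int (gnm p)) \<le> 12 * (1 + ln (X * of_int (gnm q)))"
proof -
  define P where "P = prime_factors q"
  have P: "finite P" "\<And>p. p \<in> P \<Longrightarrow> gprime p" by (auto simp: P_def)
  define T where "T = (\<lambda>(r, S). r * \<Prod>S :: gint)"
  have nz: "\<Prod>S \<noteq> 0" if "S \<subseteq> P" for S
  proof -
    have "0 \<notin> S" using that P(2) not_prime_0 by blast
    then show ?thesis using finite_subset[OF that P(1)] by (simp add: prod_zero_iff)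
  qed
  have inj: "inj_on T (R \<times> Pow P)"
  proof (rule inj_onI, clarify)
    fix r S r' S' assume h: "r \<in> R" "S \<subseteq> P" "r' \<in> R" "S' \<subseteq> P" "T (r, S) = T (r', S')"
    \<comment> \<open>No prime of P divides r, so the set S can be read off from the product, and
      then r by cancellation.\<close>
    have key: "S = {p\<in>P. p dvd T (r, S)}" if "r \<in> R" "S \<subseteq> P" for r S
    proof -
      have "p dvd r * \<Prod>S \<longleftrightarrow> p \<in> S" if p: "p \<in> P" for p
      proof -
        have "\<not> p dvd r" using coprime_iff_prime_factors[OF q, of r] R(3)[OF \<open>r \<in> R\<close>] p P_def by blast
        moreover have "p dvd \<Prod>S \<longleftrightarrow> p \<in> S" using P p \<open>S \<subseteq> P\<close> finite_subset by (intro prime_dvd_prod_primes) auto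
        ultimately show ?thesis using P(2)[OF p] gprime_dvd_mult_iff by blast
      qed
      then show ?thesis using \<open>S \<subseteq> P\<close> by (auto simp: T_def)
    qed
    have "S = S'" using key[of r S] key[of r' S'] h by simp
    moreover have "r = r'" using h(5) nz[OF h(4)] calculation by (simp add: T_def)
    ultimately show "r = r' \<and> S = S'" by blast
  qed
  have "(\<Prod>p\<in>P. 1 + 1 / real_of_int (gnm p)) = (\<Sum>S\<in>Pow P. \<Prod>p\<in>S. 1 / real_of_int (gnm p))"
    using prod_add[OF P(1), of "\<lambda>p. 1 / real_of_int (gnm p)" "\<lambda>_. 1"] by (simp add: add.commute)
  also have "\<dots> = (\<Sum>S\<in>Pow P. 1 / real_of_int (gnm (\<Prod>S)))"
    by (intro sum.cong refl) (simp add: gnm_prod[of id, simplified] prod_dividef)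
  finally have "(\<Sum>r\<in>R. 1 / real_of_int (gnm r)) * (\<Prod>p\<in>P. 1 + 1 / of_int (gnm p))
      = (\<Sum>x\<in>R \<times> Pow P. 1 / real_of_int (gnm (T x)))"
    by (simp add: sum_product sum.cartesian_product T_def gnm_mult case_prod_unfold)
  also have "\<dots> = (\<Sum>z\<in>T ` (R \<times> Pow P). 1 / real_of_int (gnm z))"
    by (simp add: sum.reindex[OF inj])
  also have "\<dots> \<le> 12 * (1 + ln (X * of_int (gnm q)))"
  proof (rule sum_inverse_gnm)
    show "finite (T ` (R \<times> Pow P))" using R P by simp
    show "0 \<notin> T ` (R \<times> Pow P)" using R nz by (auto simp: T_def)
    have q1: "1 \<le> gnm q" using q by (simp add: int_one_le_iff_zero_less)
    show "X * real_of_int (gnm q) \<ge> 1" using X q1 by (metis mult_mono' mult_1 of_int_1_le_iff zero_le_one)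
    fix z assume "z \<in> T ` (R \<times> Pow P)"
    then obtain r S where z: "z = r * \<Prod>S" "r \<in> R" "S \<subseteq> P" by (auto simp: T_def)
    have "gnm (\<Prod>S) \<le> gnm q" using prod_primes_dvd[OF q] z(3) q unfolding P_def by (intro gnm_dvd_le) auto
    then show "real_of_int (gnm z) \<le> X * real_of_int (gnm q)"
      unfolding z(1) gnm_mult of_int_mult using R(3)[OF z(2)] X by (intro mult_mono) auto
  qed
  finally show ?thesis unfolding P_def .
qed

text \<open>The two Euler products that compare the number of primitive characters with the size of the
  second moment and of the error in the first moment.\<close>

lemma euler_product_lower:
  assumes P: "finite P" "0 \<notin> P" "\<And>p. p \<in> P \<Longrightarrow> gnm p \<ge> 3"
  shows "(\<Prod>p\<in>P. 1 - 2 / (of_int (gnm p) * (of_int (gnm p) - 1))) \<ge> exp (- 144 :: real)"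
proof -
  define x where "x p = 2 / (of_int (gnm p) * (of_int (gnm p) - 1) :: real)" for p
  have x: "0 \<le> x p" "x p \<le> 1/2" "x p \<le> 3 / (real_of_int (gnm p))\<^sup>2" if "p \<in> P" for p
  proof -
    define n where "n = real_of_int (gnm p)"
    have n: "n \<ge> 3" using P(3)[OF that] by (simp add: n_def)
    have "3 * 2 \<le> n * (n - 1)" using n by (intro mult_mono) auto
    then have "2 / (n * (n - 1)) \<le> 2 / 6" by (intro divide_left_mono) auto
    moreover have "2 / (n * (n - 1)) \<le> 3 / n\<^sup>2"
    proof -
      have "2 * n\<^sup>2 \<le> 3 * (n * (n - 1))" using mult_left_mono[of 3 n n] n by (simp add: power2_eq_square algebra_simps)
      then show ?thesis using n by (simp add: divide_simps mult_ac)
    qed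
    moreover have "2 / (n * (n - 1)) \<ge> 0" using n by simp
    ultimately show "0 \<le> x p" "x p \<le> 1/2" "x p \<le> 3 / (real_of_int (gnm p))\<^sup>2" by (auto simp: x_def n_def)
  qed
  \<comment> \<open>This uses x \<le> 1/2. With x \<le> 3/N(p)^2 and the sum of the inverse squares
    at most 24, the total exponent is 2 * 3 * 24 = 144.\<close>
  have "exp (- 2 * x p) \<le> 1 - x p" if "p \<in> P" for p
  proof -
    have "- x p - 2 * (x p)\<^sup>2 \<le> ln (1 - x p)" using x[OF that] by (intro ln_one_minus_pos_lower_bound) auto
    moreover have "2 * (x p)\<^sup>2 \<le> x p" using x[OF that] mult_left_mono[of "x p" "1/2" "x p"] by (simp add: power2_eq_square)
    ultimately have "- 2 * x p \<le> ln (1 - x p)" by simp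
    then have "exp (- 2 * x p) \<le> exp (ln (1 - x p))" by simp
    also have "\<dots> = 1 - x p" using x[OF that] by simp
    finally show ?thesis .
  qed
  then have "(\<Prod>p\<in>P. exp (- 2 * x p)) \<le> (\<Prod>p\<in>P. 1 - x p)" by (intro prod_mono) auto
  moreover have "(\<Prod>p\<in>P. exp (- 2 * x p)) = exp (- 2 * (\<Sum>p\<in>P. x p))" using P by (simp add: exp_sum sum_distrib_left)
  moreover have "(\<Sum>p\<in>P. x p) \<le> (\<Sum>p\<in>P. 3 * (1 / (real_of_int (gnm p))\<^sup>2))" using x by (intro sum_mono) auto
  moreover have "(\<Sum>p\<in>P. 3 * (1 / (real_of_int (gnm p))\<^sup>2)) \<le> 3 * 24"
    unfolding sum_distrib_left[symmetric] using sum_inverse_gnm_sq[OF P(1,2)] by simp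
  ultimately have "exp (- 144) \<le> (\<Prod>p\<in>P. 1 - x p)"
  proof -
    assume h: "(\<Prod>p\<in>P. exp (- 2 * x p)) \<le> (\<Prod>p\<in>P. 1 - x p)" "(\<Prod>p\<in>P. exp (- 2 * x p)) = exp (- 2 * (\<Sum>p\<in>P. x p))"
      "(\<Sum>p\<in>P. x p) \<le> (\<Sum>p\<in>P. 3 * (1 / (real_of_int (gnm p))\<^sup>2))" "(\<Sum>p\<in>P. 3 * (1 / (real_of_int (gnm p))\<^sup>2)) \<le> 3 * 24"
    then have "exp (- 144) \<le> exp (- 2 * (\<Sum>p\<in>P. x p))" by simp
    then show ?thesis using h by linarith
  qed
  then show ?thesis by (simp only: x_def)
qed

lemma euler_product_growth:
  "\<exists>c>0. \<forall>q. q \<noteq> 0 \<longrightarrow> (\<forall>p\<in>prime_factors q. gnm p \<ge> 3) \<longrightarrow>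
     (\<Prod>p\<in>prime_factors q. 1 - 2 / of_int (gnm p)) \<ge> c * 2 ^ card (prime_factors q) / (of_int (gnm q) :: real) powr (1/4)"
proof -
  \<comment> \<open>Prime by prime the two sides are compared through \<open>h p\<close> below.
    Since 81^(1/4) = 3, it is at least 1 for norms from 81 on, and each of the finitely many smaller
    primes costs at most a factor 1/6. With the exponent 1/4 the main term keeps N(q)^(3/4) against
    an error of size N(q)^(1/2).\<close>
  define B where "B = {z. gnm z \<le> 80}"
  define c :: real where "c = (1/6) ^ card B"
  have finB: "finite B" unfolding B_def by (rule finite_gnm_le)
  have "(\<Prod>p\<in>prime_factors q. 1 - 2 / of_int (gnm p)) \<ge> c * 2 ^ card (prime_factors q) / (of_int (gnm q) :: real) powr (1/4)"
    if q: "q \<noteq> 0" and n3: "\<forall>p\<in>prime_factors q. gnm p \<ge> 3" for q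
  proof -
    define P where "P = prime_factors q"
    have P: "finite P" by (simp add: P_def)
    define h where "h p = (1 - 2 / real_of_int (gnm p)) / 2 * real_of_int (gnm p) powr (1/4)" for p
    have h1: "h p \<ge> 1" if "p \<in> P" "p \<notin> B" for p
    proof -
      have n: "real_of_int (gnm p) \<ge> 81" using that by (simp add: B_def)
      have "(81::real) powr (1/4) = (3 powr 4) powr (1/4)" by (simp add: powr_numeral)
      also have "\<dots> = 3" by (simp add: powr_powr)
      finally have "3 \<le> real_of_int (gnm p) powr (1/4)" using powr_mono2[of "1/4" 81 "real_of_int (gnm p)"] n by simp
      moreover have "2 / real_of_int (gnm p) \<le> 2 / 81" using n by (intro divide_left_mono) auto
      then have "(1 - 2 / real_of_int (gnm p)) / 2 \<ge> 1/3" by simp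
      ultimately have "1/3 * 3 \<le> h p" unfolding h_def by (intro mult_mono) auto
      then show ?thesis by simp
    qed
    have h2: "h p \<ge> 1/6" if "p \<in> P" for p
    proof -
      have n: "real_of_int (gnm p) \<ge> 3" using n3 that by (simp add: P_def)
      have "1 \<le> real_of_int (gnm p) powr (1/4)" using n by (intro ge_one_powr_ge_zero) auto
      moreover have "2 / real_of_int (gnm p) \<le> 2 / 3" using n by (intro divide_left_mono) auto
      then have "(1 - 2 / real_of_int (gnm p)) / 2 \<ge> 1/6" by simp
      ultimately have "1/6 * 1 \<le> h p" unfolding h_def by (intro mult_mono) auto
      then show ?thesis by simp
    qed
    have "c \<le> (1/6) ^ card (P \<inter> B)"
      unfolding c_def using finB by (intro power_decreasing card_mono) auto
    also have "\<dots> = (\<Prod>p\<in>P. if p \<in> B then 1/6 else 1)" using P by (simp add: prod.If_cases)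
    also have "\<dots> \<le> (\<Prod>p\<in>P. h p)" using h1 h2 by (intro prod_mono) auto
    also have "\<dots> = (\<Prod>p\<in>P. 1 - 2 / real_of_int (gnm p)) / 2 ^ card P * (\<Prod>p\<in>P. real_of_int (gnm p) powr (1/4))"
      by (simp add: h_def prod.distrib prod_dividef)
    also have "(\<Prod>p\<in>P. real_of_int (gnm p) powr (1/4)) = (\<Prod>p\<in>P. real_of_int (gnm p)) powr (1/4)"
      by (rule prod_powr_distrib[symmetric])
    also have "(\<Prod>p\<in>P. real_of_int (gnm p)) = real_of_int (gnm (\<Prod>P))" by (simp add: gnm_prod[of id, simplified])
    finally have "c \<le> (\<Prod>p\<in>P. 1 - 2 / real_of_int (gnm p)) / 2 ^ card P * real_of_int (gnm (\<Prod>P)) powr (1/4)" .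
    also have "\<dots> \<le> (\<Prod>p\<in>P. 1 - 2 / real_of_int (gnm p)) / 2 ^ card P * real_of_int (gnm q) powr (1/4)"
    proof (rule mult_left_mono)
      have "gnm (\<Prod>P) \<le> gnm q" using q prod_primes_dvd[OF q] by (intro gnm_dvd_le) (auto simp: P_def)
      then show "real_of_int (gnm (\<Prod>P)) powr (1/4) \<le> real_of_int (gnm q) powr (1/4)" by (intro powr_mono2) auto
      have "0 \<le> 1 - 2 / real_of_int (gnm p)" if "p \<in> P" for p
      proof -
        have "real_of_int (gnm p) \<ge> 3" using n3 that by (simp add: P_def)
        then have "2 / real_of_int (gnm p) \<le> 2 / 3" by (intro divide_left_mono) auto
        then show ?thesis by simp
      qed
      then show "0 \<le> (\<Prod>p\<in>P. 1 - 2 / real_of_int (gnm p)) / 2 ^ card P" by (intro divide_nonneg_nonneg prod_nonneg) auto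
    qed
    finally show ?thesis using q unfolding P_def[symmetric] by (simp add: field_simps)
  qed
  moreover have "c > 0" by (simp add: c_def)
  ultimately show ?thesis by blast
qed

section \<open>Ideals and Hecke characters\<close>

lemma gauss_int_simps [simp]: "x \<otimes>\<^bsub>gauss_int\<^esub> y = x * y" "x \<oplus>\<^bsub>gauss_int\<^esub> y = x + y"
  "\<one>\<^bsub>gauss_int\<^esub> = 1" "\<zero>\<^bsub>gauss_int\<^esub> = 0" "carrier gauss_int = range cof"
  unfolding range_cof by (simp_all add: gauss_int_def)

lemma gideal_cof: "gideal (cof a) = cof ` {x. a dvd x}"
proof -
  have "gideal (cof a) = {cof x * cof a | x. True}" by (auto simp: cgenideal_def)
  also have "\<dots> = cof ` {x. a dvd x}" by (force simp flip: cof_simps simp: dvd_def mult.commute image_iff)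
  finally show ?thesis .
qed

lemma ideal_gideal: "ideal (gideal (cof a)) gauss_int"
  by (rule cring.cgenideal_ideal[OF cring_gauss_int]) simp

lemma cof_mem_gideal [simp]: "cof x \<in> gideal (cof a) \<longleftrightarrow> a dvd x"
  by (auto simp: gideal_cof)

definition rcl :: "gint \<Rightarrow> gint \<Rightarrow> complex set" where "rcl q a = residue_class (cof q) (cof a)"

lemma rcl_eq: "rcl q a = cof ` {x. q dvd x - a}"
proof -
  have "rcl q a = {h + cof a | h. h \<in> cof ` {x. q dvd x}}"
    by (auto simp: rcl_def residue_class_def a_r_coset_def r_coset_def gideal_cof)
  also have "\<dots> = cof ` {x. q dvd x - a}"
  proof (intro equalityI subsetI)
    fix z assume "z \<in> {h + cof a | h. h \<in> cof ` {x. q dvd x}}"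
    then obtain x where "q dvd x" "z = cof (x + a)" by auto
    then show "z \<in> cof ` {x. q dvd x - a}" by (intro image_eqI[of _ _ "x + a"]) auto
  next
    fix z assume "z \<in> cof ` {x. q dvd x - a}"
    then obtain x where "q dvd x - a" "z = cof (x - a) + cof a" by auto
    then show "z \<in> {h + cof a | h. h \<in> cof ` {x. q dvd x}}" by blast
  qed
  finally show ?thesis .
qed

lemma cof_image_eq_iff: "cof ` A = cof ` B \<longleftrightarrow> A = B"
  by (rule inj_image_eq_iff) (simp add: inj_def)

lemma rcl_eq_iff: "rcl q a = rcl q b \<longleftrightarrow> q dvd a - b"
proof
  assume "rcl q a = rcl q b"
  then have "a \<in> {x. q dvd x - b}" unfolding rcl_eq cof_image_eq_iff by (metis mem_Collect_eq diff_self dvd_0_right)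
  then show "q dvd a - b" by simp
next
  assume d: "q dvd a - b"
  have "q dvd x - a \<longleftrightarrow> q dvd x - b" for x
    using dvd_add_left_iff[OF d, of "x - a"] by simp
  then show "rcl q a = rcl q b" by (simp add: rcl_eq)
qed

lemma coprime_bezout: "coprime a b \<longleftrightarrow> (\<exists>u v. u * a + v * b = (1 :: gint))"
proof
  assume "coprime a b"
  then have "fst (bezout_coefficients a b) * a + snd (bezout_coefficients a b) * b = 1"
    using bezout_coefficients_fst_snd[of a b] by simp
  then show "\<exists>u v. u * a + v * b = 1" by blast
next
  assume "\<exists>u v. u * a + v * b = 1"
  then obtain u v where "u * a + v * b = 1" by blast
  then show "coprime a b" by (intro coprimeI) (metis dvd_add dvd_mult)
qed

lemma coprime_ideals_cof: "coprime_ideals (gideal (cof a)) (gideal (cof b)) \<longleftrightarrow> coprime a b"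
proof -
  have sum: "gideal (cof a) <+>\<^bsub>gauss_int\<^esub> gideal (cof b) = cof ` {x + y | x y. a dvd x \<and> b dvd y}"
    by (auto simp: set_add_def set_mult_def gideal_cof simp flip: cof_simps)
  have "coprime_ideals (gideal (cof a)) (gideal (cof b)) \<longleftrightarrow> {x + y | x y. a dvd x \<and> b dvd y} = UNIV"
    unfolding coprime_ideals_def sum gauss_int_simps by (rule cof_image_eq_iff)
  also have "\<dots> \<longleftrightarrow> (\<exists>x y. a dvd x \<and> b dvd y \<and> x + y = 1)"
  proof
    assume "{x + y | x y. a dvd x \<and> b dvd y} = UNIV"
    then have "1 \<in> {x + y | x y. a dvd x \<and> b dvd y}" by simp
    then show "\<exists>x y. a dvd x \<and> b dvd y \<and> x + y = 1" by auto
  next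
    assume "\<exists>x y. a dvd x \<and> b dvd y \<and> x + y = 1"
    then obtain x y where xy: "a dvd x" "b dvd y" "x + y = 1" by blast
    have "z \<in> {x + y | x y. a dvd x \<and> b dvd y}" for z
    proof -
      have "z = z * x + z * y" using xy(3) by (simp add: distrib_left[symmetric])
      moreover have "a dvd z * x" "b dvd z * y" using xy by simp_all
      ultimately show ?thesis by blast
    qed
    then show "{x + y | x y. a dvd x \<and> b dvd y} = UNIV" by blast
  qed
  also have "\<dots> \<longleftrightarrow> coprime a b"
    unfolding coprime_bezout by (metis dvd_def mult.commute dvd_triv_right)
  finally show ?thesis .
qed

text \<open>The Gaussian integers are a principal ideal domain: a nonzero element of least Euclidean
  size generates the ideal, since remainders modulo it stay in the ideal and are smaller.\<close>

lemma nonzero_ideals_eq: "nonzero_ideals = (\<lambda>a. gideal (cof a)) ` {a. a \<noteq> 0}"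
proof (intro equalityI subsetI)
  fix I assume "I \<in> (\<lambda>a. gideal (cof a)) ` {a. a \<noteq> 0}"
  then obtain a where a: "a \<noteq> 0" "I = gideal (cof a)" by auto
  have "cof a \<in> I" "cof a \<noteq> 0" using a by simp_all
  then have "I \<noteq> {0}" by blast
  then show "I \<in> nonzero_ideals" using a ideal_gideal by (simp add: nonzero_ideals_def)
next
  fix I assume I: "I \<in> nonzero_ideals"
  then interpret I: ideal I gauss_int by (simp add: nonzero_ideals_def)
  define J where "J = {x. cof x \<in> I}"
  have IJ: "I = cof ` J" using I.a_subset by (auto simp: J_def)
  have "0 \<in> I" using additive_subgroup.zero_closed[OF I.additive_subgroup_axioms] by simp
  then obtain x0 where "x0 \<in> J" "x0 \<noteq> 0" using I unfolding nonzero_ideals_def IJ by fastforce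
  then have ex: "\<exists>x. x \<in> J \<and> x \<noteq> 0" by blast
  obtain x where x: "x \<in> J" "x \<noteq> 0" "\<And>y. y \<in> J \<Longrightarrow> y \<noteq> 0 \<Longrightarrow> euclidean_size x \<le> euclidean_size y"
    using ex_has_least_nat[of "\<lambda>x. x \<in> J \<and> x \<noteq> 0" x0 euclidean_size] ex \<open>x0 \<in> J\<close> \<open>x0 \<noteq> 0\<close> by blast
  have mul: "t * y \<in> J" if "y \<in> J" for t y using I.I_l_closed[of "cof y" "cof t"] that by (simp add: J_def)
  have add: "y + z \<in> J" if "y \<in> J" "z \<in> J" for y z using additive_subgroup.a_closed[OF I.additive_subgroup_axioms, of "cof y" "cof z"] that by (simp add: J_def)
  have "y \<in> J \<longleftrightarrow> x dvd y" for y
  proof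
    assume y: "y \<in> J"
    have "y mod x = y + (- (y div x)) * x" by (simp add: modulo_gint_def)
    also have "\<dots> \<in> J" using y x by (intro add mul)
    finally have "y mod x = 0" using x(3)[of "y mod x"] mod_size_less[OF x(2), of y] by fastforce
    then show "x dvd y" by (simp add: mod_eq_0_iff_dvd)
  next
    assume "x dvd y"
    then show "y \<in> J" using mul[OF x(1)] by (auto simp: dvd_def mult.commute)
  qed
  then have "J = {y. x dvd y}" by blast
  then have "I = gideal (cof x)" unfolding IJ gideal_cof by simp
  then show "I \<in> (\<lambda>a. gideal (cof a)) ` {a. a \<noteq> 0}" using x by blast
qed

lemma carrier_Quot: "carrier (gauss_int Quot gideal (cof q)) = range (rcl q)"
  by (auto simp: FactRing_def A_RCOSETS_def' rcl_def residue_class_def)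

lemma range_rcl: "q \<noteq> 0 \<Longrightarrow> range (rcl q) = rcl q ` res q"
proof -
  have "rcl q a = rcl q (a mod q)" for a
    using dvd_mod_minus[of q a] by (metis rcl_eq_iff)
  then have "rcl q a \<in> rcl q ` res q" for a using mod_in_res by blast
  then show ?thesis by blast
qed

lemma inj_rcl: "inj_on (rcl q) (res q)"
  by (rule inj_onI) (metis rcl_eq_iff res_eqI)

lemma ideal_norm_cof: "a \<noteq> 0 \<Longrightarrow> ideal_norm (gideal (cof a)) = nat (gnm a)"
  unfolding ideal_norm_def carrier_Quot by (simp add: range_rcl card_image[OF inj_rcl] card_res)

section \<open>Primary elements and primary generators\<close>

definition lam :: gint where "lam = GInt (- 2) 2"

lemma cof_lam: "cof lam = (1 + \<i>) ^ 3"
  by (simp add: lam_def complex_eq_iff eval_nat_numeral)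

lemma gnm_lam [simp]: "gnm lam = 8"
  by (simp add: lam_def gnm_def)

lemma lam_nz [simp]: "lam \<noteq> 0" by (simp add: lam_def gint_eq_iff)

abbreviation prim :: "gint \<Rightarrow> bool" where "prim a \<equiv> lam dvd a - 1"

lemma primary_cof: "primary (cof a) \<longleftrightarrow> prim a"
proof -
  have "cof a - 1 = cof (a - 1)" by simp
  then show ?thesis unfolding primary_def cof_lam[symmetric] gauss_int_simps using cof_mem_gideal[of "a - 1" lam] by simp
qed

text \<open>Turns divisibility by (1 + i)^3 into congruences modulo 4, which integer arithmetic
  decides.\<close>

lemma lam_dvd_iff: "lam dvd z \<longleftrightarrow> 4 dvd gre z + gim z \<and> 4 dvd gre z - gim z"
proof
  assume "lam dvd z"
  then obtain w where "z = lam * w" by (elim dvdE)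
  then have "gre z + gim z = 4 * (- gim w)" "gre z - gim z = 4 * (- gre w)" by (simp_all add: lam_def)
  then show "4 dvd gre z + gim z \<and> 4 dvd gre z - gim z" by (metis dvd_triv_left)
next
  assume "4 dvd gre z + gim z \<and> 4 dvd gre z - gim z"
  then obtain s t where "gre z + gim z = 4 * s" "gre z - gim z = 4 * t" by (auto elim!: dvdE)
  then have "gre z = 2 * s + 2 * t" "gim z = 2 * s - 2 * t" by auto
  then have "z = lam * GInt (- t) (- s)" by (simp add: lam_def gint_eq_iff)
  then show "lam dvd z" by simp
qed

lemma lam_dvd_4: "lam dvd 4"
  by (simp add: lam_dvd_iff)

text \<open>The quotient of two primary associates is a unit congruent to 1 modulo (1 + i)^3, and 1
  is the only such unit.\<close>

lemma prim_unit_eq: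
  assumes "prim a" "prim b" "a dvd b" "b dvd a" "a \<noteq> 0"
  shows "a = b"
proof -
  obtain u where u: "b = a * u" using assms by (elim dvdE)
  have "u dvd 1" using assms by (simp add: u)
  then have "gnm u = 1" by (simp add: gint_unit_iff)
  have "lam dvd (b - 1) - u * (a - 1)" by (rule dvd_diff[OF assms(2) dvd_mult[OF assms(1)]])
  also have "(b - 1) - u * (a - 1) = u - 1" by (simp add: u algebra_simps)
  finally have "lam dvd u - 1" .
  then have "u = 1" using gnm_eq_1_cases[OF \<open>gnm u = 1\<close>] by (auto simp: lam_dvd_iff)
  then show ?thesis by (simp add: u)
qed

lemma prim_coprime_2: "prim a \<Longrightarrow> coprime a 2"
proof -
  assume "prim a"
  then obtain w where "a - 1 = lam * w" by (elim dvdE)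
  moreover have "lam = 2 * GInt (- 1) 1" by (simp add: lam_def gint_eq_iff)
  ultimately have "1 * a + (- GInt (- 1) 1 * w) * 2 = 1" by (simp add: algebra_simps)
  then show ?thesis unfolding coprime_bezout by blast
qed

text \<open>Coprimality to 2 means that exactly one coordinate is odd. Multiplication by i moves it
  to the real part, and a sign then settles the congruence modulo 4.\<close>

lemma exists_prim_unit:
  assumes "coprime a 2"
  shows "\<exists>u. u dvd 1 \<and> prim (u * a)"
proof -
  have "odd (gre a + gim a)"
  proof
    assume "even (gre a + gim a)"
    then obtain s where s: "gre a + gim a = 2 * s" by (elim evenE)
    then have "gim a = 2 * s - gre a" by simp
    then have "a = GInt 1 1 * GInt s (s - gre a)" by (simp add: gint_eq_iff)
    moreover have "2 = GInt 1 1 * GInt 1 (-1)" by (simp add: gint_eq_iff)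
    ultimately have "GInt 1 1 dvd a" "GInt 1 1 dvd 2" by (metis dvd_triv_left)+
    then have "GInt 1 1 dvd 1" using assms coprime_common_divisor by blast
    then show False by (simp add: gint_unit_iff gnm_def)
  qed
  have *: "\<exists>u. u dvd 1 \<and> prim (u * b)" if "odd (gre b)" "even (gim b)" for b
  proof -
    from that(1) obtain s where s: "gre b = 2 * s + 1" by (rule oddE)
    from that(2) obtain t where t: "gim b = 2 * t" by (rule evenE)
    note st = s t
    show ?thesis
    proof (cases "even (s + t)")
      case True
      then have "prim (1 * b)" by (simp add: lam_dvd_iff st) presburger
      then show ?thesis by (intro exI[of _ 1]) simp
    next
      case False
      then have "prim ((- 1) * b)" by (simp add: lam_dvd_iff st) presburger
      then show ?thesis by (intro exI[of _ "- 1"]) simp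
    qed
  qed
  show ?thesis
  proof (cases "odd (gre a)")
    case True
    then show ?thesis using * \<open>odd (gre a + gim a)\<close> by simp
  next
    case False
    define b where "b = GInt 0 1 * a"
    have "odd (gre b)" "even (gim b)" using False \<open>odd (gre a + gim a)\<close> by (simp_all add: b_def)
    then obtain u where "u dvd 1" "prim (u * b)" using * by blast
    moreover have "GInt 0 1 dvd 1" by (simp add: gint_unit_iff gnm_def)
    ultimately have "u * GInt 0 1 dvd 1" "prim ((u * GInt 0 1) * a)" by (auto simp: b_def mult.assoc intro: unit_prod)
    then show ?thesis by blast
  qed
qed

lemma gideal_eq_iff: "gideal (cof a) = gideal (cof b) \<longleftrightarrow> a dvd b \<and> b dvd a"
proof
  assume "gideal (cof a) = gideal (cof b)"
  then show "a dvd b \<and> b dvd a" by (metis cof_mem_gideal dvd_refl)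
next
  assume "a dvd b \<and> b dvd a"
  then have "a dvd x \<longleftrightarrow> b dvd x" for x by (meson dvd_trans)
  then show "gideal (cof a) = gideal (cof b)" by (simp add: gideal_cof)
qed

lemma prim_nz: "prim a \<Longrightarrow> a \<noteq> 0"
  by (auto simp: lam_dvd_iff)

lemma primary_generator_cof:
  assumes "prim a"
  shows "primary_generator (gideal (cof a)) = cof a"
  unfolding primary_generator_def
proof (rule the_equality)
  show "primary (cof a) \<and> gideal (cof a) = gideal (cof a)" using assms by (simp add: primary_cof)
  fix z assume z: "primary z \<and> gideal (cof a) = gideal z"
  then obtain b where b: "z = cof b" by (auto simp: primary_def)
  then show "z = cof a" using z assms prim_unit_eq[of a b] prim_nz[OF assms] by (simp add: primary_cof gideal_eq_iff)
qed

section \<open>The unit group of the residue ring\<close>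

context
  fixes q :: gint
  assumes q: "q \<noteq> 0"
begin

lemma cring_Quot: "cring (gauss_int Quot gideal (cof q))"
  by (rule ideal.quotient_is_cring[OF ideal_gideal cring_gauss_int])

lemma Quot_mult: "rcl q a \<otimes>\<^bsub>gauss_int Quot gideal (cof q)\<^esub> rcl q b = rcl q (a * b)"
  unfolding rcl_def residue_class_def FactRing_def
  by (simp add: ideal.rcoset_mult_add[OF ideal_gideal])

lemma Quot_one: "\<one>\<^bsub>gauss_int Quot gideal (cof q)\<^esub> = rcl q 1"
  by (simp add: rcl_def residue_class_def FactRing_def)

lemma carrier_gunits: "carrier (gunits (cof q)) = rcl q ` {a. coprime a q}"
proof -
  interpret Q: cring "gauss_int Quot gideal (cof q)" by (rule cring_Quot)
  have "rcl q a \<in> Units (gauss_int Quot gideal (cof q)) \<longleftrightarrow> coprime a q" for a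
  proof
    assume "rcl q a \<in> Units (gauss_int Quot gideal (cof q))"
    then obtain b where "rcl q b \<otimes>\<^bsub>gauss_int Quot gideal (cof q)\<^esub> rcl q a = \<one>\<^bsub>gauss_int Quot gideal (cof q)\<^esub>"
      unfolding Units_def carrier_Quot by blast
    then have "q dvd b * a - 1" by (simp add: Quot_mult Quot_one rcl_eq_iff)
    then obtain c where "b * a - 1 = q * c" by (elim dvdE)
    then have "b * a + (- c) * q = 1" by (simp add: algebra_simps)
    then show "coprime a q" unfolding coprime_bezout by blast
  next
    assume "coprime a q"
    then obtain u v where uv: "u * a + v * q = 1" unfolding coprime_bezout by blast
    have "u * a - 1 = q * (- v)" using uv by (simp add: algebra_simps)
    then have "q dvd u * a - 1" by simp
    then have "rcl q u \<otimes>\<^bsub>gauss_int Quot gideal (cof q)\<^esub> rcl q a = \<one>\<^bsub>gauss_int Quot gideal (cof q)\<^esub>"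
      by (simp add: Quot_mult Quot_one rcl_eq_iff)
    then show "rcl q a \<in> Units (gauss_int Quot gideal (cof q))"
      using Q.m_comm[of "rcl q u" "rcl q a"] by (auto simp: Units_def carrier_Quot)
  qed
  moreover have "Units (gauss_int Quot gideal (cof q)) \<subseteq> range (rcl q)" by (auto simp: Units_def carrier_Quot)
  ultimately show ?thesis unfolding units_of_carrier by blast
qed

lemma gunits_mult: "rcl q a \<otimes>\<^bsub>gunits (cof q)\<^esub> rcl q b = rcl q (a * b)"
  by (simp add: units_of_mult Quot_mult)

lemma gunits_one: "\<one>\<^bsub>gunits (cof q)\<^esub> = rcl q 1"
  by (simp add: units_of_one Quot_one)

lemma comm_group_gunits: "comm_group (gunits (cof q))"
proof -
  interpret Q: cring "gauss_int Quot gideal (cof q)" by (rule cring_Quot)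
  show ?thesis by (rule Q.units_comm_group)
qed

lemma coprime_mod: "coprime (a mod q) q \<longleftrightarrow> coprime a q"
  by (metis coprime_mod_left_iff q)

lemma carrier_gunits_res: "carrier (gunits (cof q)) = rcl q ` {a\<in>res q. coprime a q}"
proof -
  have "rcl q a \<in> rcl q ` {a\<in>res q. coprime a q}" if "coprime a q" for a
  proof -
    have "rcl q a = rcl q (a mod q)" using dvd_mod_minus[of q a] by (metis rcl_eq_iff)
    then show ?thesis using that coprime_mod by auto
  qed
  then show ?thesis unfolding carrier_gunits by blast
qed

lemma finite_gunits: "finite (carrier (gunits (cof q)))"
  unfolding carrier_gunits_res using finite_res[OF q] by simp

lemma card_gunits: "card (carrier (gunits (cof q))) = card {a\<in>res q. coprime a q}"
  unfolding carrier_gunits_res by (intro card_image inj_on_subset[OF inj_rcl]) auto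

end

section \<open>The Hecke series as a sum over primary elements\<close>

lemma characters_eq_chars: "characters z = chars (gunits z)"
  by (simp add: characters_def)

definition cval :: "gint \<Rightarrow> (complex set \<Rightarrow> complex) \<Rightarrow> gint \<Rightarrow> complex" where
  "cval q \<phi> a = (if coprime a q then \<phi> (rcl q a) else 0)"

lemma hecke_char_cof:
  assumes "prim a"
  shows "hecke_char (cof q) \<phi> (gideal (cof a)) = cval q \<phi> a"
proof -
  have "gideal (cof a) \<in> nonzero_ideals" using prim_nz[OF assms] by (auto simp: nonzero_ideals_eq)
  moreover have "coprime_ideals (gideal (cof a)) (gideal (2 * cof q)) \<longleftrightarrow> coprime a q"
  proof -
    have "2 * cof q = cof (2 * q)" by simp
    then show ?thesis using prim_coprime_2[OF assms] by (simp only: coprime_ideals_cof) simp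
  qed
  ultimately show ?thesis
    by (simp add: hecke_char_def cval_def primary_generator_cof[OF assms] rcl_def)
qed

text \<open>An ideal without primary generator is not coprime to 2, by
  \<open>exists_prim_unit\<close>, so it lies outside the support of the Hecke character.\<close>

lemma hecke_char_eq_0:
  assumes "I \<in> nonzero_ideals" "I \<notin> (\<lambda>a. gideal (cof a)) ` {a. prim a}"
  shows "hecke_char (cof q) \<phi> I = 0"
proof -
  obtain a where a: "a \<noteq> 0" "I = gideal (cof a)" using assms(1) by (auto simp: nonzero_ideals_eq)
  have "\<not> coprime a 2"
  proof
    assume "coprime a 2"
    then obtain u where u: "u dvd 1" "prim (u * a)" using exists_prim_unit by blast
    have "gideal (cof (u * a)) = I" using u unfolding a gideal_eq_iff by simp
    then show False using assms(2) u by blast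
  qed
  moreover have "2 * cof q = cof (2 * q)" by simp
  ultimately have "\<not> coprime_ideals I (gideal (2 * cof q))"
    unfolding a by (simp only: coprime_ideals_cof coprime_mult_right_iff) simp
  then show ?thesis using assms(1) by (simp add: hecke_char_def)
qed

lemma inj_prim_ideal: "inj_on (\<lambda>a. gideal (cof a)) {a. prim a}"
  by (rule inj_onI) (use prim_unit_eq prim_nz in \<open>auto simp: gideal_eq_iff\<close>)

lemma hecke_series:
  "(\<Sum>\<^sub>\<infinity>I\<in>nonzero_ideals. hecke_char (cof q) \<phi> I * of_nat (ideal_norm I) powr (- s)) =
   (\<Sum>\<^sub>\<infinity>a\<in>{a. prim a}. cval q \<phi> a * of_int (gnm a) powr (- s))"
proof -
  have "(\<Sum>\<^sub>\<infinity>I\<in>nonzero_ideals. hecke_char (cof q) \<phi> I * of_nat (ideal_norm I) powr (- s)) =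
    (\<Sum>\<^sub>\<infinity>I\<in>(\<lambda>a. gideal (cof a)) ` {a. prim a}. hecke_char (cof q) \<phi> I * of_nat (ideal_norm I) powr (- s))"
    by (rule infsum_cong_neutral) (use prim_nz hecke_char_eq_0 in \<open>auto simp: nonzero_ideals_eq\<close>)
  also have "\<dots> = (\<Sum>\<^sub>\<infinity>a\<in>{a. prim a}. hecke_char (cof q) \<phi> (gideal (cof a)) * of_nat (ideal_norm (gideal (cof a))) powr (- s))"
    by (subst infsum_reindex[OF inj_prim_ideal]) (simp add: o_def)
  also have "\<dots> = (\<Sum>\<^sub>\<infinity>a\<in>{a. prim a}. cval q \<phi> a * of_int (gnm a) powr (- s))"
  proof (rule infsum_cong)
    fix a assume "a \<in> {a. prim a}"
    then have a: "prim a" "a \<noteq> 0" using prim_nz by auto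
    have "complex_of_nat (ideal_norm (gideal (cof a))) = of_int (gnm a)"
      using a by (simp add: ideal_norm_cof)
    then show "hecke_char (cof q) \<phi> (gideal (cof a)) * of_nat (ideal_norm (gideal (cof a))) powr (- s) =
        cval q \<phi> a * of_int (gnm a) powr (- s)"
      using hecke_char_cof[OF a(1)] by simp
  qed
  finally show ?thesis .
qed

section \<open>The central value\<close>

text \<open>For odd q these residues meet every class modulo q exactly once, by the Chinese
  remainder theorem. One index set thus serves the splitting of the L-series modulo Q and the
  character sums over the unit group modulo q.\<close>

definition Rset :: "gint \<Rightarrow> gint set" where "Rset q = {r\<in>res (lam * q). prim r}"

lemma coprime_lam: "coprime q 2 \<Longrightarrow> coprime lam q"
proof -
  assume "coprime q 2"
  then have "coprime q (2 * 2)" by (simp only: coprime_mult_right_iff)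
  then have "coprime q 4" by simp
  then have "coprime q lam" using lam_dvd_4 coprime_divisors[of q q lam 4] by simp
  then show ?thesis by (simp add: coprime_commute)
qed

lemma Rset_eqI:
  assumes "coprime q 2" "r \<in> Rset q" "r' \<in> Rset q" "q dvd r - r'"
  shows "r = r'"
proof -
  have "prim r" "prim r'" using assms by (auto simp: Rset_def)
  then have "lam dvd (r - 1) - (r' - 1)" by (rule dvd_diff)
  then have "lam dvd r - r'" by simp
  then have "lam * q dvd r - r'" using assms(4) coprime_lam[OF assms(1)] by (intro divides_mult)
  then show ?thesis using assms res_eqI by (auto simp: Rset_def)
qed

lemma Rset_ex:
  assumes "coprime q 2"
  shows "\<exists>r\<in>Rset q. q dvd r - a"
proof -
  obtain u v where uv: "u * lam + v * q = 1" using coprime_lam[OF assms] unfolding coprime_bezout by blast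
  \<comment> \<open>The Chinese remainder solution that is 1 modulo (1 + i)^3 and a modulo
    q.\<close>
  define r0 where "r0 = a * (u * lam) + v * q"
  have "r0 - 1 = (a * u - u) * lam" "r0 - a = (v - a * v) * q"
  proof -
    have "r0 - 1 = r0 - (u * lam + v * q)" by (simp add: uv)
    then show "r0 - 1 = (a * u - u) * lam" by (simp add: r0_def algebra_simps)
    have "r0 - a = r0 - a * (u * lam + v * q)" by (simp add: uv)
    then show "r0 - a = (v - a * v) * q" by (simp add: r0_def algebra_simps)
  qed
  then have d: "lam dvd r0 - 1" "q dvd r0 - a" by (simp_all del: gint_simps)
  define r where "r = r0 mod (lam * q)"
  have "lam * q dvd r - r0" unfolding r_def by (rule dvd_mod_minus)
  then have "lam dvd r - r0" "q dvd r - r0" by (blast intro: dvd_mult_left dvd_mult_right)+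
  then have "lam dvd (r - r0) + (r0 - 1)" "q dvd (r - r0) + (r0 - a)" using d by (blast intro: dvd_add)+
  then have "lam dvd r - 1" "q dvd r - a" by simp_all
  then show ?thesis by (intro bexI[of _ r]) (auto simp: Rset_def r_def)
qed

lemma finite_Rset: "q \<noteq> 0 \<Longrightarrow> finite (Rset q)"
  unfolding Rset_def using finite_res[of "lam * q"] by simp

lemma bij_Rset_gunits:
  assumes "q \<noteq> 0" "coprime q 2"
  shows "bij_betw (rcl q) {r\<in>Rset q. coprime r q} (carrier (gunits (cof q)))"
  unfolding bij_betw_def
proof
  show "inj_on (rcl q) {r\<in>Rset q. coprime r q}"
    by (rule inj_onI) (use Rset_eqI[OF assms(2)] in \<open>auto simp: rcl_eq_iff\<close>)
  have "\<exists>r\<in>Rset q. coprime r q \<and> rcl q r = rcl q a" if a: "coprime a q" for a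
  proof -
    obtain r where r: "r \<in> Rset q" "q dvd r - a" using Rset_ex[OF assms(2)] by blast
    then have "r mod q = a mod q" by (simp add: mod_eq_dvd_iff)
    then have "coprime r q" using a coprime_mod[OF assms(1), of r] coprime_mod[OF assms(1), of a] by simp
    then show ?thesis using r rcl_eq_iff by blast
  qed
  then show "rcl q ` {r\<in>Rset q. coprime r q} = carrier (gunits (cof q))"
    unfolding carrier_gunits[OF assms(1)] by (auto simp: image_iff) metis
qed

lemma sum_cval_Rset:
  assumes "q \<noteq> 0" "coprime q 2"
  shows "(\<Sum>r\<in>Rset q. cval q \<phi> r * f r) = (\<Sum>r\<in>{r\<in>Rset q. coprime r q}. \<phi> (rcl q r) * f r)"
  using finite_Rset[OF assms(1)] by (simp add: sum.inter_filter cval_def if_distrib[of "\<lambda>x. x * _"] cong: if_cong)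

text \<open>Nontriviality is witnessed by X. This vanishing is the cancellation that removes the
  common term \<open>E\<close> from the L-series.\<close>

lemma sum_cval_eq_0:
  assumes "q \<noteq> 0" "coprime q 2" "\<phi> \<in> characters (cof q)" "X \<in> carrier (gunits (cof q))" "\<phi> X \<noteq> 1"
  shows "(\<Sum>r\<in>Rset q. cval q \<phi> r) = 0"
proof -
  interpret G: comm_group "gunits (cof q)" by (rule comm_group_gunits[OF assms(1)])
  have "(\<Sum>r\<in>Rset q. cval q \<phi> r) = (\<Sum>r\<in>{r\<in>Rset q. coprime r q}. \<phi> (rcl q r))"
    using sum_cval_Rset[OF assms(1,2), of \<phi> "\<lambda>_. 1"] by simp
  also have "\<dots> = (\<Sum>X\<in>carrier (gunits (cof q)). \<phi> X)"
    by (rule sum.reindex_bij_betw[OF bij_Rset_gunits[OF assms(1,2)]])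
  also have "\<dots> = 0"
    using G.sum_subgroup_char[OF finite_gunits[OF assms(1)] G.subgroup_self, of \<phi>] assms(3-5)
    by (auto simp: characters_eq_chars)
  finally show ?thesis .
qed

lemma cval_cong:
  assumes "q \<noteq> 0" "q dvd a - b"
  shows "cval q \<phi> a = cval q \<phi> b"
proof -
  have "a mod q = b mod q" using assms by (simp add: mod_eq_dvd_iff)
  then have "coprime a q \<longleftrightarrow> coprime b q" using coprime_mod[OF assms(1), of a] coprime_mod[OF assms(1), of b] by simp
  then show ?thesis using assms(2) by (simp add: cval_def rcl_eq_iff[symmetric])
qed

lemma hecke_L_eqI:
  assumes L: "L holomorphic_on UNIV"
    and eq: "\<And>s. Re s > 1 \<Longrightarrow> L s = (\<Sum>\<^sub>\<infinity>I\<in>nonzero_ideals. \<theta> I * of_nat (ideal_norm I) powr (- s))"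
  shows "hecke_L \<theta> = L"
  unfolding hecke_L_def
proof (rule the_equality)
  show "L holomorphic_on UNIV \<and> (\<forall>s. Re s > 1 \<longrightarrow> L s = (\<Sum>\<^sub>\<infinity>I\<in>nonzero_ideals. \<theta> I * of_nat (ideal_norm I) powr (- s)))"
    using assms by blast
  fix M assume M: "M holomorphic_on UNIV \<and> (\<forall>s. Re s > 1 \<longrightarrow> M s = (\<Sum>\<^sub>\<infinity>I\<in>nonzero_ideals. \<theta> I * of_nat (ideal_norm I) powr (- s)))"
  show "M = L"
  proof
    fix z
    show "M z = L z"
    proof (rule analytic_continuation_open[of "{s. Re s > 1}" UNIV M L])
      show "open {s. Re s > 1}" by (rule open_halfspace_Re_gt)
      have "2 \<in> {s. Re s > 1}" by simp
      then show "{s. Re s > 1} \<noteq> {}" by blast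
    qed (use M L eq in auto)
  qed
qed

text \<open>The class of r modulo Q is Q times a lattice shifted by r/Q, and least residues place
  r/Q in the box that \<open>epstein_continuation\<close> asks for. The weights \<open>H r\<close>
  do not depend on \<open>\<phi>\<close>, so sums over characters act on the coefficients
  alone.\<close>

theorem hecke_L_half:
  "\<exists>C\<ge>0. \<forall>q. q \<noteq> 0 \<longrightarrow> coprime q 2 \<longrightarrow> (\<exists>H :: gint \<Rightarrow> complex.
     (\<forall>r\<in>Rset q. cmod (H r - of_real (1 / cmod (cof r))) \<le> C / cmod (cof (lam * q))) \<and>
     (\<forall>\<phi>\<in>characters (cof q). \<forall>X\<in>carrier (gunits (cof q)). \<phi> X \<noteq> 1 \<longrightarrow>
        hecke_L (hecke_char (cof q) \<phi>) (1/2) = (\<Sum>r\<in>Rset q. cval q \<phi> r * H r)))"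
proof -
  obtain C E where C: "C \<ge> 0" "\<And>x y. \<bar>x\<bar> \<le> 1/2 \<Longrightarrow> \<bar>y\<bar> \<le> 1/2 \<Longrightarrow> (x, y) \<noteq> (0, 0) \<Longrightarrow> (\<exists>K. K holomorphic_on UNIV
     \<and> (\<forall>s. Re s > 1 \<longrightarrow> ((\<lambda>b. of_real (latsq x y b) powr (- s)) has_sum (K s + E s)) UNIV)
     \<and> cmod (K (1/2) - of_real (1 / sqrt (x\<^sup>2 + y\<^sup>2))) \<le> C)"
    using epstein_continuation by blast
  have "\<exists>H :: gint \<Rightarrow> complex.
     (\<forall>r\<in>Rset q. cmod (H r - of_real (1 / cmod (cof r))) \<le> C / cmod (cof (lam * q))) \<and>
     (\<forall>\<phi>\<in>characters (cof q). \<forall>X\<in>carrier (gunits (cof q)). \<phi> X \<noteq> 1 \<longrightarrow>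
        hecke_L (hecke_char (cof q) \<phi>) (1/2) = (\<Sum>r\<in>Rset q. cval q \<phi> r * H r))"
    if q: "q \<noteq> 0" "coprime q 2" for q
  proof -
    define Q where "Q = lam * q"
    have Q: "Q \<noteq> 0" using q by (simp add: Q_def)
    define N where "N = real_of_int (gnm Q)"
    have N: "N > 0" using Q by (simp add: N_def)
    have NQ: "N = (cmod (cof Q))\<^sup>2" by (simp add: N_def cmod_cof_power2)
    define z where "z r = cof r / cof Q" for r
    have box: "\<bar>Re (z r)\<bar> \<le> 1/2" "\<bar>Im (z r)\<bar> \<le> 1/2" "(Re (z r), Im (z r)) \<noteq> (0, 0)" if "r \<in> Rset q" for r
    proof -
      have r: "r \<in> res Q" "r \<noteq> 0" using that prim_nz by (auto simp: Rset_def Q_def)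
      show "\<bar>Re (z r)\<bar> \<le> 1/2" "\<bar>Im (z r)\<bar> \<le> 1/2" using mod_box[OF Q r(1)] by (simp_all add: z_def)
      have "z r \<noteq> 0" using r Q by (simp add: z_def)
      then show "(Re (z r), Im (z r)) \<noteq> (0, 0)" by (auto simp: complex_eq_iff)
    qed
    have "\<exists>K. \<forall>r\<in>Rset q. K r holomorphic_on UNIV
       \<and> (\<forall>s. Re s > 1 \<longrightarrow> ((\<lambda>b. of_real (latsq (Re (z r)) (Im (z r)) b) powr (- s)) has_sum (K r s + E s)) UNIV)
       \<and> cmod (K r (1/2) - of_real (1 / sqrt ((Re (z r))\<^sup>2 + (Im (z r))\<^sup>2))) \<le> C"
      by (rule bchoice) (use C(2) box in blast)
    then obtain K where KK: "\<forall>r\<in>Rset q. K r holomorphic_on UNIV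
       \<and> (\<forall>s. Re s > 1 \<longrightarrow> ((\<lambda>b. of_real (latsq (Re (z r)) (Im (z r)) b) powr (- s)) has_sum (K r s + E s)) UNIV)
       \<and> cmod (K r (1/2) - of_real (1 / sqrt ((Re (z r))\<^sup>2 + (Im (z r))\<^sup>2))) \<le> C" by (rule exE)
    have K: "\<And>r. r \<in> Rset q \<Longrightarrow> K r holomorphic_on UNIV"
       "\<And>r s. r \<in> Rset q \<Longrightarrow> Re s > 1 \<Longrightarrow> ((\<lambda>b. of_real (latsq (Re (z r)) (Im (z r)) b) powr (- s)) has_sum (K r s + E s)) UNIV"
       "\<And>r. r \<in> Rset q \<Longrightarrow> cmod (K r (1/2) - of_real (1 / sqrt ((Re (z r))\<^sup>2 + (Im (z r))\<^sup>2))) \<le> C"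
      for r s using KK by blast+
    \<comment> \<open>The factor 1/|Q| is the scaling \<open>of_real N powr (- s)\<close> at s =
      1/2; it turns the main term 1/|r/Q| into 1/|r| and the bounded error into O(1/|Q|).\<close>
    define H where "H r = of_real (1 / cmod (cof Q)) * K r (1/2)" for r
    have "cmod (H r - of_real (1 / cmod (cof r))) \<le> C / cmod (cof Q)" if r: "r \<in> Rset q" for r
    proof -
      have "sqrt ((Re (z r))\<^sup>2 + (Im (z r))\<^sup>2) = cmod (cof r) / cmod (cof Q)"
        using norm_divide[of "cof r" "cof Q"] by (simp add: z_def cmod_def)
      then have "of_real (1 / cmod (cof Q)) * complex_of_real (1 / sqrt ((Re (z r))\<^sup>2 + (Im (z r))\<^sup>2)) = of_real (1 / cmod (cof r))"
        using Q by simp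
      then have "H r - of_real (1 / cmod (cof r)) = of_real (1 / cmod (cof Q)) * (K r (1/2) - of_real (1 / sqrt ((Re (z r))\<^sup>2 + (Im (z r))\<^sup>2)))"
        unfolding H_def by (simp only: right_diff_distrib)
      also have "cmod \<dots> = (1 / cmod (cof Q)) * cmod (K r (1/2) - of_real (1 / sqrt ((Re (z r))\<^sup>2 + (Im (z r))\<^sup>2)))"
        by (simp only: norm_mult norm_of_real abs_divide abs_one abs_norm_cancel)
      also have "\<dots> \<le> (1 / cmod (cof Q)) * C" by (intro mult_left_mono K(3) r) simp
      finally show ?thesis by simp
    qed
    moreover have "hecke_L (hecke_char (cof q) \<phi>) (1/2) = (\<Sum>r\<in>Rset q. cval q \<phi> r * H r)"
      if \<phi>: "\<phi> \<in> characters (cof q)" "X \<in> carrier (gunits (cof q))" "\<phi> X \<noteq> 1" for \<phi> X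
    proof -
      define L where "L s = (\<Sum>r\<in>Rset q. cval q \<phi> r * (of_real N powr (- s) * K r s))" for s :: complex
      have "hecke_L (hecke_char (cof q) \<phi>) = L"
      proof (rule hecke_L_eqI)
        show "L holomorphic_on UNIV"
          unfolding L_def[abs_def] using N by (intro holomorphic_intros K(1)) auto
        fix s :: complex assume s: "Re s > 1"
        define S where "S r = cval q \<phi> r * (of_real N powr (- s) * (K r s + E s))" for r
        define B where "B r = {a. Q dvd a - r}" for r
        have "((\<lambda>a. cval q \<phi> a * of_int (gnm a) powr (- s)) has_sum S r) (B r)" if r: "r \<in> Rset q" for r
        proof -
          define g where "g b = r + Q * GInt (fst b) (snd b)" for b
          have inj: "inj g" using Q by (auto simp: g_def inj_def prod_eq_iff simp del: gint_simps)
          have B: "B r = g ` UNIV"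
          proof (intro equalityI subsetI)
            fix a assume "a \<in> B r"
            then obtain c where "a - r = Q * c" by (auto simp: B_def elim!: dvdE)
            then have "a = r + Q * c" by (metis add_diff_cancel_left' diff_add_cancel add.commute)
            then have "a = g (gre c, gim c)" by (simp add: g_def)
            then show "a \<in> g ` UNIV" by blast
          qed (auto simp: B_def g_def simp del: gint_simps)
          have val: "cval q \<phi> (g b) * of_int (gnm (g b)) powr (- s) =
             cval q \<phi> r * (of_real N powr (- s) * of_real (latsq (Re (z r)) (Im (z r)) b) powr (- s))" for b
          proof -
            have "q dvd Q * GInt (fst b) (snd b)" by (simp add: Q_def del: gint_simps)
            then have "cval q \<phi> (g b) = cval q \<phi> r" by (intro cval_cong q) (simp add: g_def del: gint_simps)
            moreover have "complex_of_int (gnm (g b)) = of_real N * of_real (latsq (Re (z r)) (Im (z r)) b)"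
            proof -
              have "cof (g b) = cof Q * (z r + cof (GInt (fst b) (snd b)))"
                using Q by (simp add: g_def z_def distrib_left)
              then have "(cmod (cof (g b)))\<^sup>2 = N * (cmod (z r + cof (GInt (fst b) (snd b))))\<^sup>2"
                by (simp only: norm_mult power_mult_distrib NQ)
              also have "(cmod (z r + cof (GInt (fst b) (snd b))))\<^sup>2 = latsq (Re (z r)) (Im (z r)) b"
                by (simp add: cmod_power2 add.commute)
              finally have "real_of_int (gnm (g b)) = N * latsq (Re (z r)) (Im (z r)) b" by (simp only: cmod_cof_power2)
              then show ?thesis by (metis of_real_mult of_real_of_int_eq)
            qed
            moreover have "(of_real N * complex_of_real (latsq (Re (z r)) (Im (z r)) b)) powr (- s) =
                of_real N powr (- s) * of_real (latsq (Re (z r)) (Im (z r)) b) powr (- s)"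
              using N by (intro powr_times_real) auto
            ultimately show ?thesis by simp
          qed
          have "((\<lambda>b. cval q \<phi> (g b) * of_int (gnm (g b)) powr (- s)) has_sum S r) UNIV"
            unfolding val S_def by (intro has_sum_cmult_right K(2) r s)
          then show ?thesis unfolding B using has_sum_reindex[OF inj, of "\<lambda>a. cval q \<phi> a * of_int (gnm a) powr (- s)" "S r"]
            by (simp add: o_def)
        qed
        moreover have "B r \<inter> B r' = {}" if "r \<in> Rset q" "r' \<in> Rset q" "r \<noteq> r'" for r r'
        proof (rule ccontr)
          assume "B r \<inter> B r' \<noteq> {}"
          then obtain a where "Q dvd a - r" "Q dvd a - r'" by (auto simp: B_def)
          then have "Q dvd (a - r') - (a - r)" by (blast intro: dvd_diff)
          then have "Q dvd r - r'" by (simp del: gint_simps)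
          then have "q dvd r - r'" unfolding Q_def by (rule dvd_mult_right)
          then show False using Rset_eqI[OF q(2)] that by blast
        qed
        ultimately have "((\<lambda>a. cval q \<phi> a * of_int (gnm a) powr (- s)) has_sum (\<Sum>r\<in>Rset q. S r)) (\<Union>r\<in>Rset q. B r)"
          by (intro sum_has_sum finite_Rset q) auto
        also have "(\<Union>r\<in>Rset q. B r) = {a. prim a}"
        proof (intro equalityI subsetI)
          fix a assume "a \<in> (\<Union>r\<in>Rset q. B r)"
          then obtain r where r: "prim r" "Q dvd a - r" by (auto simp: B_def Rset_def)
          then have "lam dvd (a - r) + (r - 1)" unfolding Q_def by (intro dvd_add) (auto dest: dvd_mult_left)
          then show "a \<in> {a. prim a}" by simp
        next
          fix a assume "a \<in> {a. prim a}"
          then have a: "lam dvd a - 1" by simp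
          define r where "r = a mod Q"
          have d: "Q dvd r - a" unfolding r_def by (rule dvd_mod_minus)
          then have "lam dvd (r - a) + (a - 1)" using a unfolding Q_def by (intro dvd_add) (auto dest: dvd_mult_left)
          then have "prim r" by simp
          then have "r \<in> Rset q" by (simp add: Rset_def r_def Q_def)
          moreover have "Q dvd a - r" using d by (metis dvd_minus_iff minus_diff_eq)
          ultimately show "a \<in> (\<Union>r\<in>Rset q. B r)" by (auto simp: B_def)
        qed
        \<comment> \<open>Every class carries the same \<open>E s\<close>, which therefore
          multiplies the complete character sum.\<close>
        also have "(\<Sum>r\<in>Rset q. S r) = L s + (of_real N powr (- s) * E s) * (\<Sum>r\<in>Rset q. cval q \<phi> r)"
          unfolding S_def L_def sum_distrib_left sum.distrib[symmetric]
          by (intro sum.cong refl) (simp add: algebra_simps)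
        also have "(\<Sum>r\<in>Rset q. cval q \<phi> r) = 0" by (rule sum_cval_eq_0[OF q \<phi>])
        finally have "((\<lambda>a. cval q \<phi> a * of_int (gnm a) powr (- s)) has_sum L s) {a. prim a}" by simp
        then show "L s = (\<Sum>\<^sub>\<infinity>I\<in>nonzero_ideals. hecke_char (cof q) \<phi> I * of_nat (ideal_norm I) powr (- s))"
          unfolding hecke_series by (rule infsumI[symmetric])
      qed
      moreover have "of_real N powr (- (1/2)) = complex_of_real (1 / cmod (cof Q))"
      proof -
        have "N powr (- (1/2)) = 1 / N powr (1/2)" by (rule powr_minus_divide)
        also have "N powr (1/2) = sqrt N" using N by (intro powr_half_sqrt) simp
        also have "sqrt N = cmod (cof Q)" by (simp add: NQ)
        finally have "N powr (- (1/2)) = 1 / cmod (cof Q)" .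
        moreover have "complex_of_real N powr of_real (- (1/2)) = of_real (N powr (- (1/2)))"
          using N by (intro powr_of_real) simp
        ultimately show ?thesis by simp
      qed
      ultimately show ?thesis by (simp add: L_def H_def)
    qed
    ultimately show ?thesis unfolding Q_def by blast
  qed
  then show ?thesis using C(1) by blast
qed

section \<open>Primitive characters\<close>

text \<open>For d dividing q this is the kernel of reduction from the units modulo q to the units
  modulo d.\<close>

definition ker :: "gint \<Rightarrow> gint \<Rightarrow> complex set set" where
  "ker q d = rcl q ` {a. coprime a q \<and> d dvd a - 1}"

context
  fixes q :: gint
  assumes q: "q \<noteq> 0"
begin

interpretation G: comm_group "gunits (cof q)" by (rule comm_group_gunits[OF q])

lemma ker_mem_iff:
  assumes "d dvd q" "coprime a q"
  shows "rcl q a \<in> ker q d \<longleftrightarrow> d dvd a - 1"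
proof
  assume "rcl q a \<in> ker q d"
  then obtain b where b: "rcl q a = rcl q b" "d dvd b - 1" by (auto simp: ker_def)
  then have "d dvd a - b" using assms(1) dvd_trans rcl_eq_iff by blast
  then have "d dvd (a - b) + (b - 1)" using b(2) by (rule dvd_add)
  then show "d dvd a - 1" by simp
qed (use assms in \<open>auto simp: ker_def\<close>)

lemma ker_subgroup:
  assumes "d dvd q"
  shows "subgroup (ker q d) (gunits (cof q))"
proof (rule G.subgroupI)
  show sub: "ker q d \<subseteq> carrier (gunits (cof q))" by (auto simp: ker_def carrier_gunits[OF q])
  have "rcl q 1 \<in> ker q d" by (auto simp: ker_def)
  then show "ker q d \<noteq> {}" by blast
  fix X assume X: "X \<in> ker q d"
  then obtain a where a: "X = rcl q a" "coprime a q" "d dvd a - 1" by (auto simp: ker_def)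
  have "inv\<^bsub>gunits (cof q)\<^esub> X \<in> carrier (gunits (cof q))" using X sub by blast
  then obtain b where b: "inv\<^bsub>gunits (cof q)\<^esub> X = rcl q b" "coprime b q" by (auto simp: carrier_gunits[OF q])
  have "X \<otimes>\<^bsub>gunits (cof q)\<^esub> rcl q b = \<one>\<^bsub>gunits (cof q)\<^esub>"
    using G.r_inv[of X] X sub unfolding b(1) by blast
  then have "rcl q (a * b) = rcl q 1" unfolding a(1) gunits_mult[OF q] gunits_one[OF q] .
  then have "d dvd a * b - 1" using assms dvd_trans rcl_eq_iff by blast
  then have "d dvd (a * b - 1) - b * (a - 1)" using a(3) by (blast intro: dvd_diff dvd_mult)
  then have "d dvd b - 1" by (simp add: algebra_simps)
  then show "inv\<^bsub>gunits (cof q)\<^esub> X \<in> ker q d" using b by (auto simp: ker_def)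
  fix Y assume "Y \<in> ker q d"
  then obtain c where c: "Y = rcl q c" "coprime c q" "d dvd c - 1" by (auto simp: ker_def)
  have "d dvd a * (c - 1) + (a - 1)" using a(3) c(3) by (blast intro: dvd_add dvd_mult)
  then have "d dvd a * c - 1" by (simp add: algebra_simps)
  moreover have "coprime (a * c) q" using a(2) c(2) by simp
  ultimately have "rcl q (a * c) \<in> ker q d" unfolding ker_def by blast
  then show "X \<otimes>\<^bsub>gunits (cof q)\<^esub> Y \<in> ker q d" unfolding a(1) c(1) gunits_mult[OF q] .
qed

lemma reduce_rcl:
  assumes "d dvd q"
  shows "gideal (cof d) <+>\<^bsub>gauss_int\<^esub> rcl q a = rcl d a"
proof -
  have "gideal (cof d) <+>\<^bsub>gauss_int\<^esub> rcl q a = cof ` {x + y | x y. d dvd x \<and> q dvd y - a}"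
    by (auto simp: set_add_def set_mult_def gideal_cof rcl_eq simp flip: cof_simps)
  also have "{x + y | x y. d dvd x \<and> q dvd y - a} = {z. d dvd z - a}"
  proof (intro equalityI subsetI)
    fix z assume "z \<in> {x + y | x y. d dvd x \<and> q dvd y - a}"
    then obtain x y where xy: "z = x + y" "d dvd x" "q dvd y - a" by blast
    then have "d dvd x + (y - a)" using assms by (blast intro: dvd_add dvd_trans)
    then show "z \<in> {z. d dvd z - a}" by (simp add: xy(1) algebra_simps)
  next
    fix z assume "z \<in> {z. d dvd z - a}"
    then have "z = (z - a) + a" "d dvd z - a" "q dvd a - a" by simp_all
    then show "z \<in> {x + y | x y. d dvd x \<and> q dvd y - a}" by blast
  qed
  finally show ?thesis by (simp add: rcl_eq)
qed

lemma factors_through_imp_trivial: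
  assumes d: "d dvd q" and f: "factors_through (cof q) (cof d) \<phi>" and X: "X \<in> ker q d"
  shows "\<phi> X = 1"
proof -
  have d0: "d \<noteq> 0" using d q by auto
  interpret Gd: comm_group "gunits (cof d)" by (rule comm_group_gunits[OF d0])
  obtain \<phi>' where f': "\<phi>' \<in> characters (cof d)"
    "\<And>X. X \<in> carrier (gunits (cof q)) \<Longrightarrow> \<phi> X = \<phi>' (gideal (cof d) <+>\<^bsub>gauss_int\<^esub> X)"
    using f by (auto simp: factors_through_def)
  obtain a where a: "X = rcl q a" "coprime a q" "d dvd a - 1" using X by (auto simp: ker_def)
  have "\<phi> X = \<phi>' (rcl d a)" using f'(2)[of X] a by (simp add: carrier_gunits[OF q] reduce_rcl[OF d])
  also have "rcl d a = \<one>\<^bsub>gunits (cof d)\<^esub>" using a by (simp add: gunits_one[OF d0] rcl_eq_iff)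
  also have "\<phi>' \<dots> = 1" using f'(1) Gd.char_one by (simp add: characters_eq_chars)
  finally show ?thesis .
qed

text \<open>Reduction from q to d is surjective on units. A single addition of d is enough: if p
  divides a, it cannot divide d, hence not a + d.\<close>

lemma coprime_lift:
  assumes p: "gprime p" "q = p * d" and a: "coprime a d"
  shows "\<exists>a'. coprime a' q \<and> d dvd a' - a"
proof (cases "p dvd a")
  case True
  have npd: "\<not> p dvd d"
  proof
    assume "p dvd d"
    then have "p dvd 1" using True a coprime_common_divisor by blast
    then show False using p not_prime_unit by blast
  qed
  have "\<not> p dvd a + d" using True npd by (simp add: dvd_add_right_iff)
  then have "coprime p (a + d)" using p prime_imp_coprime by blast
  moreover have "coprime (a + d) d"
  proof -
    obtain u v where "u * a + v * d = 1" using a unfolding coprime_bezout by blast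
    then have "u * (a + d) + (v - u) * d = 1" by (simp add: algebra_simps)
    then show ?thesis unfolding coprime_bezout by blast
  qed
  ultimately have "coprime (a + d) q" by (simp add: p(2) coprime_commute)
  then show ?thesis by (intro exI[of _ "a + d"]) simp
next
  case False
  then have "coprime p a" using p prime_imp_coprime by blast
  then have "coprime a q" using a by (simp add: p(2) coprime_commute)
  then show ?thesis by (intro exI[of _ a]) simp
qed

text \<open>A unit class modulo d is lifted by \<open>coprime_lift\<close>, and two lifts differ by
  an element of the kernel, where \<open>\<phi>\<close> is 1. The moduli d = q/p are those that the
  criterion for primitivity tests.\<close>

lemma trivial_imp_factors_through:
  assumes p: "gprime p" "q = p * d" and \<phi>: "\<phi> \<in> characters (cof q)" and triv: "\<And>X. X \<in> ker q d \<Longrightarrow> \<phi> X = 1"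
  shows "factors_through (cof q) (cof d) \<phi>"
proof -
  have d: "d dvd q" "d \<noteq> 0" using p q by auto
  note ch = \<phi>[unfolded characters_eq_chars]
  have wd: "\<phi> (rcl q a) = \<phi> (rcl q b)" if ab: "coprime a q" "coprime b q" "d dvd a - b" for a b
  proof -
    obtain c v where "c * b + v * q = 1" using ab(2) unfolding coprime_bezout by blast
    then have e: "c * b - 1 = q * (- v)" by (simp add: algebra_simps)
    then have cq: "q dvd c * b - 1" by simp
    then have "c * b + (v * q) = 1" using \<open>c * b + v * q = 1\<close> by simp
    then have "b * c + v * q = 1" by (simp add: mult.commute)
    then have cc: "coprime c q" unfolding coprime_bezout by blast
    have "d dvd c * (a - b) + (c * b - 1)" using ab(3) cq d dvd_trans by (blast intro: dvd_add dvd_mult)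
    then have "d dvd c * a - 1" by (simp add: algebra_simps)
    then have "rcl q (c * a) \<in> ker q d" using ab cc by (auto simp: ker_def)
    then have "\<phi> (rcl q (c * a)) = 1" by (rule triv)
    moreover have "\<phi> (rcl q (c * a) \<otimes>\<^bsub>gunits (cof q)\<^esub> rcl q b) = \<phi> (rcl q (c * a)) * \<phi> (rcl q b)"
      using ab cc by (intro char_mult[OF ch]) (auto simp: carrier_gunits[OF q])
    moreover have "rcl q (c * a) \<otimes>\<^bsub>gunits (cof q)\<^esub> rcl q b = rcl q a"
    proof -
      have "q dvd a * (c * b - 1)" using cq by simp
      then have "q dvd c * a * b - a" by (simp add: algebra_simps)
      then show ?thesis by (simp add: gunits_mult[OF q] rcl_eq_iff)
    qed
    ultimately show ?thesis by simp
  qed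
  define \<phi>' where "\<phi>' = restrict (\<lambda>X. \<phi> (rcl q (SOME a. coprime a q \<and> rcl d a = X))) (carrier (gunits (cof d)))"
  have val: "\<phi>' (rcl d a) = \<phi> (rcl q a)" if a: "coprime a q" for a
  proof -
    have "coprime a d" using a d(1) by (metis coprime_divisors dvd_refl)
    then have mem: "rcl d a \<in> carrier (gunits (cof d))" by (auto simp: carrier_gunits[OF d(2)])
    define b where "b = (SOME b. coprime b q \<and> rcl d b = rcl d a)"
    have b: "coprime b q \<and> rcl d b = rcl d a" unfolding b_def by (rule someI[of _ a]) (use a in simp)
    have "\<phi>' (rcl d a) = \<phi> (rcl q b)" using mem by (simp add: \<phi>'_def b_def)
    also have "\<dots> = \<phi> (rcl q a)" using b a by (intro wd) (auto simp: rcl_eq_iff)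
    finally show ?thesis .
  qed
  have rep: "\<exists>a. coprime a q \<and> X = rcl d a" if X: "X \<in> carrier (gunits (cof d))" for X
  proof -
    obtain a where a: "coprime a d" "X = rcl d a" using X by (auto simp: carrier_gunits[OF d(2)])
    obtain a' where "coprime a' q" "d dvd a' - a" using coprime_lift[OF p a(1)] by blast
    then show ?thesis using a(2) by (intro exI[of _ a']) (simp add: rcl_eq_iff[symmetric])
  qed
  have "\<phi>' \<in> hom (gunits (cof d)) circle_group"
  proof (rule homI)
    fix X assume "X \<in> carrier (gunits (cof d))"
    then obtain a where a: "coprime a q" "X = rcl d a" using rep by blast
    then show "\<phi>' X \<in> carrier circle_group"
      using char_norm[OF ch, of "rcl q a"] by (simp add: val carrier_gunits[OF q])
    fix Y assume "Y \<in> carrier (gunits (cof d))"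
    then obtain b where b: "coprime b q" "Y = rcl d b" using rep by blast
    have "\<phi>' (X \<otimes>\<^bsub>gunits (cof d)\<^esub> Y) = \<phi> (rcl q (a * b))"
      using a b by (simp add: gunits_mult[OF d(2)] val)
    also have "\<dots> = \<phi> (rcl q a) * \<phi> (rcl q b)"
      unfolding gunits_mult[OF q, symmetric] using a b by (intro char_mult[OF ch]) (auto simp: carrier_gunits[OF q])
    finally show "\<phi>' (X \<otimes>\<^bsub>gunits (cof d)\<^esub> Y) = \<phi>' X \<otimes>\<^bsub>circle_group\<^esub> \<phi>' Y"
      using a b by (simp add: val)
  qed
  moreover have "\<phi>' \<in> extensional (carrier (gunits (cof d)))" by (simp add: \<phi>'_def)
  moreover have "\<phi> X = \<phi>' (gideal (cof d) <+>\<^bsub>gauss_int\<^esub> X)" if "X \<in> carrier (gunits (cof q))" for X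
    using that by (auto simp: carrier_gunits[OF q] reduce_rcl[OF d(1)] val)
  ultimately show ?thesis unfolding factors_through_def characters_def by blast
qed

lemma divides_cof: "cof a divides\<^bsub>gauss_int\<^esub> cof b \<longleftrightarrow> a dvd b"
  by (auto simp: factor_def dvd_def simp flip: cof_simps)

text \<open>Only the maximal proper divisors q/p matter: every proper divisor d divides one of them,
  and the kernel for q/p lies inside the kernel for d. The conditions that remain are indexed by the
  prime factors, ready for inclusion-exclusion.\<close>

lemma primitive_char_iff:
  "primitive_char (cof q) \<phi> \<longleftrightarrow> \<phi> \<in> chars (gunits (cof q)) \<and>
     (\<forall>p\<in>prime_factors q. \<not> (\<forall>k\<in>ker q (q div p). \<phi> k = 1))"
proof
  assume prim: "primitive_char (cof q) \<phi>"
  have "\<not> (\<forall>k\<in>ker q (q div p). \<phi> k = 1)" if p: "p \<in> prime_factors q" for p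
  proof
    assume triv: "\<forall>k\<in>ker q (q div p). \<phi> k = 1"
    have pp: "gprime p" "q = p * (q div p)" using p by auto
    then have "factors_through (cof q) (cof (q div p)) \<phi>"
      using prim triv by (intro trivial_imp_factors_through) (auto simp: primitive_char_def)
    moreover have "q div p dvd q" using pp(2) by (metis dvd_triv_right)
    moreover have "\<not> q dvd q div p"
    proof
      assume "q dvd q div p"
      then have "p * (q div p) dvd 1 * (q div p)" using pp(2) by simp
      moreover have "q div p \<noteq> 0" using pp(2) q by auto
      ultimately have "p dvd 1" by (simp only: dvd_mult_cancel_right) simp
      then show False using pp(1) not_prime_unit by blast
    qed
    ultimately show False using prim unfolding primitive_char_def associated_def
      by (metis divides_cof gauss_int_simps(5) rangeI)
  qed
  then show "\<phi> \<in> chars (gunits (cof q)) \<and> (\<forall>p\<in>prime_factors q. \<not> (\<forall>k\<in>ker q (q div p). \<phi> k = 1))"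
    using prim by (simp add: primitive_char_def characters_eq_chars)
next
  assume h: "\<phi> \<in> chars (gunits (cof q)) \<and> (\<forall>p\<in>prime_factors q. \<not> (\<forall>k\<in>ker q (q div p). \<phi> k = 1))"
  have "\<not> factors_through (cof q) (cof d) \<phi>" if d: "d dvd q" "\<not> q dvd d" for d
  proof
    assume f: "factors_through (cof q) (cof d) \<phi>"
    obtain c where c: "q = d * c" using d by (elim dvdE)
    have "c \<noteq> 0" using c q by auto
    moreover have "\<not> c dvd 1" using c d(2) by (metis dvd_refl mult_dvd_mono mult.right_neutral)
    ultimately obtain p where p: "gprime p" "p dvd c" using prime_divisor_exists by blast
    then obtain e where e: "c = p * e" by (elim dvdE)
    have "p \<in> prime_factors q" using p c q by (simp add: in_prime_factors_iff)
    moreover have "q div p = d * e" using p(1) by (simp add: c e mult.left_commute[of d p])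
    moreover have "\<phi> k = 1" if "k \<in> ker q (d * e)" for k
    proof (rule factors_through_imp_trivial[OF d(1) f])
      show "k \<in> ker q d" using that unfolding ker_def by (auto dest: dvd_mult_left)
    qed
    ultimately show False using h by auto
  qed
  then show "primitive_char (cof q) \<phi>"
    using h unfolding primitive_char_def characters_eq_chars associated_def gauss_int_simps
    by (auto simp: divides_cof)
qed

text \<open>The elements 1 + (q/p)x with x modulo p are distinct modulo q and congruent to 1 modulo
  q/p. Such an element fails to be a unit only if p divides it, which happens for at most one
  x.\<close>

lemma card_ker_ge:
  assumes p: "p \<in> prime_factors q"
  shows "of_int (gnm p) - 1 \<le> real (card (ker q (q div p)))"
proof -
  define u where "u = q div p"
  have pp: "gprime p" "q = p * u" using p by (auto simp: u_def)
  have nz: "p \<noteq> 0" "u \<noteq> 0" using pp q by auto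
  define A where "A = {x\<in>res p. coprime (1 + u * x) q}"
  have bad: "p dvd 1 + u * x" if "\<not> coprime (1 + u * x) q" for x
  proof (rule ccontr)
    assume "\<not> p dvd 1 + u * x"
    then have "coprime p (1 + u * x)" using pp prime_imp_coprime by blast
    moreover have "1 * (1 + u * x) + (- x) * u = 1" by (simp add: algebra_simps)
    then have "coprime (1 + u * x) u" unfolding coprime_bezout by blast
    ultimately show False using that by (simp add: pp(2) coprime_commute)
  qed
  have "card (res p - A) \<le> 1"
  proof -
    have "x = y" if x: "x \<in> res p - A" and y: "y \<in> res p - A" for x y
    proof -
      have px: "p dvd 1 + u * x" "p dvd 1 + u * y" using x y bad by (auto simp: A_def)
      then have "p dvd (1 + u * x) - (1 + u * y)" by (rule dvd_diff)
      then have "p dvd u * (x - y)" by (simp add: algebra_simps)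
      moreover have "\<not> p dvd u"
      proof
        assume "p dvd u"
        then have "p dvd 1" using px(1) by (simp add: dvd_add_left_iff)
        then show False using pp(1) not_prime_unit by blast
      qed
      ultimately have "p dvd x - y" using pp(1) gprime_dvd_mult_iff by blast
      then show ?thesis using x y res_eqI by blast
    qed
    then show ?thesis using finite_res[OF nz(1)] by (subst One_nat_def, subst card_le_Suc0_iff_eq) auto
  qed
  moreover have "card (res p - A) = card (res p) - card A"
    using finite_res[OF nz(1)] by (intro card_Diff_subset) (auto simp: A_def)
  moreover have "card A \<le> card (ker q u)"
  proof (rule card_inj_on_le)
    show "inj_on (\<lambda>x. rcl q (1 + u * x)) A"
    proof (rule inj_onI)
      fix x y assume h: "x \<in> A" "y \<in> A" "rcl q (1 + u * x) = rcl q (1 + u * y)"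
      then have "q dvd u * (x - y)" by (simp add: rcl_eq_iff algebra_simps)
      then have "p dvd x - y" using nz by (simp add: pp(2) mult.commute[of p])
      then show "x = y" using h res_eqI by (auto simp: A_def)
    qed
    show "(\<lambda>x. rcl q (1 + u * x)) ` A \<subseteq> ker q u" by (auto simp: A_def ker_def)
    show "finite (ker q u)"
      using finite_gunits[OF q] by (rule finite_subset[rotated]) (auto simp: ker_def carrier_gunits[OF q])
  qed
  moreover have "card (res p) = nat (gnm p)" by (rule card_res[OF nz(1)])
  ultimately have "nat (gnm p) \<le> card (ker q u) + 1" by linarith
  then show ?thesis unfolding u_def by linarith
qed

text \<open>The moduli q/\<Prod>S and q/p have least common multiple q, since p is coprime to the
  product of S. This is the independence that \<open>subgroup_product\<close> requires.\<close>

lemma ker_inter: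
  assumes S: "S \<subseteq> prime_factors q" and p: "p \<in> prime_factors q - S"
  shows "ker q (q div \<Prod>S) \<inter> ker q (q div p) \<subseteq> {rcl q 1}"
proof
  fix X assume "X \<in> ker q (q div \<Prod>S) \<inter> ker q (q div p)"
  have finS: "finite S" using S finite_subset by blast
  have pp: "gprime p" "p dvd q" using p by auto
  have SP: "gprime r" if "r \<in> S" for r using S that by auto
  have cop: "coprime p (\<Prod>S)"
    using prime_dvd_prod_primes[OF finS SP pp(1)] p pp(1) prime_imp_coprime by blast
  then have "p * \<Prod>S dvd q" using pp(2) prod_primes_dvd[OF q S] by (intro divides_mult)
  then obtain w where w: "q = p * \<Prod>S * w" by (elim dvdE)
  have nz: "p \<noteq> 0" "\<Prod>S \<noteq> 0" "w \<noteq> 0" using w q by auto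
  have d1: "q div \<Prod>S = p * w" "q div p = \<Prod>S * w" using nz by (simp_all add: w mult.assoc mult.left_commute[of p])
  then have dd: "q div \<Prod>S dvd q" "q div p dvd q" unfolding d1 by (auto simp: w mult.assoc mult.left_commute)
  obtain a where a: "X = rcl q a" "coprime a q" using \<open>X \<in> _\<close> by (auto simp: ker_def)
  then have "p * w dvd a - 1" "\<Prod>S * w dvd a - 1"
    using \<open>X \<in> _\<close> ker_mem_iff[OF dd(1) a(2)] ker_mem_iff[OF dd(2) a(2)] unfolding d1 by auto
  moreover obtain t where t: "a - 1 = w * t" using calculation(1) by (metis dvd_mult_right dvdE)
  ultimately have "p dvd t" "\<Prod>S dvd t" using nz by (simp_all add: mult.commute[of _ w])
  then have "p * \<Prod>S dvd t" using cop by (intro divides_mult)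
  then have "q dvd a - 1" unfolding w t by (simp add: mult.commute[of _ w])
  then show "X \<in> {rcl q 1}" by (simp add: a rcl_eq_iff)
qed

end

lemma gnm_prime_factor_ge_3:
  assumes "p \<in> prime_factors q" "coprime q 2"
  shows "gnm p \<ge> 3"
proof -
  have p: "gprime p" "p dvd q" using assms by auto
  have "gnm p \<noteq> 1" using p(1) not_prime_unit gint_unit_iff by blast
  moreover have "gnm p \<noteq> 0" using p(1) not_prime_0 by auto
  moreover have "gnm p \<noteq> 2"
  proof
    assume "gnm p = 2"
    then have "p * gcnj p = 2" by (simp add: mult_gcnj)
    then have "p dvd 2" by (metis dvd_triv_left)
    then have "p dvd 1" using p(2) assms(2) coprime_common_divisor by blast
    then show False using p(1) not_prime_unit by blast
  qed
  ultimately show ?thesis using gnm_nonneg[of p] by linarith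
qed

lemma div_dvd_div_rev:
  assumes "x dvd y" "y dvd q" "q \<noteq> (0::gint)"
  shows "q div y dvd q div x"
proof -
  obtain c where c: "y = x * c" using assms(1) by (elim dvdE)
  obtain d where d: "q = y * d" using assms(2) by (elim dvdE)
  have "x \<noteq> 0" "y \<noteq> 0" using assms(3) c d by auto
  then have "q div y = d" "q div x = c * d" by (simp_all add: d) (simp add: c mult.assoc)
  then show ?thesis by simp
qed

lemma ker_mono: "d' dvd d \<Longrightarrow> ker q d \<subseteq> ker q d'"
  unfolding ker_def by (auto intro: dvd_trans)

section \<open>Sums over primitive characters\<close>

context
  fixes q :: gint
  assumes q: "q \<noteq> 0" "coprime q 2"
begin

interpretation G: comm_group "gunits (cof q)" by (rule comm_group_gunits[OF q(1)])

definition prim_sum :: "complex set \<Rightarrow> complex" where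
  "prim_sum X = (\<Sum>\<phi>\<in>{\<phi>. primitive_char (cof q) \<phi>}. \<phi> X)"

text \<open>The number of primitive characters, by \<open>prim_sum_one\<close>, in the product form
  that the Euler product estimates need.\<close>

definition prim_count :: real where
  "prim_count = real (card (carrier (gunits (cof q)))) * (\<Prod>p\<in>prime_factors q. 1 - 1 / real (card (ker q (q div p))))"

lemma finite_primitive: "finite {\<phi>. primitive_char (cof q) \<phi>}"
  by (rule finite_subset[OF _ G.finite_chars[OF finite_gunits[OF q(1)]]]) (auto simp: primitive_char_iff[OF q(1)])

lemma card_ker_pos:
  assumes "p \<in> prime_factors q"
  shows "real (card (ker q (q div p))) \<ge> 2" "real (card (ker q (q div p))) \<ge> of_int (gnm p) - 1"
proof -
  show *: "real (card (ker q (q div p))) \<ge> of_int (gnm p) - 1" by (rule card_ker_ge[OF q(1) assms])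
  have "real_of_int (gnm p) \<ge> 3" using gnm_prime_factor_ge_3[OF assms q(2)] by simp
  then show "real (card (ker q (q div p))) \<ge> 2" using * by linarith
qed

text \<open>Of the subgroups \<open>M S\<close> only two facts are recorded: they contain the
  identity and lie in a kernel. The first evaluates the sum exactly at the identity, the second
  bounds it elsewhere.\<close>

lemma prim_sum_formula:
  "\<exists>M. (\<forall>S\<in>Pow (prime_factors q). \<one>\<^bsub>gunits (cof q)\<^esub> \<in> M S \<and> M S \<subseteq> ker q (q div \<Prod>S)) \<and>
     (\<forall>X\<in>carrier (gunits (cof q)). prim_sum X = (\<Sum>S\<in>Pow (prime_factors q). (-1) ^ card S *
        (if X \<in> M S then of_nat (card (carrier (gunits (cof q)))) / of_nat (\<Prod>p\<in>S. card (ker q (q div p))) else 0)))"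
proof -
  define P where "P = prime_factors q"
  define K where "K = (\<lambda>p. ker q (q div p))"
  define C where "C = (\<lambda>S. ker q (q div \<Prod>S))"
  have finP: "finite P" by (simp add: P_def)
  note fin = finite_gunits[OF q(1)]
  have dv: "\<Prod>S dvd q" if "S \<subseteq> P" for S using prod_primes_dvd[OF q(1)] that by (simp add: P_def)
  have dq: "q div x dvd q" if "x dvd q" for x
    using that by (metis dvd_div_mult_self dvd_triv_left)
  have sub: "\<exists>M. subgroup M (gunits (cof q)) \<and> M \<subseteq> C S \<and> card M = (\<Prod>p\<in>S. card (K p)) \<and>
     (\<forall>\<phi>\<in>chars (gunits (cof q)). (\<forall>k\<in>M. \<phi> k = 1) \<longleftrightarrow> (\<forall>p\<in>S. \<forall>k\<in>K p. \<phi> k = 1))" if S: "S \<subseteq> P" for S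
  proof (rule G.subgroup_product[OF fin finP _ _ _ _ _ S])
    show "subgroup (K p) (gunits (cof q))" if "p \<in> P" for p
      unfolding K_def using that by (intro ker_subgroup[OF q(1)] dq) (auto simp: P_def)
    show "subgroup (C S) (gunits (cof q))" if "S \<subseteq> P" for S
      unfolding C_def using that by (intro ker_subgroup[OF q(1)] dq dv)
    show "C S \<subseteq> C T" if "S \<subseteq> T" "T \<subseteq> P" for S T
    proof -
      have "finite T" using that finP finite_subset by blast
      then have "\<Prod>S dvd \<Prod>T" using that by (intro prod_dvd_prod_subset) auto
      then show ?thesis unfolding C_def using that by (intro ker_mono div_dvd_div_rev dv q(1))
    qed
    show "K p \<subseteq> C S" if "S \<subseteq> P" "p \<in> S" for p S
    proof -
      have "finite S" using that finP finite_subset by blast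
      then have "p dvd \<Prod>S" using that dvd_prodI[of S p "\<lambda>x. x"] by simp
      then show ?thesis unfolding C_def K_def using that by (intro ker_mono div_dvd_div_rev dv q(1))
    qed
    show "C S \<inter> K p \<subseteq> {\<one>\<^bsub>gunits (cof q)\<^esub>}" if "S \<subseteq> P" "p \<in> P - S" for p S
      unfolding C_def K_def gunits_one[OF q(1)] using that by (intro ker_inter[OF q(1)]) (auto simp: P_def)
  qed
  have "\<exists>M. \<forall>S\<in>Pow P. subgroup (M S) (gunits (cof q)) \<and> M S \<subseteq> C S \<and> card (M S) = (\<Prod>p\<in>S. card (K p)) \<and>
     (\<forall>\<phi>\<in>chars (gunits (cof q)). (\<forall>k\<in>M S. \<phi> k = 1) \<longleftrightarrow> (\<forall>p\<in>S. \<forall>k\<in>K p. \<phi> k = 1))"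
    by (rule bchoice) (use sub in blast)
  then obtain M where M: "\<forall>S\<in>Pow P. subgroup (M S) (gunits (cof q)) \<and> M S \<subseteq> C S \<and> card (M S) = (\<Prod>p\<in>S. card (K p)) \<and>
     (\<forall>\<phi>\<in>chars (gunits (cof q)). (\<forall>k\<in>M S. \<phi> k = 1) \<longleftrightarrow> (\<forall>p\<in>S. \<forall>k\<in>K p. \<phi> k = 1))" by (rule exE)
  have "prim_sum X = (\<Sum>S\<in>Pow P. (-1) ^ card S * (if X \<in> M S then of_nat (card (carrier (gunits (cof q)))) / of_nat (\<Prod>p\<in>S. card (K p)) else 0))"
    if X: "X \<in> carrier (gunits (cof q))" for X
  proof -
    have "{\<phi>. primitive_char (cof q) \<phi>} = {\<phi>\<in>chars (gunits (cof q)). \<forall>p\<in>P. \<not> (\<forall>k\<in>K p. \<phi> k = 1)}"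
      unfolding primitive_char_iff[OF q(1)] P_def K_def by blast
    then have "prim_sum X = (\<Sum>S\<in>Pow P. (-1) ^ card S * (\<Sum>\<phi>\<in>{\<phi>\<in>chars (gunits (cof q)). \<forall>p\<in>S. \<forall>k\<in>K p. \<phi> k = 1}. \<phi> X))"
      unfolding prim_sum_def using G.sum_chars_avoiding[OF fin finP, where K = K and x = X] by simp
    also have "\<dots> = (\<Sum>S\<in>Pow P. (-1) ^ card S * (if X \<in> M S then of_nat (card (carrier (gunits (cof q)))) / of_nat (\<Prod>p\<in>S. card (K p)) else 0))"
    proof (intro sum.cong refl)
      fix S assume S: "S \<in> Pow P"
      have "{\<phi>\<in>chars (gunits (cof q)). \<forall>p\<in>S. \<forall>k\<in>K p. \<phi> k = 1} = {\<phi>\<in>chars (gunits (cof q)). \<forall>k\<in>M S. \<phi> k = 1}"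
        using M S by blast
      moreover have "subgroup (M S) (gunits (cof q))" "card (M S) = (\<Prod>p\<in>S. card (K p))" using M S by blast+
      ultimately show "(-1) ^ card S * (\<Sum>\<phi>\<in>{\<phi>\<in>chars (gunits (cof q)). \<forall>p\<in>S. \<forall>k\<in>K p. \<phi> k = 1}. \<phi> X) =
        (-1) ^ card S * (if X \<in> M S then of_nat (card (carrier (gunits (cof q)))) / of_nat (\<Prod>p\<in>S. card (K p)) else 0)"
        using G.sum_chars_trivial_on[OF fin _ X, of "M S"] by simp
    qed
    finally show ?thesis .
  qed
  moreover have "\<one>\<^bsub>gunits (cof q)\<^esub> \<in> M S \<and> M S \<subseteq> ker q (q div \<Prod>S)" if "S \<in> Pow P" for S
  proof -
    have "subgroup (M S) (gunits (cof q))" "M S \<subseteq> C S" using M that by blast+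
    then show ?thesis using subgroup.one_closed unfolding C_def by blast
  qed
  ultimately show ?thesis unfolding P_def[symmetric] K_def by (intro exI[of _ M]) blast
qed

lemma prim_sum_one: "prim_sum (rcl q 1) = of_real prim_count"
proof -
  obtain M where M: "\<forall>S\<in>Pow (prime_factors q). \<one>\<^bsub>gunits (cof q)\<^esub> \<in> M S \<and> M S \<subseteq> ker q (q div \<Prod>S)"
    "\<forall>X\<in>carrier (gunits (cof q)). prim_sum X = (\<Sum>S\<in>Pow (prime_factors q). (-1) ^ card S *
        (if X \<in> M S then of_nat (card (carrier (gunits (cof q)))) / of_nat (\<Prod>p\<in>S. card (ker q (q div p))) else 0))"
    using prim_sum_formula by blast
  define g where "g = real (card (carrier (gunits (cof q))))"
  have "prim_sum (\<one>\<^bsub>gunits (cof q)\<^esub>) = (\<Sum>S\<in>Pow (prime_factors q). (-1) ^ card S *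
        (if \<one>\<^bsub>gunits (cof q)\<^esub> \<in> M S then of_nat (card (carrier (gunits (cof q)))) / of_nat (\<Prod>p\<in>S. card (ker q (q div p))) else 0))"
    using M(2) G.one_closed by blast
  also have "\<dots> = (\<Sum>S\<in>Pow (prime_factors q). of_real (g * ((-1) ^ card S * (\<Prod>p\<in>S. 1 / real (card (ker q (q div p)))))))"
    using M(1) by (intro sum.cong refl) (auto simp: g_def prod_dividef)
  also have "\<dots> = of_real (g * (\<Sum>S\<in>Pow (prime_factors q). (-1) ^ card S * (\<Prod>p\<in>S. 1 / real (card (ker q (q div p))))))"
    by (simp only: of_real_sum sum_distrib_left)
  also have "(\<Sum>S\<in>Pow (prime_factors q). (-1) ^ card S * (\<Prod>p\<in>S. 1 / real (card (ker q (q div p))))) =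
      (\<Prod>p\<in>prime_factors q. 1 - 1 / real (card (ker q (q div p))))"
    using prod_diff_conv_sum[of "prime_factors q" "\<lambda>_. 1" "\<lambda>p. 1 / real (card (ker q (q div p)))"] by simp
  finally show ?thesis by (simp add: g_def prim_count_def gunits_one[OF q(1)])
qed

lemma real_gnm_prime_factor_ge_3: "p \<in> prime_factors q \<Longrightarrow> real_of_int (gnm p) \<ge> 3"
  using gnm_prime_factor_ge_3[OF _ q(2)] by (metis of_int_le_iff of_int_numeral)

lemma card_gunits_eq:
  "real (card (carrier (gunits (cof q)))) = of_int (gnm q) * (\<Prod>p\<in>prime_factors q. 1 - 1 / of_int (gnm p))"
  by (simp add: card_gunits[OF q(1)] card_res_coprime[OF q(1)])

text \<open>Each kernel has at least N(p) - 1 = N(p)(1 - 1/N(p)) elements, which cancels the Euler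
  factors of the group order at the primes of S; the factors outside S are at most 1.\<close>

lemma index_le:
  assumes S: "S \<subseteq> prime_factors q"
  shows "real (card (carrier (gunits (cof q)))) / real (\<Prod>p\<in>S. card (ker q (q div p))) \<le> of_int (gnm (q div \<Prod>S))"
proof -
  define n where "n p = real_of_int (gnm p)" for p
  have n: "n p \<ge> 3" if "p \<in> prime_factors q" for p using real_gnm_prime_factor_ge_3 that by (simp add: n_def)
  have x: "0 \<le> 1 - 1 / n p" "1 - 1 / n p \<le> 1" if "p \<in> prime_factors q" for p using n[OF that] by auto
  have finS: "finite S" using S finite_subset by blast
  have "q = \<Prod>S * (q div \<Prod>S)" using prod_primes_dvd[OF q(1) S] by simp
  then have "gnm q = gnm (\<Prod>S) * gnm (q div \<Prod>S)" using gnm_mult by metis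
  then have Nq: "real_of_int (gnm q) = (\<Prod>p\<in>S. n p) * of_int (gnm (q div \<Prod>S))"
    by (simp add: gnm_prod[of id, simplified] n_def)
  have "(\<Prod>p\<in>prime_factors q. 1 - 1 / n p) = (\<Prod>p\<in>prime_factors q - S. 1 - 1 / n p) * (\<Prod>p\<in>S. 1 - 1 / n p)"
    using S by (intro prod.subset_diff) auto
  also have "\<dots> \<le> 1 * (\<Prod>p\<in>S. 1 - 1 / n p)"
    using x S by (intro mult_right_mono prod_le_1 prod_nonneg) auto
  finally have "real (card (carrier (gunits (cof q)))) \<le> of_int (gnm q) * (\<Prod>p\<in>S. 1 - 1 / n p)"
    unfolding card_gunits_eq n_def[symmetric] by (intro mult_left_mono) (auto simp: n_def)
  also have "\<dots> = of_int (gnm (q div \<Prod>S)) * (\<Prod>p\<in>S. n p * (1 - 1 / n p))" by (simp add: Nq prod.distrib)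
  also have "\<dots> \<le> of_int (gnm (q div \<Prod>S)) * (\<Prod>p\<in>S. real (card (ker q (q div p))))"
  proof (intro mult_left_mono prod_mono conjI)
    fix p assume "p \<in> S"
    then have p: "p \<in> prime_factors q" using S by blast
    have e: "n p * (1 - 1 / n p) = n p - 1" using n[OF p] by (simp add: field_simps)
    show "0 \<le> n p * (1 - 1 / n p)" unfolding e using n[OF p] by simp
    show "n p * (1 - 1 / n p) \<le> real (card (ker q (q div p)))" unfolding e using card_ker_pos(2)[OF p] by (simp add: n_def)
  qed auto
  finally have "real (card (carrier (gunits (cof q)))) \<le> of_int (gnm (q div \<Prod>S)) * real (\<Prod>p\<in>S. card (ker q (q div p)))" by simp
  moreover have "real (\<Prod>p\<in>S. card (ker q (q div p))) > 0"
    unfolding of_nat_prod using card_ker_pos(1) S by (intro prod_pos) force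
  ultimately show ?thesis by (simp add: pos_divide_le_eq)
qed

text \<open>The set S contributes only when a is congruent to 1 modulo d = q/\<Prod>S, and then with
  weight at most N(d). In sums over a this weight is balanced by the sparseness of the progression
  modulo d, as \<open>sum_progression\<close> shows.\<close>

lemma prim_sum_bound:
  assumes a: "coprime a q"
  shows "cmod (prim_sum (rcl q a)) \<le> (\<Sum>S\<in>Pow (prime_factors q). if q div \<Prod>S dvd a - 1 then of_int (gnm (q div \<Prod>S)) else 0)"
proof -
  obtain M where M: "\<forall>S\<in>Pow (prime_factors q). \<one>\<^bsub>gunits (cof q)\<^esub> \<in> M S \<and> M S \<subseteq> ker q (q div \<Prod>S)"
    "\<forall>X\<in>carrier (gunits (cof q)). prim_sum X = (\<Sum>S\<in>Pow (prime_factors q). (-1) ^ card S *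
        (if X \<in> M S then of_nat (card (carrier (gunits (cof q)))) / of_nat (\<Prod>p\<in>S. card (ker q (q div p))) else 0))"
    using prim_sum_formula by blast
  have mem: "rcl q a \<in> carrier (gunits (cof q))" using a by (auto simp: carrier_gunits[OF q(1)])
  define t where "t S = (-1) ^ card S *
        (if rcl q a \<in> M S then of_nat (card (carrier (gunits (cof q)))) / of_nat (\<Prod>p\<in>S. card (ker q (q div p))) else (0::complex))" for S
  have "prim_sum (rcl q a) = (\<Sum>S\<in>Pow (prime_factors q). t S)" using M(2) mem unfolding t_def by blast
  also have "cmod \<dots> \<le> (\<Sum>S\<in>Pow (prime_factors q). cmod (t S))" by (rule norm_sum)
  also have "\<dots> \<le> (\<Sum>S\<in>Pow (prime_factors q). if q div \<Prod>S dvd a - 1 then of_int (gnm (q div \<Prod>S)) else 0)"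
  proof (rule sum_mono)
    fix S assume S: "S \<in> Pow (prime_factors q)"
    then have S': "S \<subseteq> prime_factors q" by simp
    show "cmod (t S) \<le> (if q div \<Prod>S dvd a - 1 then of_int (gnm (q div \<Prod>S)) else 0)"
    proof (cases "rcl q a \<in> M S")
      case True
      then have "rcl q a \<in> ker q (q div \<Prod>S)" using M(1) S by blast
      moreover have "q div \<Prod>S dvd q" using prod_primes_dvd[OF q(1) S'] by (metis dvd_div_mult_self dvd_triv_left)
      ultimately have "q div \<Prod>S dvd a - 1" using ker_mem_iff[OF q(1)] a by blast
      moreover have "cmod (t S) = real (card (carrier (gunits (cof q)))) / real (\<Prod>p\<in>S. card (ker q (q div p)))"
        using True by (simp only: t_def norm_mult norm_power norm_divide norm_of_nat norm_minus_cancel norm_one power_one mult_1_left if_True)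
      ultimately show ?thesis using index_le[OF S'] by simp
    qed (simp add: t_def)
  qed
  finally show ?thesis .
qed

text \<open>In the worst case the kernel has n - 1 elements, where n = N(p), and (1 - 1/n)(1 - 1/(n
  - 1)) = 1 - 2/n. This form feeds the comparison with the error of the first moment.\<close>

lemma prim_count_ge_product: "prim_count \<ge> of_int (gnm q) * (\<Prod>p\<in>prime_factors q. 1 - 2 / of_int (gnm p))"
proof -
  have "(\<Prod>p\<in>prime_factors q. 1 - 2 / real_of_int (gnm p)) \<le>
     (\<Prod>p\<in>prime_factors q. (1 - 1 / of_int (gnm p)) * (1 - 1 / real (card (ker q (q div p)))))"
  proof (intro prod_mono conjI)
    fix p assume p: "p \<in> prime_factors q"
    define n where "n = real_of_int (gnm p)"
    have n: "n \<ge> 3" using real_gnm_prime_factor_ge_3[OF p] by (simp add: n_def)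
    have k: "real (card (ker q (q div p))) \<ge> n - 1" using card_ker_pos(2)[OF p] by (simp add: n_def)
    have "2 / n \<le> 2 / 3" using n by (intro divide_left_mono) auto
    then show "0 \<le> 1 - 2 / real_of_int (gnm p)" by (simp add: n_def)
    have "1 / real (card (ker q (q div p))) \<le> 1 / (n - 1)" using n k by (intro divide_left_mono mult_pos_pos) auto
    then have "(1 - 1 / n) * (1 - 1 / (n - 1)) \<le> (1 - 1 / n) * (1 - 1 / real (card (ker q (q div p))))"
      using n by (intro mult_left_mono) auto
    moreover have "(1 - 1 / n) * (1 - 1 / (n - 1)) = 1 - 2 / n" using n by (simp add: field_simps)
    ultimately show "1 - 2 / real_of_int (gnm p) \<le> (1 - 1 / of_int (gnm p)) * (1 - 1 / real (card (ker q (q div p))))"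
      by (simp add: n_def)
  qed
  then have "of_int (gnm q) * (\<Prod>p\<in>prime_factors q. 1 - 2 / real_of_int (gnm p)) \<le>
     of_int (gnm q) * (\<Prod>p\<in>prime_factors q. (1 - 1 / of_int (gnm p)) * (1 - 1 / real (card (ker q (q div p)))))"
    by (intro mult_left_mono) auto
  then show ?thesis unfolding prim_count_def card_gunits_eq by (simp only: prod.distrib mult.assoc)
qed

text \<open>Passing from primitive to all characters costs at most the product of 1 + 1/N(p), which
  the coprimality condition in the second moment gives back. With n = N(p), the local identity is (1
  - 1/(n - 1))(1 + 1/n) = 1 - 2/(n(n - 1)), the factor of
  \<open>euler_product_lower\<close>.\<close>

lemma prim_count_ge_index:
  "prim_count * (\<Prod>p\<in>prime_factors q. 1 + 1 / of_int (gnm p)) \<ge> exp (- 144) * real (card (carrier (gunits (cof q))))"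
proof -
  define g where "g = real (card (carrier (gunits (cof q))))"
  have "exp (- 144 :: real) \<le> (\<Prod>p\<in>prime_factors q. 1 - 2 / (of_int (gnm p) * (of_int (gnm p) - 1)))"
  proof (rule euler_product_lower)
    show "0 \<notin> prime_factors q" by (metis in_prime_factors_iff not_prime_0)
    show "\<And>p. p \<in> prime_factors q \<Longrightarrow> gnm p \<ge> 3" using gnm_prime_factor_ge_3 q(2) by blast
  qed simp
  also have "\<dots> \<le> (\<Prod>p\<in>prime_factors q. (1 - 1 / real (card (ker q (q div p)))) * (1 + 1 / of_int (gnm p)))"
  proof (intro prod_mono conjI)
    fix p assume p: "p \<in> prime_factors q"
    define n where "n = real_of_int (gnm p)"
    have n: "n \<ge> 3" using real_gnm_prime_factor_ge_3[OF p] by (simp add: n_def)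
    have k: "real (card (ker q (q div p))) \<ge> n - 1" using card_ker_pos(2)[OF p] by (simp add: n_def)
    have "3 * 2 \<le> n * (n - 1)" using n by (intro mult_mono) auto
    then have "2 / (n * (n - 1)) \<le> 2 / 6" by (intro divide_left_mono) auto
    then show "0 \<le> 1 - 2 / (real_of_int (gnm p) * (real_of_int (gnm p) - 1))" by (simp add: n_def)
    have "1 / real (card (ker q (q div p))) \<le> 1 / (n - 1)" using n k by (intro divide_left_mono mult_pos_pos) auto
    then have "(1 - 1 / (n - 1)) * (1 + 1 / n) \<le> (1 - 1 / real (card (ker q (q div p)))) * (1 + 1 / n)"
      using n by (intro mult_right_mono) auto
    moreover have "(1 - 1 / (n - 1)) * (1 + 1 / n) = 1 - 2 / (n * (n - 1))" using n by (simp add: field_simps)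
    ultimately show "1 - 2 / (real_of_int (gnm p) * (real_of_int (gnm p) - 1)) \<le> (1 - 1 / real (card (ker q (q div p)))) * (1 + 1 / of_int (gnm p))"
      by (simp add: n_def)
  qed
  finally have "exp (- 144) * g \<le> (\<Prod>p\<in>prime_factors q. (1 - 1 / real (card (ker q (q div p)))) * (1 + 1 / of_int (gnm p))) * g"
    by (intro mult_right_mono) (auto simp: g_def)
  then show ?thesis unfolding prim_count_def g_def[symmetric] by (simp add: prod.distrib mult_ac)
qed

lemma rcl_neg_mem: "rcl q (- 1) \<in> carrier (gunits (cof q))"
  by (auto simp: carrier_gunits[OF q(1)])

lemma residue_class_neg: "residue_class (cof q) (- 1) = rcl q (- 1)"
  by (simp add: rcl_def)

text \<open>A character takes the value 1 or -1 at -1, so half the difference of its values at a and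
  -a is its value at a for odd characters and 0 for even ones.\<close>

lemma sum_odd_primitive:
  assumes a: "coprime a q"
  shows "(\<Sum>\<phi>\<in>odd_primitive_chars (cof q). \<phi> (rcl q a)) = (prim_sum (rcl q a) - prim_sum (rcl q (- a))) / 2"
proof -
  define A where "A = {\<phi>. primitive_char (cof q) \<phi>}"
  have fin: "finite A" unfolding A_def by (rule finite_primitive)
  have ch: "\<phi> \<in> chars (gunits (cof q))" if "\<phi> \<in> A" for \<phi> using that by (simp add: A_def primitive_char_iff[OF q(1)])
  have mem: "rcl q a \<in> carrier (gunits (cof q))" using a by (auto simp: carrier_gunits[OF q(1)])
  have neg: "\<phi> (rcl q (- a)) = \<phi> (rcl q (- 1)) * \<phi> (rcl q a)" if "\<phi> \<in> A" for \<phi>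
    using char_mult[OF ch[OF that] rcl_neg_mem mem] by (simp add: gunits_mult[OF q(1)])
  have sq: "\<phi> (rcl q (- 1)) = 1 \<or> \<phi> (rcl q (- 1)) = - 1" if "\<phi> \<in> A" for \<phi>
  proof -
    have "\<phi> (rcl q (- 1)) * \<phi> (rcl q (- 1)) = \<phi> (rcl q 1)"
      using char_mult[OF ch[OF that] rcl_neg_mem rcl_neg_mem] by (simp add: gunits_mult[OF q(1)])
    also have "\<dots> = 1" using G.char_one[OF ch[OF that]] by (simp add: gunits_one[OF q(1)])
    finally show ?thesis by (simp add: square_eq_1_iff)
  qed
  have "odd_primitive_chars (cof q) = {\<phi>\<in>A. \<phi> (rcl q (- 1)) = - 1}"
    by (auto simp: odd_primitive_chars_def A_def residue_class_neg)
  then have "(\<Sum>\<phi>\<in>odd_primitive_chars (cof q). \<phi> (rcl q a)) = (\<Sum>\<phi>\<in>A. if \<phi> (rcl q (- 1)) = - 1 then \<phi> (rcl q a) else 0)"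
    using sum.inter_filter[OF fin] by simp
  also have "\<dots> = (\<Sum>\<phi>\<in>A. (\<phi> (rcl q a) - \<phi> (rcl q (- a))) / 2)"
    using sq by (intro sum.cong refl) (force simp: neg)
  also have "\<dots> = (prim_sum (rcl q a) - prim_sum (rcl q (- a))) / 2"
    by (simp add: prim_sum_def A_def sum_divide_distrib[symmetric] sum_subtractf)
  finally show ?thesis .
qed

text \<open>Conjugating a character value amounts to inverting the argument; after expanding the
  square, orthogonality leaves only the diagonal.\<close>

lemma char_parseval:
  fixes h :: "complex set \<Rightarrow> complex"
  shows "(\<Sum>\<phi>\<in>chars (gunits (cof q)). (cmod (\<Sum>X\<in>carrier (gunits (cof q)). \<phi> X * h X))\<^sup>2) =
     real (card (carrier (gunits (cof q)))) * (\<Sum>X\<in>carrier (gunits (cof q)). (cmod (h X))\<^sup>2)"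
proof -
  define A where "A = carrier (gunits (cof q))"
  define Ch where "Ch = chars (gunits (cof q))"
  have fin: "finite A" unfolding A_def by (rule finite_gunits[OF q(1)])
  have cnj: "cnj (\<phi> Y) = \<phi> (inv\<^bsub>gunits (cof q)\<^esub> Y)" if "\<phi> \<in> Ch" "Y \<in> A" for \<phi> Y
  proof -
    have "\<phi> (Y \<otimes>\<^bsub>gunits (cof q)\<^esub> inv\<^bsub>gunits (cof q)\<^esub> Y) = \<phi> Y * \<phi> (inv\<^bsub>gunits (cof q)\<^esub> Y)"
      using that unfolding A_def Ch_def by (intro char_mult) auto
    moreover have "\<phi> \<one>\<^bsub>gunits (cof q)\<^esub> = 1" using that(1) unfolding Ch_def by (rule G.char_one)
    moreover have "Y \<otimes>\<^bsub>gunits (cof q)\<^esub> inv\<^bsub>gunits (cof q)\<^esub> Y = \<one>\<^bsub>gunits (cof q)\<^esub>"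
      using that(2) unfolding A_def by (rule G.r_inv)
    ultimately have "\<phi> Y * \<phi> (inv\<^bsub>gunits (cof q)\<^esub> Y) = 1" by simp
    moreover have "\<phi> Y * cnj (\<phi> Y) = 1" 
    proof -
      have "cmod (\<phi> Y) = 1" using that unfolding A_def Ch_def by (rule char_norm)
      then show ?thesis using complex_norm_square[of "\<phi> Y"] by simp
    qed
    ultimately show ?thesis by (metis mult_cancel_left mult_zero_left zero_neq_one)
  qed
  have orth: "(\<Sum>\<phi>\<in>Ch. \<phi> X * cnj (\<phi> Y)) = (if X = Y then of_nat (card A) else 0)" if "X \<in> A" "Y \<in> A" for X Y
  proof -
    have "(\<Sum>\<phi>\<in>Ch. \<phi> X * cnj (\<phi> Y)) = (\<Sum>\<phi>\<in>Ch. \<phi> (X \<otimes>\<^bsub>gunits (cof q)\<^esub> inv\<^bsub>gunits (cof q)\<^esub> Y))"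
      using that by (intro sum.cong refl) (simp add: cnj char_mult Ch_def A_def)
    also have "\<dots> = (if X \<otimes>\<^bsub>gunits (cof q)\<^esub> inv\<^bsub>gunits (cof q)\<^esub> Y = \<one>\<^bsub>gunits (cof q)\<^esub> then of_nat (card A) else 0)"
      unfolding Ch_def A_def using that by (intro G.sum_chars[OF finite_gunits[OF q(1)]]) (auto simp: A_def)
    also have "X \<otimes>\<^bsub>gunits (cof q)\<^esub> inv\<^bsub>gunits (cof q)\<^esub> Y = \<one>\<^bsub>gunits (cof q)\<^esub> \<longleftrightarrow> X = Y"
    proof
      assume "X \<otimes>\<^bsub>gunits (cof q)\<^esub> inv\<^bsub>gunits (cof q)\<^esub> Y = \<one>\<^bsub>gunits (cof q)\<^esub>"
      then have "inv\<^bsub>gunits (cof q)\<^esub> (inv\<^bsub>gunits (cof q)\<^esub> Y) = X" using that unfolding A_def by (intro G.inv_equality) auto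
      then show "X = Y" using that unfolding A_def by simp
    qed (use that in \<open>auto simp: A_def\<close>)
    finally show ?thesis .
  qed
  have "complex_of_real (\<Sum>\<phi>\<in>Ch. (cmod (\<Sum>X\<in>A. \<phi> X * h X))\<^sup>2) =
      (\<Sum>\<phi>\<in>Ch. (\<Sum>X\<in>A. \<phi> X * h X) * cnj (\<Sum>Y\<in>A. \<phi> Y * h Y))"
    by (simp only: of_real_sum complex_norm_square)
  also have "\<dots> = (\<Sum>\<phi>\<in>Ch. \<Sum>X\<in>A. \<Sum>Y\<in>A. (h X * cnj (h Y)) * (\<phi> X * cnj (\<phi> Y)))"
    by (simp add: sum_product mult_ac)
  also have "\<dots> = (\<Sum>X\<in>A. \<Sum>\<phi>\<in>Ch. \<Sum>Y\<in>A. (h X * cnj (h Y)) * (\<phi> X * cnj (\<phi> Y)))" by (rule sum.swap)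
  also have "\<dots> = (\<Sum>X\<in>A. \<Sum>Y\<in>A. \<Sum>\<phi>\<in>Ch. (h X * cnj (h Y)) * (\<phi> X * cnj (\<phi> Y)))" by (intro sum.cong refl sum.swap)
  also have "\<dots> = (\<Sum>X\<in>A. \<Sum>Y\<in>A. (h X * cnj (h Y)) * (if X = Y then of_nat (card A) else 0))"
    unfolding sum_distrib_left[symmetric] by (intro sum.cong refl) (simp add: orth)
  also have "\<dots> = (\<Sum>X\<in>A. (h X * cnj (h X)) * of_nat (card A))"
    using fin by (intro sum.cong refl) (simp add: if_distrib[of "\<lambda>x. _ * x"] sum.delta cong: if_cong)
  also have "\<dots> = complex_of_real (real (card A) * (\<Sum>X\<in>A. (cmod (h X))\<^sup>2))"
    by (simp only: of_real_mult of_real_sum complex_norm_square of_real_of_nat_eq sum_distrib_left mult_ac)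
  finally show ?thesis unfolding A_def Ch_def by (simp only: of_real_eq_iff)
qed

end

section \<open>The two moments\<close>

text \<open>This places the main term of the first moment among the residues. With n = N(Q) \<ge> 8,
  a coordinate t of Q satisfies t^2 \<le> n and so 2|t| < n, which means that 1/Q rounds to
  0.\<close>

lemma one_mem_Rset: "q \<noteq> 0 \<Longrightarrow> 1 \<in> Rset q"
proof -
  assume q: "q \<noteq> 0"
  define Q where "Q = lam * q"
  have Q: "Q \<noteq> 0" using q by (simp add: Q_def)
  define n where "n = gnm Q"
  have "1 \<le> gnm q" using q by (simp add: int_one_le_iff_zero_less)
  then have n: "n \<ge> 8" by (simp add: n_def Q_def gnm_mult)
  have small: "rdiv t n = 0" if "t\<^sup>2 \<le> n" for t
  proof -
    have "(2 * \<bar>t\<bar>)\<^sup>2 < n\<^sup>2"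
    proof -
      have "(2 * \<bar>t\<bar>)\<^sup>2 \<le> 4 * n" using that by (simp add: power_mult_distrib)
      also have "4 * n < n * n" using n by simp
      finally show ?thesis by (simp add: power2_eq_square)
    qed
    then have "2 * \<bar>t\<bar> < n" by (rule power_less_imp_less_base) (use n in simp)
    then have "0 \<le> 2 * t + n" "2 * t + n < 2 * n" by linarith+
    then show ?thesis unfolding rdiv_def by (rule div_pos_pos_trivial)
  qed
  have "(gre Q)\<^sup>2 \<le> n" "(- gim Q)\<^sup>2 \<le> n" by (simp_all add: n_def gnm_def)
  then have "1 div Q = 0" using small by (simp add: divide_gint_def gint_eq_iff n_def)
  then have "1 mod Q = 1" by (simp add: modulo_gint_def)
  then show ?thesis by (simp add: Rset_def res_def Q_def)
qed

lemma Rset_norm_le: "q \<noteq> 0 \<Longrightarrow> r \<in> Rset q \<Longrightarrow> cmod (cof r) \<le> cmod (cof (lam * q))"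
proof -
  assume q: "q \<noteq> 0" "r \<in> Rset q"
  then have "2 * gnm r \<le> gnm (lam * q)" using gnm_mod_le[of "lam * q" r] by (simp add: Rset_def res_def)
  then have "gnm r \<le> gnm (lam * q)" using gnm_nonneg[of r] by linarith
  then have "(cmod (cof r))\<^sup>2 \<le> (cmod (cof (lam * q)))\<^sup>2" unfolding cmod_cof_power2 by simp
  then show ?thesis by (rule power2_le_imp_le) simp
qed

lemma cmod_cof_ge_1: "a \<noteq> 0 \<Longrightarrow> 1 \<le> cmod (cof a)"
proof -
  assume "a \<noteq> 0"
  then have "1 \<le> gnm a" by (simp add: int_one_le_iff_zero_less)
  then have "1\<^sup>2 \<le> (cmod (cof a))\<^sup>2" unfolding cmod_cof_power2 by simp
  then show ?thesis by (rule power2_le_imp_le) simp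
qed

text \<open>Write r = e + db with b nonzero. Then |d||b| \<le> |r| + 1 \<le> 2|r|, and |b| \<le>
  2X/|d| with X the absolute value of (1 + i)^3 q, so \<open>sum_inverse_abs\<close> bounds the sum
  by (2/|d|) * 12 * (2X/|d|) = 48 X/N(d). The weight N(d) cancels, and every divisor d contributes
  the same amount.\<close>

lemma sum_progression:
  assumes q: "q \<noteq> 0" and d: "d \<noteq> 0" and e: "cmod (cof e) = 1"
    and F: "F \<subseteq> Rset q" "e \<notin> F" "\<And>r. r \<in> F \<Longrightarrow> d dvd r - e"
  shows "of_int (gnm d) * (\<Sum>r\<in>F. 1 / cmod (cof r)) \<le> 48 * cmod (cof (lam * q))"
proof -
  define X where "X = cmod (cof (lam * q))"
  define D where "D = cmod (cof d)"
  have D: "D > 0" using d by (simp add: D_def)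
  have finF: "finite F" using F(1) finite_Rset[OF q] finite_subset by blast
  define b where "b r = (r - e) div d" for r
  have b: "r - e = d * b r" if "r \<in> F" for r using F(3)[OF that] by (simp add: b_def)
  have b0: "b r \<noteq> 0" if "r \<in> F" for r using b[OF that] F(2) that by auto
  have X1: "X \<ge> 1" unfolding X_def using q by (intro cmod_cof_ge_1) simp
  have r1: "1 \<le> cmod (cof r)" "cmod (cof r) \<le> X" if "r \<in> F" for r
    using that F(1) prim_nz Rset_norm_le[OF q] by (auto simp: X_def Rset_def intro!: cmod_cof_ge_1)
  have nb: "cmod (cof (r - e)) = D * cmod (cof (b r))" if "r \<in> F" for r
    by (subst b[OF that]) (simp add: D_def norm_mult del: gint_simps)
  have tri: "cmod (cof (r - e)) \<le> cmod (cof r) + 1" for r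
    using norm_triangle_ineq4[of "cof r" "cof e"] e by simp
  have "(\<Sum>r\<in>F. 1 / cmod (cof r)) \<le> (\<Sum>r\<in>F. (2 / D) * (1 / cmod (cof (b r))))"
  proof (rule sum_mono)
    fix r assume r: "r \<in> F"
    have "D * cmod (cof (b r)) \<le> 2 * cmod (cof r)" using tri[of r] r1[OF r] nb[OF r] by linarith
    moreover have "cmod (cof (b r)) > 0" using b0[OF r] by simp
    moreover have "cmod (cof r) > 0" using r1[OF r] by linarith
    ultimately show "1 / cmod (cof r) \<le> (2 / D) * (1 / cmod (cof (b r)))" using D by (simp add: field_simps)
  qed
  also have "\<dots> = (2 / D) * (\<Sum>z\<in>b ` F. 1 / cmod (cof z))"
  proof -
    have "inj_on b F"
    proof (rule inj_onI)
      fix r r' assume "r \<in> F" "r' \<in> F" "b r = b r'"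
      then have "r - e = r' - e" using b by simp
      then show "r = r'" by simp
    qed
    then show ?thesis by (simp add: sum.reindex sum_distrib_left)
  qed
  finally have s1: "(\<Sum>r\<in>F. 1 / cmod (cof r)) \<le> (2 / D) * (\<Sum>z\<in>b ` F. 1 / cmod (cof z))" .
  have s2: "(\<Sum>z\<in>b ` F. 1 / cmod (cof z)) \<le> 12 * (2 * X / D)"
  proof (rule sum_inverse_abs)
    show "0 \<notin> b ` F" using b0 by auto
    fix z assume "z \<in> b ` F"
    then obtain r where r: "r \<in> F" "z = b r" by auto
    have "D * cmod (cof z) \<le> 2 * X" unfolding r(2) using tri[of r] r1[OF r(1)] nb[OF r(1)] X1 by linarith
    then show "cmod (cof z) \<le> 2 * X / D" using D by (simp add: field_simps)
  qed (use finF X1 D in auto)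
  have "(\<Sum>r\<in>F. 1 / cmod (cof r)) \<le> (2 / D) * (12 * (2 * X / D))"
    by (rule order_trans[OF s1 mult_left_mono[OF s2]]) (use D in simp)
  then have "D\<^sup>2 * (\<Sum>r\<in>F. 1 / cmod (cof r)) \<le> D\<^sup>2 * ((2 / D) * (12 * (2 * X / D)))" by (intro mult_left_mono) auto
  also have "\<dots> = 48 * X" using D by (simp add: power2_eq_square)
  also have "D\<^sup>2 = of_int (gnm d)" by (simp add: D_def cmod_cof_power2)
  finally show ?thesis by (simp add: X_def)
qed

context
  fixes q :: gint and H :: "gint \<Rightarrow> complex" and C :: real
  assumes q: "q \<noteq> 0" "coprime q 2" and C: "C \<ge> 0"
    and H: "\<And>r. r \<in> Rset q \<Longrightarrow> cmod (H r - of_real (1 / cmod (cof r))) \<le> C / cmod (cof (lam * q))"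
begin

text \<open>The central value in the shape that \<open>hecke_L_half\<close> gives for nontrivial
  characters; as a finite sum it also makes sense for the trivial one, which enters the second
  moment when it is extended to all characters.\<close>

definition Lval :: "(complex set \<Rightarrow> complex) \<Rightarrow> complex" where
  "Lval \<phi> = (\<Sum>r\<in>{r\<in>Rset q. coprime r q}. \<phi> (rcl q r) * H r)"

lemma H_bound: "r \<in> Rset q \<Longrightarrow> cmod (H r) \<le> (1 + C) * (1 / cmod (cof r))"
proof -
  assume r: "r \<in> Rset q"
  have r1: "1 \<le> cmod (cof r)" using r prim_nz by (auto simp: Rset_def intro!: cmod_cof_ge_1)
  have "cmod (H r) \<le> cmod (H r - of_real (1 / cmod (cof r))) + 1 / cmod (cof r)"
    using norm_triangle_sub[of "H r" "of_real (1 / cmod (cof r))"] by (simp add: norm_divide)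
  also have "cmod (H r - of_real (1 / cmod (cof r))) \<le> C / cmod (cof (lam * q))" by (rule H[OF r])
  also have "\<dots> \<le> C / cmod (cof r)"
    using Rset_norm_le[OF q(1) r] C r1 by (intro divide_left_mono mult_pos_pos) linarith+
  finally have "cmod (H r) \<le> C / cmod (cof r) + 1 / cmod (cof r)" by simp
  then show ?thesis by (simp add: add_divide_distrib add.commute)
qed

text \<open>The group order may exceed the number of primitive characters by the factor W, up to a
  constant, and the sum over residues coprime to q is smaller than a logarithm by the same W.
  Neither factor alone is acceptable; in their product W cancels.\<close>

lemma second_moment:
  "(\<Sum>\<phi>\<in>odd_primitive_chars (cof q). (cmod (Lval \<phi>))\<^sup>2) \<le>
     (1 + C)\<^sup>2 * 12 * exp 144 * prim_count q * (1 + ln (8 * (of_int (gnm q))\<^sup>2))"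
proof -
  define A where "A = carrier (gunits (cof q))"
  define R where "R = {r\<in>Rset q. coprime r q}"
  define h where "h X = H (inv_into R (rcl q) X)" for X
  define W where "W = (\<Prod>p\<in>prime_factors q. 1 + 1 / real_of_int (gnm p))"
  have bij: "bij_betw (rcl q) R A" unfolding R_def A_def by (rule bij_Rset_gunits[OF q])
  have hr: "h (rcl q r) = H r" if "r \<in> R" for r
    using bij_betw_inv_into_left[OF bij that] by (simp add: h_def)
  have Lh: "Lval \<phi> = (\<Sum>X\<in>A. \<phi> X * h X)" for \<phi>
    unfolding Lval_def R_def[symmetric] sum.reindex_bij_betw[OF bij, symmetric] by (intro sum.cong refl) (simp add: hr)
  have finch: "finite (chars (gunits (cof q)))"
    by (rule comm_group.finite_chars[OF comm_group_gunits[OF q(1)] finite_gunits[OF q(1)]])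
  have "(\<Sum>\<phi>\<in>odd_primitive_chars (cof q). (cmod (Lval \<phi>))\<^sup>2) \<le> (\<Sum>\<phi>\<in>chars (gunits (cof q)). (cmod (Lval \<phi>))\<^sup>2)"
    by (rule sum_mono2[OF finch]) (auto simp: odd_primitive_chars_def primitive_char_iff[OF q(1)])
  also have "\<dots> = real (card A) * (\<Sum>X\<in>A. (cmod (h X))\<^sup>2)"
    unfolding Lh A_def by (rule char_parseval[OF q])
  also have "(\<Sum>X\<in>A. (cmod (h X))\<^sup>2) = (\<Sum>r\<in>R. (cmod (H r))\<^sup>2)"
    unfolding sum.reindex_bij_betw[OF bij, symmetric] by (intro sum.cong refl) (simp add: hr)
  also have "\<dots> \<le> (\<Sum>r\<in>R. (1 + C)\<^sup>2 * (1 / of_int (gnm r)))"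
  proof (rule sum_mono)
    fix r assume "r \<in> R"
    then have "(cmod (H r))\<^sup>2 \<le> ((1 + C) * (1 / cmod (cof r)))\<^sup>2" by (intro power_mono H_bound) (auto simp: R_def)
    then show "(cmod (H r))\<^sup>2 \<le> (1 + C)\<^sup>2 * (1 / of_int (gnm r))"
      unfolding cmod_cof_power2[symmetric] by (simp add: power_mult_distrib power_divide)
  qed
  also have "\<dots> = (1 + C)\<^sup>2 * (\<Sum>r\<in>R. 1 / of_int (gnm r))" by (simp only: sum_distrib_left)
  finally have 1: "(\<Sum>\<phi>\<in>odd_primitive_chars (cof q). (cmod (Lval \<phi>))\<^sup>2) \<le> real (card A) * ((1 + C)\<^sup>2 * (\<Sum>r\<in>R. 1 / of_int (gnm r)))"
    by (simp add: mult_left_mono)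
  define Nq where "Nq = real_of_int (gnm q)"
  have Nq: "Nq \<ge> 1" using q(1) by (simp add: Nq_def int_one_le_iff_zero_less)
  have sieve: "(\<Sum>r\<in>R. 1 / real_of_int (gnm r)) * W \<le> 12 * (1 + ln ((8 * Nq) * of_int (gnm q)))"
    unfolding W_def
  proof (rule sum_coprime_sieve[OF q(1)])
    show "finite R" using finite_Rset[OF q(1)] by (simp add: R_def)
    show "0 \<notin> R" using prim_nz by (auto simp: R_def Rset_def)
    fix r assume r: "r \<in> R"
    have "(cmod (cof r))\<^sup>2 \<le> (cmod (cof (lam * q)))\<^sup>2" using r by (intro power_mono Rset_norm_le[OF q(1)]) (auto simp: R_def)
    then show "coprime r q \<and> real_of_int (gnm r) \<le> 8 * Nq" using r
      unfolding cmod_cof_power2 gnm_mult gnm_lam by (simp add: R_def Nq_def)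
  qed (use Nq in simp)
  have W: "W \<ge> 1" unfolding W_def by (intro prod_ge_1) auto
  have sum0: "0 \<le> (\<Sum>r\<in>R. 1 / real_of_int (gnm r))" by (intro sum_nonneg) auto
  have idx: "real (card A) \<le> exp 144 * (prim_count q * W)"
  proof -
    have "exp (- 144) * real (card A) \<le> prim_count q * W"
      using prim_count_ge_index[OF q] unfolding A_def W_def .
    then have "exp 144 * (exp (- 144) * real (card A)) \<le> exp 144 * (prim_count q * W)" by (intro mult_left_mono) auto
    then show ?thesis by (simp add: mult.assoc[symmetric] exp_add[symmetric])
  qed
  have pc: "prim_count q \<ge> 0"
  proof -
    have "0 \<le> exp 144 * (prim_count q * W)" using idx by (rule order_trans[rotated]) simp
    then show ?thesis using W by (simp add: zero_le_mult_iff)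
  qed
  have "real (card A) * (\<Sum>r\<in>R. 1 / of_int (gnm r)) \<le> (exp 144 * (prim_count q * W)) * (\<Sum>r\<in>R. 1 / of_int (gnm r))"
    using idx sum0 by (rule mult_right_mono)
  also have "\<dots> = exp 144 * prim_count q * ((\<Sum>r\<in>R. 1 / of_int (gnm r)) * W)" by simp
  also have "\<dots> \<le> exp 144 * prim_count q * (12 * (1 + ln ((8 * Nq) * of_int (gnm q))))"
    using sieve pc by (intro mult_left_mono) auto
  finally have "(1 + C)\<^sup>2 * (real (card A) * (\<Sum>r\<in>R. 1 / of_int (gnm r))) \<le> (1 + C)\<^sup>2 * (exp 144 * prim_count q * (12 * (1 + ln ((8 * Nq) * of_int (gnm q)))))"
    by (intro mult_left_mono) auto
  then have "real (card A) * ((1 + C)\<^sup>2 * (\<Sum>r\<in>R. 1 / of_int (gnm r))) \<le>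
      (1 + C)\<^sup>2 * (exp 144 * prim_count q * (12 * (1 + ln ((8 * Nq) * of_int (gnm q)))))"
    by (simp only: mult.left_commute)
  with 1 have "(\<Sum>\<phi>\<in>odd_primitive_chars (cof q). (cmod (Lval \<phi>))\<^sup>2) \<le>
      (1 + C)\<^sup>2 * (exp 144 * prim_count q * (12 * (1 + ln ((8 * Nq) * of_int (gnm q)))))" by (rule order_trans)
  also have "(8 * Nq) * of_int (gnm q) = 8 * (real_of_int (gnm q))\<^sup>2" by (simp add: Nq_def power2_eq_square)
  also have "(1 + C)\<^sup>2 * (exp 144 * prim_count q * (12 * (1 + ln (8 * (real_of_int (gnm q))\<^sup>2)))) =
      (1 + C)\<^sup>2 * 12 * exp 144 * prim_count q * (1 + ln (8 * (real_of_int (gnm q))\<^sup>2))" by (simp only: mult_ac)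
  finally show ?thesis .
qed

text \<open>For each set S of prime factors the residues congruent to 1 or -1 modulo q/\<Prod>S are
  summed by \<open>sum_progression\<close> with a bound that does not depend on S, whence the number
  of subsets as a factor in Y. The same expansion evaluated at -1 shows that odd primitive
  characters make up about half of all primitive ones.\<close>

lemma first_moment:
  defines "Y \<equiv> 2 ^ card (prime_factors q) * cmod (cof (lam * q))"
  shows "cmod ((\<Sum>\<phi>\<in>odd_primitive_chars (cof q). Lval \<phi>) - of_nat (psi_star (cof q)) * H 1) \<le> 48 * (1 + C) * Y"
    and "real (psi_star (cof q)) \<ge> (prim_count q - Y) / 2"
proof -
  define R where "R = {r\<in>Rset q. coprime r q}"
  define P where "P = prime_factors q"
  define X where "X = cmod (cof (lam * q))"
  define d where "d S = q div \<Prod>S" for S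
  define v where "v a = (\<Sum>\<phi>\<in>odd_primitive_chars (cof q). \<phi> (rcl q a))" for a
  define B where "B a = (\<Sum>S\<in>Pow P. if d S dvd a - 1 then real_of_int (gnm (d S)) else 0)" for a
  have X1: "X \<ge> 1" unfolding X_def using q by (intro cmod_cof_ge_1) simp
  have finP: "finite P" by (simp add: P_def)
  have finR: "finite R" using finite_Rset[OF q(1)] by (simp add: R_def)
  have ds: "d S dvd q" "d S \<noteq> 0" if "S \<in> Pow P" for S
  proof -
    show "d S dvd q" unfolding d_def using prod_primes_dvd[OF q(1), of S] that by (metis P_def PowD dvd_div_mult_self dvd_triv_left)
    then show "d S \<noteq> 0" using q(1) by auto
  qed
  have v: "v a = (prim_sum q (rcl q a) - prim_sum q (rcl q (- a))) / 2" if "coprime a q" for a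
    unfolding v_def by (rule sum_odd_primitive[OF q that])
  have Bb: "cmod (prim_sum q (rcl q a)) \<le> B a" if "coprime a q" for a
    unfolding B_def d_def P_def by (rule prim_sum_bound[OF q that])
  have chone: "\<phi> (rcl q 1) = 1" if "\<phi> \<in> odd_primitive_chars (cof q)" for \<phi>
    using that comm_group.char_one[OF comm_group_gunits[OF q(1)], of \<phi>]
    by (simp add: odd_primitive_chars_def primitive_char_iff[OF q(1)] gunits_one[OF q(1)])
  have v1: "v 1 = of_nat (psi_star (cof q))"
  proof -
    have "v 1 = (\<Sum>\<phi>\<in>odd_primitive_chars (cof q). 1)" unfolding v_def by (intro sum.cong refl chone)
    then show ?thesis by (simp add: psi_star_def)
  qed
  have "2 * real (psi_star (cof q)) \<ge> prim_count q - B (- 1)"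
  proof -
    have "complex_of_real (2 * real (psi_star (cof q))) = of_real (prim_count q) - prim_sum q (rcl q (- 1))"
      using v[of 1] v1 prim_sum_one[OF q] by (simp add: mult.commute)
    then have "2 * real (psi_star (cof q)) = Re (of_real (prim_count q) - prim_sum q (rcl q (- 1)))" by (metis Re_complex_of_real)
    also have "\<dots> \<ge> prim_count q - cmod (prim_sum q (rcl q (- 1)))" using complex_Re_le_cmod[of "prim_sum q (rcl q (- 1))"] by simp
    finally show ?thesis using Bb[of "- 1"] by simp
  qed
  moreover have "B (- 1) \<le> Y"
  proof -
    \<comment> \<open>At a = -1 the condition says that \<open>d S\<close> divides 2; it also
      divides q, so it is a unit and has weight 1.\<close>
    have "B (- 1) \<le> (\<Sum>S\<in>Pow P. 1)"
      unfolding B_def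
    proof (rule sum_mono)
      fix S assume S: "S \<in> Pow P"
      show "(if d S dvd - 1 - 1 then real_of_int (gnm (d S)) else 0) \<le> 1"
      proof (cases "d S dvd - 1 - 1")
        case True
        have "(- 1 - 1 :: gint) = - 2" by simp
        then have "d S dvd 2" using True by (simp only: dvd_minus_iff)
        then have "d S dvd 1" using ds[OF S] q(2) coprime_common_divisor by blast
        then show ?thesis by (simp add: gint_unit_iff)
      qed simp
    qed
    also have "\<dots> = 2 ^ card P" using finP by (simp add: card_Pow)
    also have "\<dots> \<le> 2 ^ card P * X" using X1 by simp
    finally show ?thesis by (simp add: Y_def P_def X_def)
  qed
  ultimately show "real (psi_star (cof q)) \<ge> (prim_count q - Y) / 2" by simp
  have one: "1 \<in> R" using one_mem_Rset[OF q(1)] by (simp add: R_def)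
  have "(\<Sum>\<phi>\<in>odd_primitive_chars (cof q). Lval \<phi>) = (\<Sum>r\<in>R. v r * H r)"
    unfolding Lval_def R_def[symmetric] v_def sum_distrib_right by (rule sum.swap)
  also have "\<dots> = v 1 * H 1 + (\<Sum>r\<in>R - {1}. v r * H r)" by (rule sum.remove[OF finR one])
  finally have "(\<Sum>\<phi>\<in>odd_primitive_chars (cof q). Lval \<phi>) - of_nat (psi_star (cof q)) * H 1 = (\<Sum>r\<in>R - {1}. v r * H r)"
    by (simp add: v1)
  also have "cmod \<dots> \<le> (\<Sum>r\<in>R - {1}. cmod (v r * H r))" by (rule norm_sum)
  also have "\<dots> \<le> (\<Sum>r\<in>R - {1}. ((B r + B (- r)) / 2) * ((1 + C) * (1 / cmod (cof r))))"
  proof (rule sum_mono)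
    fix r assume r: "r \<in> R - {1}"
    then have cr: "coprime r q" "coprime (- r) q" "r \<in> Rset q" by (auto simp: R_def)
    have vb: "cmod (v r) \<le> (B r + B (- r)) / 2"
      using Bb[OF cr(1)] Bb[OF cr(2)] norm_triangle_ineq4[of "prim_sum q (rcl q r)" "prim_sum q (rcl q (- r))"]
      by (simp add: v[OF cr(1)] norm_divide)
    show "cmod (v r * H r) \<le> ((B r + B (- r)) / 2) * ((1 + C) * (1 / cmod (cof r)))"
      unfolding norm_mult by (rule mult_mono[OF vb H_bound[OF cr(3)] order_trans[OF norm_ge_zero vb] norm_ge_zero])
  qed
  also have "\<dots> = ((1 + C) / 2) * ((\<Sum>r\<in>R - {1}. B r * (1 / cmod (cof r))) + (\<Sum>r\<in>R - {1}. B (- r) * (1 / cmod (cof r))))"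
  proof -
    have alg: "((a + b) / 2) * ((1 + C) * y) = ((1 + C) / 2) * (a * y + b * y)" for a b y :: real by (simp add: field_simps)
    show ?thesis unfolding sum.distrib[symmetric] sum_distrib_left by (intro sum.cong refl alg)
  qed
  also have "\<dots> \<le> ((1 + C) / 2) * (48 * Y + 48 * Y)"
  proof -
    \<comment> \<open>One bound for both progressions, e = 1 and e = -1. The point e itself must be
      absent from the sum, as it would correspond to b = 0 in
      \<open>sum_progression\<close>.\<close>
    have prog: "(\<Sum>r\<in>R - {1}. B' r * (1 / cmod (cof r))) \<le> 48 * Y"
      if B': "\<And>r. B' r = (\<Sum>S\<in>Pow P. if d S dvd r - e then real_of_int (gnm (d S)) else 0)" and e: "cmod (cof e) = 1" "e \<notin> R - {1}" for B' e
    proof -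
      have "(\<Sum>r\<in>R - {1}. B' r * (1 / cmod (cof r))) =
          (\<Sum>r\<in>R - {1}. \<Sum>S\<in>Pow P. (if d S dvd r - e then real_of_int (gnm (d S)) else 0) * (1 / cmod (cof r)))"
        unfolding B' sum_distrib_right ..
      also have "\<dots> = (\<Sum>S\<in>Pow P. \<Sum>r\<in>R - {1}. (if d S dvd r - e then real_of_int (gnm (d S)) else 0) * (1 / cmod (cof r)))"
        by (rule sum.swap)
      also have "\<dots> \<le> (\<Sum>S\<in>Pow P. 48 * X)"
      proof (rule sum_mono)
        fix S assume S: "S \<in> Pow P"
        have "(\<Sum>r\<in>R - {1}. (if d S dvd r - e then real_of_int (gnm (d S)) else 0) * (1 / cmod (cof r))) =
            (\<Sum>r\<in>{r\<in>R - {1}. d S dvd r - e}. of_int (gnm (d S)) * (1 / cmod (cof r)))"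
          by (subst sum.inter_filter[OF finite_Diff[OF finR]]) (rule sum.cong[OF refl], simp)
        also have "\<dots> = of_int (gnm (d S)) * (\<Sum>r\<in>{r\<in>R - {1}. d S dvd r - e}. 1 / cmod (cof r))" by (simp only: sum_distrib_left)
        also have "\<dots> \<le> 48 * X"
          unfolding X_def using e ds[OF S] by (intro sum_progression[OF q(1), of _ e]) (auto simp: R_def)
        finally show "(\<Sum>r\<in>R - {1}. (if d S dvd r - e then real_of_int (gnm (d S)) else 0) * (1 / cmod (cof r))) \<le> 48 * X" .
      qed
      also have "\<dots> = 48 * Y" using finP by (simp add: card_Pow Y_def X_def P_def)
      finally show ?thesis .
    qed
    have "(\<Sum>r\<in>R - {1}. B r * (1 / cmod (cof r))) \<le> 48 * Y"
      by (rule prog[where e = 1]) (auto simp: B_def)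
    moreover have "(\<Sum>r\<in>R - {1}. B (- r) * (1 / cmod (cof r))) \<le> 48 * Y"
    proof (rule prog[where e = "- 1"])
      fix r
      have "d S dvd - r - 1 \<longleftrightarrow> d S dvd r - (- 1)" for S
      proof -
        have "- r - 1 = - (r - (- 1))" by simp
        then show ?thesis by (simp only: dvd_minus_iff)
      qed
      then show "B (- r) = (\<Sum>S\<in>Pow P. if d S dvd r - (- 1) then real_of_int (gnm (d S)) else 0)" by (simp only: B_def)
    next
      \<comment> \<open>-1 is not primary, since (1 + i)^3 does not divide -2; the progression
        through -1 therefore has no main term.\<close>
      show "- 1 \<notin> R - {1}" by (simp add: R_def Rset_def lam_dvd_iff)
    qed simp
    ultimately show ?thesis using C by (intro mult_left_mono add_mono) auto
  qed
  also have "\<dots> = 48 * (1 + C) * Y" by (simp add: field_simps)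
  finally show "cmod ((\<Sum>\<phi>\<in>odd_primitive_chars (cof q). Lval \<phi>) - of_nat (psi_star (cof q)) * H 1) \<le> 48 * (1 + C) * Y" .
qed

end

text \<open>Every unit class modulo q has a primary representative, so the values on ideals
  determine the character. This allows the Hecke characters to be counted through the characters
  modulo q.\<close>

lemma inj_hecke_char:
  assumes q: "q \<noteq> 0" "coprime q 2"
  shows "inj_on (hecke_char (cof q)) (characters (cof q))"
proof (rule inj_onI)
  fix \<phi> \<phi>' assume h: "\<phi> \<in> characters (cof q)" "\<phi>' \<in> characters (cof q)" "hecke_char (cof q) \<phi> = hecke_char (cof q) \<phi>'"
  have "\<phi> X = \<phi>' X" if "X \<in> carrier (gunits (cof q))" for X
  proof -
    have "X \<in> rcl q ` {r\<in>Rset q. coprime r q}" using that bij_Rset_gunits[OF q] by (simp add: bij_betw_def)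
    then obtain r where r: "r \<in> Rset q" "coprime r q" "X = rcl q r" by auto
    have "prim r" using r by (simp add: Rset_def)
    then have "cval q \<phi> r = cval q \<phi>' r" using hecke_char_cof[of r q] h(3) by metis
    then show ?thesis using r by (simp add: cval_def)
  qed
  then show "\<phi> = \<phi>'" using h by (intro extensionalityI[of \<phi> "carrier (gunits (cof q))"]) (auto simp: characters_def)
qed

section \<open>Nonvanishing from the comparison of the two moments\<close>

theorem corollary1p2:
  shows "\<exists>c>0. \<exists>N\<^sub>0. \<forall>q\<in>carrier gauss_int.
           coprime_ideals (gideal q) (gideal 2) \<and> gnorm q \<ge> N\<^sub>0 \<longrightarrow>
           real (card {hecke_char q \<phi> | \<phi>. \<phi> \<in> odd_primitive_chars q \<and>
                         hecke_L (hecke_char q \<phi>) (1/2) \<noteq> 0})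
             \<ge> c * (real (psi_star q) / ln (gnorm q))"
proof -
  obtain C where C: "C \<ge> 0" "\<And>q. q \<noteq> 0 \<Longrightarrow> coprime q 2 \<Longrightarrow> \<exists>H :: gint \<Rightarrow> complex.
     (\<forall>r\<in>Rset q. cmod (H r - of_real (1 / cmod (cof r))) \<le> C / cmod (cof (lam * q))) \<and>
     (\<forall>\<phi>\<in>characters (cof q). \<forall>X\<in>carrier (gunits (cof q)). \<phi> X \<noteq> 1 \<longrightarrow>
        hecke_L (hecke_char (cof q) \<phi>) (1/2) = (\<Sum>r\<in>Rset q. cval q \<phi> r * H r))"
    using hecke_L_half by blast
  obtain c1 where c1: "c1 > 0" "\<And>q. q \<noteq> 0 \<Longrightarrow> (\<forall>p\<in>prime_factors q. gnm p \<ge> 3) \<Longrightarrow>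
     (\<Prod>p\<in>prime_factors q. 1 - 2 / of_int (gnm p)) \<ge> c1 * 2 ^ card (prime_factors q) / (of_int (gnm q) :: real) powr (1/4)"
    using euler_product_growth by blast
  \<comment> \<open>The factor 24 is 4 * 6: \<open>prim_count\<close> is at most 4 psi, and 1 + ln
    (8 n^2) is at most 6 ln n. The rest is the constant of \<open>second_moment\<close>.\<close>
  define C2 where "C2 = (1 + C)\<^sup>2 * 12 * exp 144 * 24"
  \<comment> \<open>Lower bounds for t = N(q)^(1/4): 3 makes the norm at least 81 and its logarithm
    at least 1, 4C brings \<open>H 1\<close> within 1/4 of 1, and the last entry lets the number of
    primitive characters dominate the error of the first moment.\<close>
  define T where "T = Max {3, 4 * C, 2400 * (1 + C) / c1}"
  have T: "T \<ge> 3" "T \<ge> 4 * C" "T \<ge> 2400 * (1 + C) / c1" by (auto simp: T_def)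
  have C2: "C2 > 0" using C(1) by (simp add: C2_def add_pos_nonneg)
  have main: "real (card {hecke_char (cof q) \<phi> | \<phi>. \<phi> \<in> odd_primitive_chars (cof q) \<and> hecke_L (hecke_char (cof q) \<phi>) (1/2) \<noteq> 0})
     \<ge> 1 / (4 * C2) * (real (psi_star (cof q)) / ln (gnorm (cof q)))"
    if q2: "coprime q 2" and N: "gnorm (cof q) \<ge> T ^ 4" for q
  proof -
    define n where "n = real_of_int (gnm q)"
    have n: "n \<ge> T ^ 4" using N by (simp add: n_def gnorm_cof)
    have "T ^ 4 \<ge> 3 ^ 4" using T(1) by (intro power_mono) auto
    then have n3: "n \<ge> 81" using n by simp
    have q0: "q \<noteq> 0" using n3 by (auto simp: n_def)
    define t where "t = n powr (1/4)"
    have t4: "t ^ 4 = n"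
    proof -
      have "t ^ 4 = t powr 4" using n3 by (simp add: t_def powr_numeral)
      also have "\<dots> = n" using n3 by (simp add: t_def powr_powr)
      finally show ?thesis .
    qed
    have tT: "t \<ge> T"
    proof -
      have "T ^ 4 \<le> t ^ 4" using n t4 by simp
      then show ?thesis using power_le_imp_le_base[of T 3 t] by (simp add: t_def)
    qed
    have t3: "t \<ge> 3" using tT T by simp
    obtain H where H: "\<And>r. r \<in> Rset q \<Longrightarrow> cmod (H r - of_real (1 / cmod (cof r))) \<le> C / cmod (cof (lam * q))"
      "\<And>\<phi> X. \<phi> \<in> characters (cof q) \<Longrightarrow> X \<in> carrier (gunits (cof q)) \<Longrightarrow> \<phi> X \<noteq> 1 \<Longrightarrow>
        hecke_L (hecke_char (cof q) \<phi>) (1/2) = (\<Sum>r\<in>Rset q. cval q \<phi> r * H r)"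
      using C(2)[OF q0 q2] by blast
    define O' where "O' = odd_primitive_chars (cof q)"
    define psi where "psi = real (psi_star (cof q))"
    have O'ch: "\<phi> \<in> characters (cof q)" if "\<phi> \<in> O'" for \<phi> using that by (simp add: O'_def odd_primitive_chars_def primitive_char_def)
    have finO: "finite O'"
      by (rule finite_subset[OF _ finite_primitive[OF q0 q2]]) (auto simp: O'_def odd_primitive_chars_def)
    define L where "L = Lval q H"
    have LL: "hecke_L (hecke_char (cof q) \<phi>) (1/2) = L \<phi>" if "\<phi> \<in> O'" for \<phi>
    proof -
      \<comment> \<open>Oddness supplies the witness of nontriviality that
        \<open>hecke_L_half\<close> asks for: the value at -1 is -1.\<close>
      have "\<phi> (rcl q (- 1)) \<noteq> 1" using that residue_class_neg[OF q0 q2] by (simp add: O'_def odd_primitive_chars_def)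
      then have "hecke_L (hecke_char (cof q) \<phi>) (1/2) = (\<Sum>r\<in>Rset q. cval q \<phi> r * H r)"
        by (rule H(2)[OF O'ch[OF that] rcl_neg_mem[OF q0 q2]])
      then show ?thesis by (simp add: L_def Lval_def[OF q0 q2 C(1) H(1)] sum_cval_Rset[OF q0 q2])
    qed
    define Y where "Y = 2 ^ card (prime_factors q) * cmod (cof (lam * q))"
    define M1 where "M1 = (\<Sum>\<phi>\<in>O'. L \<phi>)"
    define M2 where "M2 = (\<Sum>\<phi>\<in>O'. (cmod (L \<phi>))\<^sup>2)"
    have X2: "(cmod (cof (lam * q)))\<^sup>2 = 8 * n" by (simp only: cmod_cof_power2 gnm_mult gnm_lam n_def of_int_mult of_int_numeral)
    have Xle: "cmod (cof (lam * q)) \<le> 3 * t\<^sup>2"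
    proof (rule power2_le_imp_le)
      have "(3 * t\<^sup>2)\<^sup>2 = 9 * t ^ 4" by (simp add: power_mult_distrib power_mult[symmetric])
      then show "(cmod (cof (lam * q)))\<^sup>2 \<le> (3 * t\<^sup>2)\<^sup>2" using X2 t4 n3 by simp
    qed simp
    have Xge: "cmod (cof (lam * q)) \<ge> t"
    proof (rule power2_le_imp_le)
      have "t\<^sup>2 \<le> t ^ 4" using t3 by (intro power_increasing) auto
      then show "t\<^sup>2 \<le> (cmod (cof (lam * q)))\<^sup>2" using X2 t4 n3 by simp
    qed simp
    \<comment> \<open>The lower bound grows like t^3 and Y like t^2, apart from the common power of
      2; 2400 = 800 * 3 because |Q| \<le> 3 t^2. The choice of 800 leaves psi \<ge> 200(1 + C)Y,
      more than four times the error 48(1 + C)Y, so at least psi/2 of the main term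
      survives.\<close>
    have pc: "prim_count q \<ge> 800 * (1 + C) * Y"
    proof -
      have "c1 * 2 ^ card (prime_factors q) / t \<le> (\<Prod>p\<in>prime_factors q. 1 - 2 / of_int (gnm p))"
        unfolding t_def n_def using gnm_prime_factor_ge_3[OF _ q2] by (intro c1(2)[OF q0]) auto
      then have "n * (c1 * 2 ^ card (prime_factors q) / t) \<le> n * (\<Prod>p\<in>prime_factors q. 1 - 2 / of_int (gnm p))"
        using n3 by (intro mult_left_mono) auto
      also have "\<dots> \<le> prim_count q" unfolding n_def by (rule prim_count_ge_product[OF q0 q2])
      finally have "n * (c1 * 2 ^ card (prime_factors q) / t) \<le> prim_count q" .
      moreover have "n * (c1 * 2 ^ card (prime_factors q) / t) = c1 * t * (2 ^ card (prime_factors q) * t\<^sup>2)"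
        using t3 by (simp add: t4[symmetric] field_simps eval_nat_numeral)
      moreover have "2400 * (1 + C) \<le> c1 * t"
      proof -
        have "2400 * (1 + C) / c1 \<le> t" using T tT by linarith
        then show ?thesis using c1(1) by (simp add: field_simps)
      qed
      then have "2400 * (1 + C) * (2 ^ card (prime_factors q) * t\<^sup>2) \<le> c1 * t * (2 ^ card (prime_factors q) * t\<^sup>2)"
        by (intro mult_right_mono) auto
      moreover have "800 * (1 + C) * Y \<le> 800 * (1 + C) * (2 ^ card (prime_factors q) * (3 * t\<^sup>2))"
        unfolding Y_def using Xle C(1) by (intro mult_left_mono) auto
      moreover have "800 * (1 + C) * (2 ^ card (prime_factors q) * (3 * t\<^sup>2)) = 2400 * (1 + C) * (2 ^ card (prime_factors q) * t\<^sup>2)"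
        by simp
      ultimately show ?thesis by linarith
    qed
    have Y0: "Y \<ge> 0" by (simp add: Y_def)
    have fm: "cmod (M1 - of_real psi * H 1) \<le> 48 * (1 + C) * Y" "psi \<ge> (prim_count q - Y) / 2"
      using first_moment[OF q0 q2 C(1) H(1)] by (simp_all add: M1_def L_def O'_def psi_def Y_def)
    have "2 * Y \<le> 800 * (1 + C) * Y" using C(1) Y0 by (intro mult_right_mono) auto
    then have "2 * Y \<le> prim_count q" using pc by (rule order_trans)
    then have psi1: "psi \<ge> prim_count q / 4" using fm(2) by simp
    moreover have "800 * (1 + C) * Y / 4 = 200 * (1 + C) * Y" by simp
    ultimately have psi: "psi \<ge> prim_count q / 4" "psi \<ge> 200 * (1 + C) * Y"
      using divide_right_mono[OF pc, of 4] by linarith+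
    have psi0: "psi \<ge> 0" by (simp add: psi_def)
    have "cmod (of_real psi * H 1) \<ge> psi * (3/4)"
    proof -
      have "cmod (H 1 - 1) \<le> C / cmod (cof (lam * q))" using H(1)[OF one_mem_Rset[OF q0]] by simp
      also have "\<dots> \<le> 1/4"
      proof -
        have "4 * C \<le> cmod (cof (lam * q))" using T(2) tT Xge by linarith
        moreover have "cmod (cof (lam * q)) > 0" using Xge t3 by linarith
        ultimately show ?thesis by (simp add: field_simps)
      qed
      finally have "cmod (H 1) \<ge> 3/4" using norm_triangle_ineq2[of 1 "1 - H 1"] by (simp add: norm_minus_commute)
      then have "psi * (3/4) \<le> psi * cmod (H 1)" using psi0 by (rule mult_left_mono)
      then show ?thesis using psi0 by (simp add: norm_mult)
    qed
    moreover have "cmod (of_real psi * H 1) \<le> cmod M1 + cmod (M1 - of_real psi * H 1)"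
      using norm_triangle_ineq4[of M1 "M1 - of_real psi * H 1"] by simp
    moreover have "48 * (1 + C) * Y \<le> psi / 4"
    proof -
      have "48 * (1 + C) * Y \<le> 50 * (1 + C) * Y" using C(1) Y0 by (intro mult_right_mono) auto
      moreover have "50 * (1 + C) * Y = 200 * (1 + C) * Y / 4" by simp
      ultimately show ?thesis using psi(2) by linarith
    qed
    ultimately have M1: "cmod M1 \<ge> psi / 2" using fm(1) by linarith
    have lnn: "ln n \<ge> 1"
    proof -
      have "exp 1 \<le> n" using exp_le n3 by linarith
      then show ?thesis using n3 by (simp add: ln_ge_iff)
    qed
    have M2: "M2 \<le> C2 * psi * ln n"
    proof -
      have "M2 \<le> (1 + C)\<^sup>2 * 12 * exp 144 * prim_count q * (1 + ln (8 * n\<^sup>2))"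
        unfolding M2_def L_def O'_def n_def by (rule second_moment[OF q0 q2 C(1) H(1)])
      also have "\<dots> \<le> (1 + C)\<^sup>2 * 12 * exp 144 * (4 * psi) * (6 * ln n)"
      proof (intro mult_mono)
        have "ln (8 * n\<^sup>2) = ln 8 + 2 * ln n" using n3 by (simp add: ln_mult ln_realpow)
        moreover have "ln (8::real) \<le> ln n" using n3 by simp
        ultimately show "1 + ln (8 * n\<^sup>2) \<le> 6 * ln n" using lnn by linarith
        have "n\<^sup>2 \<ge> 1" using n3 by (intro one_le_power) simp
        then have "8 * n\<^sup>2 \<ge> 1" by simp
        then show "0 \<le> 1 + ln (8 * n\<^sup>2)" using ln_ge_zero[of "8 * n\<^sup>2"] by linarith
      next
        have "0 \<le> 800 * (1 + C) * Y" using C(1) Y0 by simp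
        then show "0 \<le> prim_count q" using pc by (rule order_trans)
      qed (use psi psi0 C(1) in auto)
      also have "\<dots> = C2 * psi * ln n" by (simp add: C2_def)
      finally show ?thesis .
    qed
    define Z where "Z = {\<phi>\<in>O'. L \<phi> \<noteq> 0}"
    have finZ: "finite Z" using finO by (simp add: Z_def)
    have card_eq: "card {hecke_char (cof q) \<phi> | \<phi>. \<phi> \<in> odd_primitive_chars (cof q) \<and> hecke_L (hecke_char (cof q) \<phi>) (1/2) \<noteq> 0} = card Z"
    proof -
      have "{hecke_char (cof q) \<phi> | \<phi>. \<phi> \<in> odd_primitive_chars (cof q) \<and> hecke_L (hecke_char (cof q) \<phi>) (1/2) \<noteq> 0} = hecke_char (cof q) ` Z"
        unfolding Z_def O'_def[symmetric] using LL by auto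
      moreover have "inj_on (hecke_char (cof q)) Z"
        by (rule inj_on_subset[OF inj_hecke_char[OF q0 q2]]) (auto simp: Z_def O'ch)
      ultimately show ?thesis by (simp add: card_image)
    qed
    have "(cmod M1)\<^sup>2 \<le> real (card Z) * M2"
    proof -
      have "M1 = (\<Sum>\<phi>\<in>Z. L \<phi>)" unfolding M1_def by (rule sum.mono_neutral_right[OF finO]) (auto simp: Z_def)
      then have "cmod M1 \<le> (\<Sum>\<phi>\<in>Z. cmod (L \<phi>))" by (simp add: norm_sum)
      then have "(cmod M1)\<^sup>2 \<le> (\<Sum>\<phi>\<in>Z. 1 * cmod (L \<phi>))\<^sup>2" by (intro power_mono) auto
      also have "\<dots> \<le> (\<Sum>\<phi>\<in>Z. 1\<^sup>2) * (\<Sum>\<phi>\<in>Z. (cmod (L \<phi>))\<^sup>2)" by (rule Cauchy_Schwarz_ineq_sum)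
      also have "\<dots> \<le> real (card Z) * M2"
      proof -
        have "(\<Sum>\<phi>\<in>Z. (cmod (L \<phi>))\<^sup>2) \<le> M2" unfolding M2_def by (rule sum_mono2[OF finO]) (auto simp: Z_def)
        then show ?thesis by (simp add: mult_left_mono)
      qed
      finally show ?thesis .
    qed
    also have "\<dots> \<le> real (card Z) * (C2 * psi * ln n)" using M2 by (intro mult_left_mono) auto
    finally have cs: "(psi / 2)\<^sup>2 \<le> real (card Z) * (C2 * psi * ln n)"
      using M1 psi0 by (meson order_trans power_mono divide_nonneg_nonneg zero_le_numeral)
    have "psi / 4 \<le> real (card Z) * (C2 * ln n)"
    proof (cases "psi = 0")
      case True
      then show ?thesis using C2 lnn by simp
    next
      case False
      then have "psi > 0" using psi0 by simp
      moreover have "psi * (psi / 4) \<le> psi * (real (card Z) * (C2 * ln n))" using cs by (simp add: power2_eq_square mult_ac)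
      ultimately show ?thesis by (simp only: mult_le_cancel_left_pos)
    qed
    then have "1 / (4 * C2) * (psi / ln n) \<le> real (card Z)"
    proof -
      assume a: "psi / 4 \<le> real (card Z) * (C2 * ln n)"
      have "1 / (4 * C2) * (psi / ln n) = (psi / 4) / (C2 * ln n)" by simp
      also have "\<dots> \<le> real (card Z)" using a C2 lnn by (simp add: pos_divide_le_eq)
      finally show ?thesis .
    qed
    then show ?thesis unfolding card_eq psi_def n_def gnorm_cof .
  qed
  show ?thesis
  proof (rule exI[of _ "1 / (4 * C2)"], rule conjI[OF _ exI[of _ "T ^ 4"]], simp add: C2, intro ballI impI)
    fix q assume "q \<in> carrier gauss_int" and h: "coprime_ideals (gideal q) (gideal 2) \<and> gnorm q \<ge> T ^ 4"
    then obtain q' where q': "q = cof q'" by auto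
    have "(2 :: complex) = cof 2" by simp
    then have "coprime q' 2" using h unfolding q' by (simp only: coprime_ideals_cof)
    then show "real (card {hecke_char q \<phi> | \<phi>. \<phi> \<in> odd_primitive_chars q \<and> hecke_L (hecke_char q \<phi>) (1/2) \<noteq> 0})
        \<ge> 1 / (4 * C2) * (real (psi_star q) / ln (gnorm q))"
      unfolding q' using h main[of q'] by (simp only: q')
  qed
qed

end
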